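(* Let $\phi:A\to B$ be a $*$-homomorphism of C$^*$-algebras. (i) Suppose $p,q$ are projections in $M_\infty(\tilde A)$ and $v,v'$ are two partial isometries in $M_\infty(\tilde B)$ from $\phi(p)$ to $\phi(q)$. If there is a continuous path $v_t$ of partial isometries with $v_0=v$, $v_1=v'$, $v_t^*v_t=\phi(p)$ and $v_tv_t^*=\phi(q)$ for all $0\le t\le1$, then $[p,q,v]=[p,q,v']$ in $K_0(\phi)$. (ii) Suppose $p,q,r$ are projections in $M_\infty(\tilde A)$ and $v,w$ are partial isometries in $M_\infty(\tilde B)$ from $\phi(p)$ to $\phi(q)$ and from $\phi(q)$ to $\phi(r)$, respectively. Then $[p,q,v]+[q,r,w]=[p,r,wv]$. (iii) Let $(p,q,v)$ and $(p',q',v')$ be triples in $\Gamma_0(\phi)$. If $pp'=0$, then $$(p,q,v)\oplus(p',q',v')\cong\left(p+p',\,q\oplus q',\begin{bmatrix} v & 0 \\ v' & 0 \end{bmatrix}\right).$$ If $qq'=0$, then $$(p,q,v)\oplus(p',q',v')\cong\left(p\oplus p',\,q+q',\begin{bmatrix} v & v' \\ 0 & 0 \end{bmatrix}\right).$$ If $pp'=qq'=0$, then $(p,q,v)\oplus(p',q',v')\cong(p+p',q+q',v+v')$. (iv) Every triple in $\Gamma_0(\phi)$ is equivalent to one of the form $(p,1_n,v)$, where $n\ge1$ and $\dot p=\dot v=1_n$, and to one of the form $(1_n,q,v)$, where $n\ge1$ and $\dot q=\dot v=1_n$. (v) $[p,q,v]=0$ if and only if there exist projections $r,s$ in $M_\infty(\tilde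 A)$ and partial isometries $x,y$ in $M_\infty(\tilde A)$ from $p\oplus r$ to $s$ and from $q\oplus r$ to $s$, respectively, such that $\phi(y)(v\oplus\phi(r))\phi(x^* )$ and $\phi(s)$ are homotopic as unitaries through $\phi(s)M_\infty(\tilde B)\phi(s)$. Moreover, suppose $m\ge n$, $p$ is in $M_m(\tilde A)$, and $(p,1_n,v)$ is a triple in $\Gamma_0(\phi)$ with $\dot p=\dot v=1_n$. Then $[p,1_n,v]=0$ if and only if there exist $k\ge0$ and a partial isometry $w$ in $M_{m+k}(\tilde A)$ with $w^*w=\dot w=1_n\oplus0_{m-n}\oplus1_k$ and $ww^*=p\oplus1_k$ such that $(v\oplus1_k)\phi(w)$ and $1_n\oplus0_{m-n}\oplus1_k$ are homotopic as unitaries in $(1_n\oplus0_{m-n}\oplus1_k)M_{m+k}(\tilde B)(1_n\oplus0_{m-n}\oplus1_k)$.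
   Context: **Notation.** $\tilde A$ is the unitization of $A$ (a new unit is adjoined even if $A$ is already unital); for $a\in\tilde A$ (or a matrix over $\tilde A$, entrywise) $\dot a$ is its scalar part. $*$-homomorphisms are extended unitally to unitizations and entrywise to matrices, with the same letter. $M_\infty(\tilde A)=\bigcup_n M_n(\tilde A)$ with $M_n\subseteq M_{n+1}$ via $a\mapsto\mathrm{diag}(a,0)$; $a\oplus b$ is the block diagonal sum (the entries of one triple are regarded in a common $M_n$ before forming $\oplus$; the choice of $n$ is immaterial for the classes below); $1_n$ is the identity of $M_n$ and $0_k$ the zero of $M_k$. A partial isometry $v$ is "from $p$ to $q$" if $v^*v=p$, $vv^*=q$. **$K_0(\phi)$.** $\Gamma_0(\phi)$ is the set of triples $(p,q,v)$ with $p,q$ projections in $M_\infty(\tilde A)$ and $v$ a partial isometry in $M_\infty(\tilde B)$ from $\phi(p)$ to $\phi(q)$, with $(p,q,v)\oplus(p',q',v')=(p\oplus p',q\oplus q',v\oplus v')$. Triples are isomorphic, $(p,q,v)\cong(p',q',v')$, if there are partial isometries $c,d$ in $M_\infty(\tilde A)$ from $p$ to $p'$ and from $q$ to $q'$ with $\phi(d)v=v'\phi(c)$. A triple $(p,q,v)$ is elementary if $p=q$ and there is a continuous path $v_t$, $0\le t\le1$, with $v_0=\phi(p)$, $v_1=v$, $v_t^*v_t=v_tv_t^*=\phi(p)$ for all $t$. Triples $\sigma,\sigma'$ are equivalent, $\sigma\sim\sigma'$, if there are elementary $\tau,\tau'$ with $\sigma\oplus\tau\cong\sigma'\oplus\tau'$.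 $K_0(\phi)=\Gamma_0(\phi)/\!\sim$ with classes $[p,q,v]$; it is an abelian group under $[\sigma]+[\sigma']=[\sigma\oplus\sigma']$ with identity $[0,0,0]$. *)

theory Defs
  imports "HOL-Analysis.Analysis"
begin

section \<open>C*-algebras\<close>

class star_ring = ring +
  fixes star :: "'a \<Rightarrow> 'a"  ("(_\<^sup>\<star>)" [1000] 999)
  assumes star_star [simp]: "star (star x) = x"
    and star_add: "star (x + y) = star x + star y"
    and star_mult: "star (x * y) = star y * star x"

text \<open>
  A complex C*-algebra, not assumed unital (and possibly zero). The real normed structure is that of
  the library, and the complex scalar multiplication extends the real one.
\<close>

class cstar_algebra = real_normed_algebra + banach + star_ring +
  fixes scaleC :: "complex \<Rightarrow> 'a \<Rightarrow> 'a"  (infixr "*\<^sub>C" 75)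
  assumes scaleC_add_right: "c *\<^sub>C (x + y) = c *\<^sub>C x + c *\<^sub>C y"
    and scaleC_add_left: "(c + d) *\<^sub>C x = c *\<^sub>C x + d *\<^sub>C x"
    and scaleC_scaleC: "c *\<^sub>C (d *\<^sub>C x) = (c * d) *\<^sub>C x"
    and scaleR_scaleC: "scaleR r x = complex_of_real r *\<^sub>C x"
    and mult_scaleC_left: "(c *\<^sub>C x) * y = c *\<^sub>C (x * y)"
    and mult_scaleC_right: "x * (c *\<^sub>C y) = c *\<^sub>C (x * y)"
    and norm_scaleC: "norm (c *\<^sub>C x) = cmod c * norm x"
    and star_scaleC: "star (c *\<^sub>C x) = cnj c *\<^sub>C star x"
    and cstar_identity: "norm (star x * x) = (norm x)\<^sup>2"

instantiation complex :: cstar_algebra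
begin
definition "star_complex = cnj"
definition "scaleC_complex = ((*) :: complex \<Rightarrow> complex \<Rightarrow> complex)"
instance
  by standard
    (auto simp: star_complex_def scaleC_complex_def algebra_simps scaleR_conv_of_real
      norm_mult power2_eq_square)
end

definition star_hom :: "('a::cstar_algebra \<Rightarrow> 'b::cstar_algebra) \<Rightarrow> bool" where
  "star_hom \<phi> \<longleftrightarrow>
     (\<forall>x y. \<phi> (x + y) = \<phi> x + \<phi> y) \<and> (\<forall>c x. \<phi> (c *\<^sub>C x) = c *\<^sub>C \<phi> x) \<and>
     (\<forall>x y. \<phi> (x * y) = \<phi> x * \<phi> y) \<and> (\<forall>x. \<phi> (star x) = star (\<phi> x))"

lemma star_zero [simp]: "star (0::'a::star_ring) = 0"
  using star_add[of "0::'a" 0] by simp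

lemma star_minus: "star (- x) = - star (x::'a::star_ring)"
  using star_add[of x "- x"] by (simp add: add_eq_0_iff)

lemma star_sum: "star (sum f A) = (\<Sum>x\<in>A. star (f x :: 'a::star_ring))"
  by (induction A rule: infinite_finite_induct) (auto simp: star_add)

lemma scaleC_zero_left [simp]: "0 *\<^sub>C x = (0::'a::cstar_algebra)"
  using scaleC_add_left[of 0 0 x] by simp

lemma scaleC_zero_right [simp]: "c *\<^sub>C 0 = (0::'a::cstar_algebra)"
  using scaleC_add_right[of c 0 0] by simp

lemma scaleC_one [simp]: "1 *\<^sub>C x = (x::'a::cstar_algebra)"
  using scaleR_scaleC[of 1 x, symmetric] by simp

lemma scaleC_minus_left: "(- c) *\<^sub>C x = - (c *\<^sub>C (x::'a::cstar_algebra))"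
  using scaleC_add_left[of c "- c" x] by (simp add: eq_neg_iff_add_eq_0 add.commute)

lemma scaleC_minus_right: "c *\<^sub>C (- x) = - (c *\<^sub>C (x::'a::cstar_algebra))"
  using scaleC_add_right[of c x "- x"] by (simp add: eq_neg_iff_add_eq_0 add.commute)

lemma norm_star [simp]: "norm (star x) = norm (x::'a::cstar_algebra)"
proof -
  have le: "norm y \<le> norm (star y)" for y :: 'a
  proof (cases "norm y = 0")
    case False
    then have "norm y * norm y \<le> norm (star y) * norm y"
      using cstar_identity[of y] norm_mult_ineq[of "star y" y] by (simp add: power2_eq_square)
    with False show ?thesis by simp
  qed simp
  show ?thesis using le[of x] le[of "star x"] by simp
qed

section \<open>The unitization\<close>

text \<open>
  The element \<^term>\<open>Unitization a c\<close> is a + c1, where 1 is a new unit, also if the algebra already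
  has a unit.
\<close>

datatype 'a unitization = Unitization (alg_part: 'a) (scal_part: complex)

lemma unitization_eqI:
  "alg_part x = alg_part y \<Longrightarrow> scal_part x = scal_part y \<Longrightarrow> x = y"
  by (cases x; cases y) simp

text \<open>
  The norm is the C*-norm. For a nonunital algebra this is the operator norm of left multiplication,
  which dominates the modulus of the scalar part. For a unital algebra with unit e, left
  multiplication has kernel spanned by 1 - e, the unitization is the direct sum of the algebra and
  the complex numbers, and the maximum with the modulus of the scalar part gives its C*-norm.
\<close>

instantiation unitization :: (cstar_algebra) "{ring_1, real_normed_vector}"
begin

definition "0 = Unitization 0 0"
definition "1 = Unitization 0 1"
definition "x + y = Unitization (alg_part x + alg_part y) (scal_part x + scal_part y)"
definition "- x = Unitization (- alg_part x) (- scal_part x)"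
definition "x - y = Unitization (alg_part x - alg_part y) (scal_part x - scal_part y)"
definition "x * y = Unitization
  (alg_part x * alg_part y + scal_part x *\<^sub>C alg_part y + scal_part y *\<^sub>C alg_part x)
  (scal_part x * scal_part y)"
definition "scaleR r x = Unitization (r *\<^sub>R alg_part x) (complex_of_real r * scal_part x)"
definition "norm x = max (onorm (\<lambda>b. alg_part x * b + scal_part x *\<^sub>C b)) (cmod (scal_part x))"
definition "dist x y = norm (x - y :: 'a unitization)"
definition "sgn x = inverse (norm x) *\<^sub>R (x :: 'a unitization)"
definition [code del]: "(uniformity :: ('a unitization \<times> 'a unitization) filter) =
  (INF e\<in>{0<..}. principal {(x, y). dist x y < e})"
definition [code del]: "open (U :: 'a unitization set) \<longleftrightarrow>
  (\<forall>x\<in>U. eventually (\<lambda>(x', y). x' = x \<longrightarrow> y \<in> U) uniformity)"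

lemma unitization_sel [simp]:
  "alg_part (0 :: 'a unitization) = 0" "scal_part (0 :: 'a unitization) = 0"
  "alg_part (1 :: 'a unitization) = 0" "scal_part (1 :: 'a unitization) = 1"
  "alg_part (x + y) = alg_part x + alg_part (y :: 'a unitization)"
  "scal_part (x + y) = scal_part x + scal_part (y :: 'a unitization)"
  "alg_part (- x) = - alg_part (x :: 'a unitization)"
  "scal_part (- x) = - scal_part (x :: 'a unitization)"
  "alg_part (x - y) = alg_part x - alg_part (y :: 'a unitization)"
  "scal_part (x - y) = scal_part x - scal_part (y :: 'a unitization)"
  "alg_part (x * y) = alg_part x * alg_part y + scal_part x *\<^sub>C alg_part y
     + scal_part y *\<^sub>C alg_part (x :: 'a unitization)"
  "scal_part (x * y) = scal_part x * scal_part (y :: 'a unitization)"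
  "alg_part (r *\<^sub>R x) = r *\<^sub>R alg_part (x :: 'a unitization)"
  "scal_part (r *\<^sub>R x) = complex_of_real r * scal_part (x :: 'a unitization)"
  by (simp_all add: zero_unitization_def one_unitization_def plus_unitization_def
      uminus_unitization_def minus_unitization_def times_unitization_def scaleR_unitization_def)

abbreviation left_mult :: "'a unitization \<Rightarrow> 'a \<Rightarrow> 'a" where
  "left_mult x \<equiv> \<lambda>b. alg_part x * b + scal_part x *\<^sub>C b"

lemma norm_left_mult_le: "norm (left_mult x b) \<le> (norm (alg_part x) + cmod (scal_part x)) * norm b"
proof -
  have "norm (left_mult x b) \<le> norm (alg_part x * b) + norm (scal_part x *\<^sub>C b)"
    by (rule norm_triangle_ineq)
  also have "\<dots> \<le> norm (alg_part x) * norm b + cmod (scal_part x) * norm b"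
    using norm_mult_ineq[of "alg_part x" b] by (simp add: norm_scaleC)
  finally show ?thesis by (simp add: distrib_right)
qed

lemma bounded_linear_left_mult: "bounded_linear (left_mult x)"
proof (rule bounded_linear_intro)
  show "norm (left_mult x b) \<le> norm b * (norm (alg_part x) + cmod (scal_part x))" for b
    using norm_left_mult_le[of x b] by (simp add: mult.commute)
qed (auto simp: algebra_simps scaleC_add_right scaleR_scaleC scaleC_scaleC mult_scaleC_right)

lemma norm_unitization_le: "norm x \<le> norm (alg_part x) + cmod (scal_part (x :: 'a unitization))"
  unfolding norm_unitization_def by (intro max.boundedI onorm_bound norm_left_mult_le) auto

lemma norm_scal_part_le: "cmod (scal_part x) \<le> norm (x :: 'a unitization)"
  by (simp add: norm_unitization_def)

lemma norm_left_mult_le_norm: "norm (left_mult x b) \<le> norm (x :: 'a unitization) * norm b"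
proof -
  have "norm (left_mult x b) \<le> onorm (left_mult x) * norm b"
    by (rule onorm[OF bounded_linear_left_mult])
  also have "\<dots> \<le> norm x * norm b"
    by (intro mult_right_mono) (auto simp: norm_unitization_def)
  finally show ?thesis .
qed

lemma norm_alg_part_le: "norm (alg_part x) \<le> 2 * norm (x :: 'a unitization)"
proof -
  let ?a = "alg_part x"
  have "norm ?a * norm ?a = norm (?a * star ?a)"
    using cstar_identity[of "star ?a"] by (simp add: power2_eq_square)
  also have "\<dots> = norm (left_mult x (star ?a) - scal_part x *\<^sub>C star ?a)"
    by simp
  also have "\<dots> \<le> norm (left_mult x (star ?a)) + norm (scal_part x *\<^sub>C star ?a)"
    by (rule norm_triangle_ineq4)
  also have "\<dots> \<le> norm x * norm ?a + norm x * norm ?a"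
    using norm_left_mult_le_norm[of x "star ?a"] norm_scal_part_le[of x]
    by (intro add_mono) (auto simp: norm_scaleC intro: mult_right_mono)
  finally have "norm ?a * norm ?a \<le> (2 * norm x) * norm ?a" by simp
  then show ?thesis
    by (cases "norm ?a = 0") (auto simp: norm_unitization_def mult_le_cancel_right le_max_iff_disj)
qed

instance
proof
  fix x y z :: "'a unitization" and r s :: real
  show "x + y + z = x + (y + z)" "x + y = y + x" "0 + x = x" "- x + x = 0" "x - y = x + - y"
    "1 * x = x" "x * 1 = x" "r *\<^sub>R (x + y) = r *\<^sub>R x + r *\<^sub>R y"
    "(r + s) *\<^sub>R x = r *\<^sub>R x + s *\<^sub>R x" "r *\<^sub>R s *\<^sub>R x = (r * s) *\<^sub>R x" "1 *\<^sub>R x = x"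
    by (auto intro!: unitization_eqI simp: algebra_simps)
  show "(0 :: 'a unitization) \<noteq> 1"
    by (metis unitization_sel(2,4) zero_neq_one)
  show "x * y * z = x * (y * z)" "(x + y) * z = x * z + y * z" "x * (y + z) = x * y + x * z"
    by (auto intro!: unitization_eqI simp: algebra_simps scaleC_add_left scaleC_add_right
        scaleC_scaleC mult_scaleC_left mult_scaleC_right)
  show "dist x y = norm (x - y)" by (rule dist_unitization_def)
  show "sgn x = inverse (norm x) *\<^sub>R x" by (rule sgn_unitization_def)
  show "(uniformity :: ('a unitization \<times> 'a unitization) filter) =
      (INF e\<in>{0<..}. principal {(x, y). dist x y < e})"
    by (rule uniformity_unitization_def)
  show "open U \<longleftrightarrow> (\<forall>x\<in>U. \<forall>\<^sub>F (x', y) in uniformity. x' = x \<longrightarrow> y \<in> U)"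
    for U :: "'a unitization set"
    by (rule open_unitization_def)
  show "norm x = 0 \<longleftrightarrow> x = 0"
  proof
    assume "norm x = 0"
    then show "x = 0"
      using norm_alg_part_le[of x] norm_scal_part_le[of x] by (auto intro!: unitization_eqI)
  next
    assume "x = 0"
    then show "norm x = 0"
      by (simp add: norm_unitization_def onorm_zero)
  qed
  have "onorm (left_mult (x + y)) = onorm (\<lambda>b. left_mult x b + left_mult y b)"
    by (rule arg_cong[of _ _ onorm]) (simp add: fun_eq_iff algebra_simps scaleC_add_left)
  also have "\<dots> \<le> onorm (left_mult x) + onorm (left_mult y)"
    by (rule onorm_triangle) (rule bounded_linear_left_mult)+
  finally show "norm (x + y) \<le> norm x + norm y"
    using norm_triangle_ineq[of "scal_part x" "scal_part y"] unfolding norm_unitization_def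
    by (auto simp: max_def)
  have "onorm (left_mult (r *\<^sub>R x)) = onorm (\<lambda>b. r *\<^sub>R left_mult x b)"
    by (rule arg_cong[of _ _ onorm])
      (simp add: fun_eq_iff scaleC_add_right scaleR_scaleC scaleC_scaleC mult_scaleC_left)
  also have "\<dots> = \<bar>r\<bar> * onorm (left_mult x)"
    by (rule onorm_scaleR) (rule bounded_linear_left_mult)
  finally show "norm (r *\<^sub>R x) = \<bar>r\<bar> * norm x"
    unfolding norm_unitization_def
    by (simp add: norm_mult max_mult_distrib_left del: unitization_sel(13))
qed

end

instantiation unitization :: (cstar_algebra) cstar_algebra
begin

definition "star x = Unitization (star (alg_part x)) (cnj (scal_part x))"
definition "c *\<^sub>C x = Unitization (c *\<^sub>C alg_part x) (c * scal_part x)"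

lemma unitization_star_sel [simp]:
  "alg_part (star x) = star (alg_part (x :: 'a unitization))"
  "scal_part (star x) = cnj (scal_part (x :: 'a unitization))"
  "alg_part (c *\<^sub>C x) = c *\<^sub>C alg_part (x :: 'a unitization)"
  "scal_part (c *\<^sub>C x) = c * scal_part (x :: 'a unitization)"
  by (simp_all add: star_unitization_def scaleC_unitization_def)

lemma left_mult_mult: "left_mult (x * y) b = left_mult x (left_mult y b)"
  by (simp add: algebra_simps scaleC_add_right scaleC_scaleC mult_scaleC_left mult_scaleC_right)

lemma norm_unitization_mult_ineq: "norm (x * y) \<le> norm x * norm (y :: 'a unitization)"
proof -
  have 1: "onorm (left_mult (x * y)) \<le> norm x * norm y"
  proof (rule onorm_bound)
    fix b
    have "norm (left_mult (x * y) b) \<le> norm x * norm (left_mult y b)"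
      unfolding left_mult_mult by (rule norm_left_mult_le_norm)
    also have "\<dots> \<le> norm x * (norm y * norm b)"
      by (intro mult_left_mono norm_left_mult_le_norm) simp
    finally show "norm (left_mult (x * y) b) \<le> norm x * norm y * norm b"
      by (simp add: mult.assoc)
  qed simp
  have 2: "cmod (scal_part (x * y)) \<le> norm x * norm y"
    by (simp add: norm_mult mult_mono norm_scal_part_le)
  show ?thesis
    unfolding norm_unitization_def[of "x * y"] using 1 2 by (rule max.boundedI)
qed

lemma norm_unitization_cstar_le: "(norm x)\<^sup>2 \<le> norm (star x * (x :: 'a unitization))"
proof -
  let ?N = "norm (star x * x)"
  have 1: "onorm (left_mult x) \<le> sqrt ?N"
  proof (rule onorm_bound)
    fix b
    have "(norm (left_mult x b))\<^sup>2 = norm (star (left_mult x b) * left_mult x b)"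
      by (simp add: cstar_identity)
    also have "star (left_mult x b) * left_mult x b = star b * left_mult (star x * x) b"
      by (simp add: algebra_simps star_add star_mult star_scaleC scaleC_add_right scaleC_scaleC
          mult_scaleC_left mult_scaleC_right)
    also have "norm \<dots> \<le> norm (star b) * norm (left_mult (star x * x) b)"
      by (rule norm_mult_ineq)
    also have "\<dots> \<le> norm b * (?N * norm b)"
      using norm_left_mult_le_norm[of "star x * x" b] by (simp add: mult_left_mono)
    also have "\<dots> = (sqrt ?N * norm b)\<^sup>2"
      by (simp add: power2_eq_square)
    finally show "norm (left_mult x b) \<le> sqrt ?N * norm b"
      by (rule power2_le_imp_le) simp
  qed simp
  have 2: "cmod (scal_part x) \<le> sqrt ?N"
    using norm_scal_part_le[of "star x * x"]
    by (intro real_le_rsqrt) (simp add: norm_mult power2_eq_square)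
  have "norm x \<le> sqrt ?N"
    unfolding norm_unitization_def[of x] using 1 2 by (rule max.boundedI)
  then show ?thesis
    using power_mono[of "norm x" "sqrt ?N" 2] by simp
qed

lemma norm_unitization_star_le: "norm (x :: 'a unitization) \<le> norm (star x)"
proof (cases "norm x = 0")
  case False
  have "norm x * norm x \<le> norm (star x) * norm x"
    using norm_unitization_cstar_le[of x] norm_unitization_mult_ineq[of "star x" x]
    unfolding power2_eq_square by (rule order_trans)
  with False show ?thesis
    by (metis mult_right_le_imp_le norm_ge_zero order_le_less)
qed simp

instance
proof
  fix x y :: "'a unitization" and c d :: complex and r :: real
  show "star (star x) = x" "star (x + y) = star x + star y" "star (x * y) = star y * star x"
    "c *\<^sub>C (x + y) = c *\<^sub>C x + c *\<^sub>C y" "(c + d) *\<^sub>C x = c *\<^sub>C x + d *\<^sub>C x"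
    "c *\<^sub>C (d *\<^sub>C x) = (c * d) *\<^sub>C x" "r *\<^sub>R x = complex_of_real r *\<^sub>C x"
    "(c *\<^sub>C x) * y = c *\<^sub>C (x * y)" "x * (c *\<^sub>C y) = c *\<^sub>C (x * y)"
    "star (c *\<^sub>C x) = cnj c *\<^sub>C star x"
    "(r *\<^sub>R x) * y = r *\<^sub>R (x * y)" "x * (r *\<^sub>R y) = r *\<^sub>R (x * y)"
    by (auto intro!: unitization_eqI simp: algebra_simps star_add star_mult star_scaleC
        scaleC_add_left scaleC_add_right scaleC_scaleC mult_scaleC_left mult_scaleC_right
        scaleR_scaleC scaleR_conv_of_real)
  show "norm (x * y) \<le> norm x * norm y"
    by (rule norm_unitization_mult_ineq)
  have "onorm (left_mult (c *\<^sub>C x)) = cmod c * onorm (left_mult x)"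
  proof -
    have eq: "left_mult (c *\<^sub>C x) = (\<lambda>b. c *\<^sub>C left_mult x b)"
      by (simp add: fun_eq_iff scaleC_add_right scaleC_scaleC mult_scaleC_left)
    have "onorm (\<lambda>b. c *\<^sub>C left_mult x b) = onorm (\<lambda>b. cmod c *\<^sub>R left_mult x b)"
      unfolding onorm_def by (simp add: norm_scaleC)
    also have "\<dots> = cmod c * onorm (left_mult x)"
      by (subst onorm_scaleR[OF bounded_linear_left_mult]) simp
    finally show ?thesis by (simp only: eq)
  qed
  then show "norm (c *\<^sub>C x) = cmod c * norm x"
    unfolding norm_unitization_def
    by (simp add: norm_mult max_mult_distrib_left del: unitization_star_sel(3))
  show "norm (star x * x) = (norm x)\<^sup>2"
  proof (rule antisym)
    have "norm (star x) \<le> norm x"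
      using norm_unitization_star_le[of "star x"] by (simp add: star_unitization_def)
    then have "norm (star x) * norm x \<le> norm x * norm x"
      by (rule mult_right_mono) simp
    with norm_unitization_mult_ineq show "norm (star x * x) \<le> (norm x)\<^sup>2"
      unfolding power2_eq_square by (rule order_trans)
  qed (rule norm_unitization_cstar_le)
next
  fix X :: "nat \<Rightarrow> 'a unitization"
  assume X: "Cauchy X"
  have a: "Cauchy (\<lambda>n. alg_part (X n))"
  proof (rule CauchyI)
    fix e :: real assume "0 < e"
    then obtain M where "\<forall>m\<ge>M. \<forall>n\<ge>M. norm (X m - X n) < e / 2"
      using CauchyD[OF X, of "e / 2"] by auto
    moreover have "norm (alg_part (X m) - alg_part (X n)) \<le> 2 * norm (X m - X n)" for m n
      using norm_alg_part_le[of "X m - X n"] by simp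
    ultimately show "\<exists>M. \<forall>m\<ge>M. \<forall>n\<ge>M. norm (alg_part (X m) - alg_part (X n)) < e"
      by (intro exI[of _ M]) (smt (verit) field_sum_of_halves)
  qed
  have s: "Cauchy (\<lambda>n. scal_part (X n))"
  proof (rule CauchyI)
    fix e :: real assume "0 < e"
    then obtain M where "\<forall>m\<ge>M. \<forall>n\<ge>M. norm (X m - X n) < e"
      using CauchyD[OF X, of e] by auto
    moreover have "norm (scal_part (X m) - scal_part (X n)) \<le> norm (X m - X n)" for m n
      using norm_scal_part_le[of "X m - X n"] by simp
    ultimately show "\<exists>M. \<forall>m\<ge>M. \<forall>n\<ge>M. norm (scal_part (X m) - scal_part (X n)) < e"
      by (intro exI[of _ M]) (smt (verit))
  qed
  obtain u where u: "(\<lambda>n. alg_part (X n)) \<longlonglongrightarrow> u"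
    using Cauchy_convergent[OF a] unfolding convergent_def by blast
  obtain c where c: "(\<lambda>n. scal_part (X n)) \<longlonglongrightarrow> c"
    using Cauchy_convergent[OF s] unfolding convergent_def by blast
  have "(\<lambda>n. norm (alg_part (X n) - u) + cmod (scal_part (X n) - c)) \<longlonglongrightarrow> 0 + 0"
    using u c by (intro tendsto_add) (simp_all add: LIM_zero_iff tendsto_norm_zero)
  then have lim: "(\<lambda>n. norm (alg_part (X n) - u) + cmod (scal_part (X n) - c)) \<longlonglongrightarrow> 0"
    by simp
  have "norm (X n - Unitization u c) \<le> norm (alg_part (X n) - u) + cmod (scal_part (X n) - c)" for n
    using norm_unitization_le[of "X n - Unitization u c"] by simp
  then have "(\<lambda>n. X n - Unitization u c) \<longlonglongrightarrow> 0"
    by (intro Lim_null_comparison[OF _ lim] always_eventually allI)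
  then have "X \<longlonglongrightarrow> Unitization u c"
    by (rule LIM_zero_cancel)
  then show "convergent X"
    by (rule convergentI)
qed

end

definition unitize :: "('a \<Rightarrow> 'b) \<Rightarrow> 'a unitization \<Rightarrow> 'b unitization" where
  "unitize \<phi> x = Unitization (\<phi> (alg_part x)) (scal_part x)"

definition scalar :: "'a::zero unitization \<Rightarrow> 'a unitization" where
  "scalar x = Unitization 0 (scal_part x)"

section \<open>The algebra of finite matrices of arbitrary size\<close>

text \<open>
  The union of all matrix algebras: an element is an infinite matrix whose entries vanish outside
  some square in the upper left corner, so that a and diag(a,0) are the same element.
\<close>

typedef (overloaded) ('a::zero) minf =
  "{a :: nat \<Rightarrow> nat \<Rightarrow> 'a. \<exists>n. \<forall>i j. i \<ge> n \<or> j \<ge> n \<longrightarrow> a i j = 0}"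
  morphisms entry Minf
  by (rule exI[of _ "\<lambda>_ _. 0"]) simp

setup_lifting type_definition_minf

definition fin_mat :: "nat \<Rightarrow> 'a::zero minf set" where
  "fin_mat n = {a. \<forall>i j. i \<ge> n \<or> j \<ge> n \<longrightarrow> entry a i j = 0}"

lemma minf_eqI: "(\<And>i j. entry a i j = entry b i j) \<Longrightarrow> a = b"
  by (metis entry_inject ext)

lemma mat_exhaust: "\<exists>n. a \<in> fin_mat n"
  using entry[of a] by (auto simp: fin_mat_def)

lemma mat_mono: "n \<le> m \<Longrightarrow> fin_mat n \<subseteq> fin_mat m"
  by (auto simp: fin_mat_def)

instantiation minf :: (zero) zero
begin
lift_definition zero_minf :: "'a minf" is "\<lambda>_ _. 0" by simp
instance ..
end

instantiation minf :: (star_ring) star_ring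
begin

lift_definition plus_minf :: "'a minf \<Rightarrow> 'a minf \<Rightarrow> 'a minf" is "\<lambda>a b i j. a i j + b i j"
proof -
  fix a b :: "nat \<Rightarrow> nat \<Rightarrow> 'a"
  assume "\<exists>n. \<forall>i j. i \<ge> n \<or> j \<ge> n \<longrightarrow> a i j = 0" "\<exists>n. \<forall>i j. i \<ge> n \<or> j \<ge> n \<longrightarrow> b i j = 0"
  then obtain n m where "\<forall>i j. i \<ge> n \<or> j \<ge> n \<longrightarrow> a i j = 0" "\<forall>i j. i \<ge> m \<or> j \<ge> m \<longrightarrow> b i j = 0"
    by blast
  then show "\<exists>n. \<forall>i j. i \<ge> n \<or> j \<ge> n \<longrightarrow> a i j + b i j = 0"
    by (intro exI[of _ "max n m"]) auto
qed

lift_definition minus_minf :: "'a minf \<Rightarrow> 'a minf \<Rightarrow> 'a minf" is "\<lambda>a b i j. a i j - b i j"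
proof -
  fix a b :: "nat \<Rightarrow> nat \<Rightarrow> 'a"
  assume "\<exists>n. \<forall>i j. i \<ge> n \<or> j \<ge> n \<longrightarrow> a i j = 0" "\<exists>n. \<forall>i j. i \<ge> n \<or> j \<ge> n \<longrightarrow> b i j = 0"
  then obtain n m where "\<forall>i j. i \<ge> n \<or> j \<ge> n \<longrightarrow> a i j = 0" "\<forall>i j. i \<ge> m \<or> j \<ge> m \<longrightarrow> b i j = 0"
    by blast
  then show "\<exists>n. \<forall>i j. i \<ge> n \<or> j \<ge> n \<longrightarrow> a i j - b i j = 0"
    by (intro exI[of _ "max n m"]) auto
qed

lift_definition uminus_minf :: "'a minf \<Rightarrow> 'a minf" is "\<lambda>a i j. - a i j" by simp

lift_definition times_minf :: "'a minf \<Rightarrow> 'a minf \<Rightarrow> 'a minf"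
  is "\<lambda>a b i j. \<Sum>k | a i k \<noteq> 0. a i k * b k j"
proof -
  fix a b :: "nat \<Rightarrow> nat \<Rightarrow> 'a"
  assume "\<exists>n. \<forall>i j. i \<ge> n \<or> j \<ge> n \<longrightarrow> a i j = 0" "\<exists>n. \<forall>i j. i \<ge> n \<or> j \<ge> n \<longrightarrow> b i j = 0"
  then obtain n m where "\<forall>i j. i \<ge> n \<or> j \<ge> n \<longrightarrow> a i j = 0" "\<forall>i j. i \<ge> m \<or> j \<ge> m \<longrightarrow> b i j = 0"
    by blast
  then show "\<exists>n. \<forall>i j. i \<ge> n \<or> j \<ge> n \<longrightarrow> (\<Sum>k | a i k \<noteq> 0. a i k * b k j) = 0"
    by (intro exI[of _ "max n m"]) auto
qed

lift_definition star_minf :: "'a minf \<Rightarrow> 'a minf" is "\<lambda>a i j. star (a j i)"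
  by (metis star_zero)

lemma entry_mult:
  assumes "a \<in> fin_mat n \<or> b \<in> fin_mat n"
  shows "entry (a * b) i j = (\<Sum>k<n. entry a i k * entry b k j)"
proof -
  obtain m where m: "a \<in> fin_mat m" using mat_exhaust by blast
  have "entry (a * b) i j = (\<Sum>k | entry a i k \<noteq> 0. entry a i k * entry b k j)"
    by (simp add: times_minf.rep_eq)
  also have "\<dots> = (\<Sum>k<max n m. entry a i k * entry b k j)"
    using m by (intro sum.mono_neutral_left) (auto simp: fin_mat_def not_le[symmetric])
  also have "\<dots> = (\<Sum>k<n. entry a i k * entry b k j)"
    using assms by (intro sum.mono_neutral_right) (auto simp: fin_mat_def)
  finally show ?thesis .
qed

lemma mult_mat: "a \<in> fin_mat n \<Longrightarrow> b \<in> fin_mat n \<Longrightarrow> a * b \<in> fin_mat n"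
  by (simp add: fin_mat_def times_minf.rep_eq)

instance
proof
  fix a b c :: "'a minf"
  show "a + b + c = a + (b + c)" "a + b = b + a" "0 + a = a" "- a + a = 0" "a - b = a + - b"
    "star (star a) = a" "star (a + b) = star a + star b"
    by (auto intro!: minf_eqI simp: plus_minf.rep_eq minus_minf.rep_eq uminus_minf.rep_eq
        zero_minf.rep_eq star_minf.rep_eq algebra_simps star_add)
  obtain n1 n2 n3 where "a \<in> fin_mat n1" "b \<in> fin_mat n2" "c \<in> fin_mat n3"
    using mat_exhaust by blast
  then obtain n where a: "a \<in> fin_mat n" and b: "b \<in> fin_mat n" and c: "c \<in> fin_mat n"
    using mat_mono[of n1 "n1 + n2 + n3"] mat_mono[of n2 "n1 + n2 + n3"]
      mat_mono[of n3 "n1 + n2 + n3"] by auto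
  show "a * b * c = a * (b * c)"
  proof (rule minf_eqI)
    fix i j
    have "entry (a * b * c) i j
        = (\<Sum>k<n. \<Sum>l<n. entry a i l * entry b l k * entry c k j)"
      using a c by (simp add: entry_mult[of _ n] sum_distrib_right)
    also have "\<dots> = (\<Sum>l<n. \<Sum>k<n. entry a i l * entry b l k * entry c k j)"
      by (rule sum.swap)
    also have "\<dots> = entry (a * (b * c)) i j"
      using a b by (simp add: entry_mult[of _ n] sum_distrib_left mult.assoc)
    finally show "entry (a * b * c) i j = entry (a * (b * c)) i j" .
  qed
  show "(a + b) * c = a * c + b * c"
    using c by (intro minf_eqI)
      (simp add: entry_mult[of _ n] plus_minf.rep_eq distrib_right sum.distrib)
  show "a * (b + c) = a * b + a * c"
    using a by (intro minf_eqI)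
      (simp add: entry_mult[of _ n] plus_minf.rep_eq distrib_left sum.distrib)
  have "star a \<in> fin_mat n"
    using a by (auto simp: fin_mat_def star_minf.rep_eq)
  then show "star (a * b) = star b * star a"
    using a by (intro minf_eqI)
      (simp add: entry_mult[of _ n] star_minf.rep_eq star_sum star_mult)
qed

end

lift_definition id_mat :: "nat \<Rightarrow> 'a::{zero,one} minf"
  is "\<lambda>n i j. if i = j \<and> i < n then 1 else 0"
  by (metis leD)

text \<open>Entrywise application; the test makes this total and is irrelevant when f 0 = 0.\<close>

lift_definition map_minf :: "('a::zero \<Rightarrow> 'b::zero) \<Rightarrow> 'a minf \<Rightarrow> 'b minf"
  is "\<lambda>f a i j. if a i j = 0 then 0 else f (a i j)"
  by auto

text \<open>
  The block matrix with rows (a, b) and (c, d), where a occupies the upper left n by n corner.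
  It is the intended matrix if a lies in \<^term>\<open>fin_mat n\<close>, b has its nonzero entries in the first n
  rows, and c has its nonzero entries in the first n columns.
\<close>

lift_definition block_mat :: "nat \<Rightarrow> 'a::zero minf \<Rightarrow> 'a minf \<Rightarrow> 'a minf \<Rightarrow> 'a minf \<Rightarrow> 'a minf"
  is "\<lambda>n a b c d i j.
    if i < n then (if j < n then a i j else b i (j - n))
    else (if j < n then c (i - n) j else d (i - n) (j - n))"
proof -
  fix n and a b c d :: "nat \<Rightarrow> nat \<Rightarrow> 'a"
  assume "\<exists>n. \<forall>i j. i \<ge> n \<or> j \<ge> n \<longrightarrow> a i j = 0" "\<exists>n. \<forall>i j. i \<ge> n \<or> j \<ge> n \<longrightarrow> b i j = 0"
    "\<exists>n. \<forall>i j. i \<ge> n \<or> j \<ge> n \<longrightarrow> c i j = 0" "\<exists>n. \<forall>i j. i \<ge> n \<or> j \<ge> n \<longrightarrow> d i j = 0"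
  then obtain n1 n2 n3 n4 where
    "\<forall>i j. i \<ge> n1 \<or> j \<ge> n1 \<longrightarrow> a i j = 0" "\<forall>i j. i \<ge> n2 \<or> j \<ge> n2 \<longrightarrow> b i j = 0"
    "\<forall>i j. i \<ge> n3 \<or> j \<ge> n3 \<longrightarrow> c i j = 0" "\<forall>i j. i \<ge> n4 \<or> j \<ge> n4 \<longrightarrow> d i j = 0"
    by blast
  then show "\<exists>N. \<forall>i j. i \<ge> N \<or> j \<ge> N \<longrightarrow>
      (if i < n then (if j < n then a i j else b i (j - n))
       else (if j < n then c (i - n) j else d (i - n) (j - n))) = 0"
    by (intro exI[of _ "n + n1 + n2 + n3 + n4"]) auto
qed

abbreviation dsum :: "'a::zero minf \<Rightarrow> nat \<Rightarrow> 'a minf \<Rightarrow> 'a minf"  ("(_ \<oplus>\<^bsub>_\<^esub> _)" [66, 0, 65] 65)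
  where "a \<oplus>\<^bsub>n\<^esub> b \<equiv> block_mat n a 0 0 b"

definition projection :: "'a::star_ring \<Rightarrow> bool" where
  "projection p \<longleftrightarrow> star p = p \<and> p * p = p"

definition partial_isometry :: "'a::star_ring \<Rightarrow> bool" where
  "partial_isometry v \<longleftrightarrow> v * star v * v = v"

definition partial_isometry_from_to :: "'a::star_ring \<Rightarrow> 'a \<Rightarrow> 'a \<Rightarrow> bool" where
  "partial_isometry_from_to v p q \<longleftrightarrow> partial_isometry v \<and> star v * v = p \<and> v * star v = q"

text \<open>
  A continuous path, parametrized by the unit interval, in a matrix algebra over a C*-algebra.
  On matrices of a fixed size, the topology of the C*-norm is that of entrywise convergence.
\<close>

definition matrix_path :: "(real \<Rightarrow> 'a::cstar_algebra minf) \<Rightarrow> bool" where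
  "matrix_path V \<longleftrightarrow> (\<exists>n. \<forall>t\<in>{0..1}. V t \<in> fin_mat n) \<and>
     (\<forall>i j. continuous_on {0..1} (\<lambda>t. entry (V t) i j))"

text \<open>The unitaries of the corner eRe, for a projection e in the matrix algebra R.\<close>

definition corner_unitaries :: "'a::star_ring set \<Rightarrow> 'a \<Rightarrow> 'a set" where
  "corner_unitaries R e = {u. (\<exists>a\<in>R. u = e * a * e) \<and> star u * u = e \<and> u * star u = e}"

definition homotopic_unitaries ::
  "'a::cstar_algebra minf set \<Rightarrow> 'a minf \<Rightarrow> 'a minf \<Rightarrow> 'a minf \<Rightarrow> bool" where
  "homotopic_unitaries R e u u' \<longleftrightarrow>
     (\<exists>V. matrix_path V \<and> V 0 = u \<and> V 1 = u' \<and> (\<forall>t\<in>{0..1}. V t \<in> corner_unitaries R e))"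

section \<open>The relative group of a homomorphism\<close>

abbreviation amplify ::
  "('a::cstar_algebra \<Rightarrow> 'b::cstar_algebra) \<Rightarrow> 'a unitization minf \<Rightarrow> 'b unitization minf"
  where "amplify \<phi> \<equiv> map_minf (unitize \<phi>)"

abbreviation scalar_mat :: "'a::cstar_algebra unitization minf \<Rightarrow> 'a unitization minf" where
  "scalar_mat \<equiv> map_minf scalar"

type_synonym ('a, 'b) triple = "'a unitization minf \<times> 'a unitization minf \<times> 'b unitization minf"

definition Gamma0 :: "('a::cstar_algebra \<Rightarrow> 'b::cstar_algebra) \<Rightarrow> ('a, 'b) triple set" where
  "Gamma0 \<phi> = {(p, q, v). projection p \<and> projection q \<and>
     partial_isometry_from_to v (amplify \<phi> p) (amplify \<phi> q)}"

definition triple_mat :: "nat \<Rightarrow> ('a::cstar_algebra, 'b::cstar_algebra) triple set" where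
  "triple_mat n = fin_mat n \<times> fin_mat n \<times> fin_mat n"

text \<open>
  The direct sum of triples, where the entries of the first one are regarded as n by n matrices. It
  is only used for a first summand in \<^term>\<open>triple_mat n\<close>.
\<close>

fun triple_sum :: "('a::cstar_algebra, 'b::cstar_algebra) triple \<Rightarrow> nat \<Rightarrow> ('a, 'b) triple \<Rightarrow> ('a, 'b) triple"
    ("(_ \<oplus>\<oplus>\<^bsub>_\<^esub> _)" [66, 0, 65] 65) where
  "(p, q, v) \<oplus>\<oplus>\<^bsub>n\<^esub> (p', q', v') = (p \<oplus>\<^bsub>n\<^esub> p', q \<oplus>\<^bsub>n\<^esub> q', v \<oplus>\<^bsub>n\<^esub> v')"

fun triple_iso ::
  "('a::cstar_algebra \<Rightarrow> 'b::cstar_algebra) \<Rightarrow> ('a, 'b) triple \<Rightarrow> ('a, 'b) triple \<Rightarrow> bool" where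
  "triple_iso \<phi> (p, q, v) (p', q', v') \<longleftrightarrow>
     (\<exists>c d. partial_isometry_from_to c p p' \<and> partial_isometry_from_to d q q' \<and>
       amplify \<phi> d * v = v' * amplify \<phi> c)"

definition elementary :: "('a::cstar_algebra \<Rightarrow> 'b::cstar_algebra) \<Rightarrow> ('a, 'b) triple set" where
  "elementary \<phi> = {(p, q, v). (p, q, v) \<in> Gamma0 \<phi> \<and> p = q \<and>
     (\<exists>V. matrix_path V \<and> V 0 = amplify \<phi> p \<and> V 1 = v \<and>
       (\<forall>t\<in>{0..1}. star (V t) * V t = amplify \<phi> p \<and> V t * star (V t) = amplify \<phi> p))}"

definition K0_rel ::
  "('a::cstar_algebra \<Rightarrow> 'b::cstar_algebra) \<Rightarrow> (('a, 'b) triple \<times> ('a, 'b) triple) set" where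
  "K0_rel \<phi> = {(\<sigma>, \<sigma>'). \<sigma> \<in> Gamma0 \<phi> \<and> \<sigma>' \<in> Gamma0 \<phi> \<and>
     (\<exists>\<tau>\<in>elementary \<phi>. \<exists>\<tau>'\<in>elementary \<phi>. \<exists>n n'.
       \<sigma> \<in> triple_mat n \<and> \<sigma>' \<in> triple_mat n' \<and>
       triple_iso \<phi> (\<sigma> \<oplus>\<oplus>\<^bsub>n\<^esub> \<tau>) (\<sigma>' \<oplus>\<oplus>\<^bsub>n'\<^esub> \<tau>'))}"

definition K0 :: "('a::cstar_algebra \<Rightarrow> 'b::cstar_algebra) \<Rightarrow> ('a, 'b) triple set set" where
  "K0 \<phi> = Gamma0 \<phi> // K0_rel \<phi>"

definition K0_class ::
  "('a::cstar_algebra \<Rightarrow> 'b::cstar_algebra) \<Rightarrow> ('a, 'b) triple \<Rightarrow> ('a, 'b) triple set" where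
  "K0_class \<phi> \<sigma> = K0_rel \<phi> `` {\<sigma>}"

text \<open>
  The union is over all choices of representatives and of a matrix size for the first one; all of
  these give the same class.
\<close>

definition K0_add :: "('a::cstar_algebra \<Rightarrow> 'b::cstar_algebra) \<Rightarrow>
    ('a, 'b) triple set \<Rightarrow> ('a, 'b) triple set \<Rightarrow> ('a, 'b) triple set" where
  "K0_add \<phi> X Y = (\<Union>\<sigma>\<in>X. \<Union>\<sigma>'\<in>Y. \<Union>n\<in>{n. \<sigma> \<in> triple_mat n}. K0_class \<phi> (\<sigma> \<oplus>\<oplus>\<^bsub>n\<^esub> \<sigma>'))"

definition K0_zero :: "('a::cstar_algebra \<Rightarrow> 'b::cstar_algebra) \<Rightarrow> ('a, 'b) triple set" where
  "K0_zero \<phi> = K0_class \<phi> (0, 0, 0)"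

text \<open>The diagonal matrix with n ones, m - n zeros and k ones, for m at least n.\<close>

abbreviation padded_id :: "nat \<Rightarrow> nat \<Rightarrow> nat \<Rightarrow> 'a::{zero,one} minf" where
  "padded_id m n k \<equiv> id_mat n \<oplus>\<^bsub>n\<^esub> (0 \<oplus>\<^bsub>m - n\<^esub> id_mat k)"

end

theory Submission
  imports Defs
begin

text \<open>
  Direct sums of triples are handled as sums of orthogonal triples: if \<open>p * p' = 0\<close> and \<open>q * q' = 0\<close>,
  then (p + p', q + q', v + v') depends up to isomorphism only on the isomorphism classes of the two
  summands, and a direct sum is the orthogonal sum of the first triple and a shifted copy of the second.
  This gives (iii) and the fact that equivalence is a congruence.

  The only homotopy needed is the rotation from \<open>p + q\<close> to \<open>v - star v\<close> for a partial isometry v between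
  orthogonal projections p and q. It shows that (q, p, - star v) is an inverse of (p, q, v), also of
  (p, q, v') for homotopic v and v', which gives (i); and it connects \<open>w * v - q\<close> to \<open>v + w\<close>, which gives (ii).
  For (iv) one adds (1 - q, 1 - q, 1 - q) and conjugates by a scalar isometry. For (v) one unfolds the
  definition; paths are composed by multiplying them pointwise, and in the second part the scalar parts
  are removed by multiplying w and the path by the adjoints of their scalar parts.
\<close>

section \<open>Partial isometries in a ring with involution\<close>

text \<open>Direct sums carry a block size and are commutative and associative only up to
  isomorphism, which would burden every regrouping. Orthogonal sums are the componentwise
  \<open>+\<close> of triples, so regrouping them is \<open>ac_simps\<close>; finitely many triples
  become orthogonal once some of them are shifted past a common size. The algebra
  \<open>minf\<close> is a bare ring with involution, without unit or norm. Passing from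
  \<open>star x * x = 0\<close> to x = 0 would need positivity in matrix algebras, so a relation
  like \<open>v * p = v\<close> is not deduced from \<open>star v * v = p\<close> but carried along
  in every statement on partial isometries. In return almost everything is ring algebra, and
  analysis enters only through entrywise continuity of paths. The minus sign in
  \<open>v - star v\<close> comes from the rotation matrix with rows (cos, -sin) and (sin, cos),
  which joins the identity to it inside the real span of \<open>star v * v\<close>,
  \<open>v * star v\<close>, v and \<open>star v\<close>; no functional calculus is
  involved.\<close>

lemma star_diff: "star (x - y) = star x - star (y::'a::star_ring)"
  using star_add[of x "- y"] by (simp add: star_minus)

lemma star_one [simp]: "star 1 = (1::'a::{star_ring,ring_1})"
  by (metis mult_1 mult_1_right star_mult star_star)

lemma projection_zero [simp]: "projection 0"
  by (simp add: projection_def)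

lemma projection_orth_sym:
  "projection p \<Longrightarrow> projection q \<Longrightarrow> p * q = 0 \<Longrightarrow> q * p = 0"
  by (metis projection_def star_mult star_zero)

lemma projection_add:
  "projection p \<Longrightarrow> projection q \<Longrightarrow> p * q = 0 \<Longrightarrow> projection (p + q)"
  using projection_orth_sym[of p q] by (auto simp: projection_def star_add algebra_simps)

lemma projection_diff:
  "projection p \<Longrightarrow> projection q \<Longrightarrow> p * q = p \<Longrightarrow> projection (q - p)"
proof -
  assume p: "projection p" and q: "projection q" and pq: "p * q = p"
  have "q * p = p" using arg_cong[OF pq, of star] p q by (simp add: star_mult projection_def)
  with p q pq show ?thesis by (auto simp: projection_def star_diff algebra_simps)
qed

text \<open>The third premise takes the place of the C*-identity: in a C*-algebra it would follow
  from the first one for a projection p, but a ring with involution need not be definite.\<close>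

lemma pift_intro:
  "star v * v = p \<Longrightarrow> v * star v = q \<Longrightarrow> v * p = v \<Longrightarrow> partial_isometry_from_to v p q"
  unfolding partial_isometry_from_to_def partial_isometry_def by (metis mult.assoc)

lemma pift_simps:
  assumes "partial_isometry_from_to v p q"
  shows "star v * v = p" "v * star v = q" "v * p = v" "q * v = v" "p * star v = star v"
    "star v * q = star v"
proof -
  show 1: "star v * v = p" and 2: "v * star v = q" and 3: "v * p = v"
    using assms by (auto simp: partial_isometry_from_to_def partial_isometry_def mult.assoc)
  show 4: "q * v = v" using 1 2 3 by (metis mult.assoc)
  have "star p = p" "star q = q" using 1 2 by (auto simp: star_mult)
  with 3 4 show "p * star v = star v" "star v * q = star v"
    by (metis star_mult)+
qed

lemma pift_projection:
  assumes "partial_isometry_from_to v p q"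
  shows "projection p" "projection q"
proof -
  note v = pift_simps[OF assms]
  show "projection p" unfolding projection_def using v by (metis mult.assoc star_mult star_star)
  show "projection q" unfolding projection_def using v by (metis mult.assoc star_mult star_star)
qed

lemma pift_self: "projection p \<Longrightarrow> partial_isometry_from_to p p p"
  by (intro pift_intro) (auto simp: projection_def)

lemma pift_star:
  "partial_isometry_from_to v p q \<Longrightarrow> partial_isometry_from_to (star v) q p"
  by (intro pift_intro) (auto simp: pift_simps)

lemma pift_minus:
  "partial_isometry_from_to v p q \<Longrightarrow> partial_isometry_from_to (- v) p q"
  by (intro pift_intro) (auto simp: pift_simps star_minus)

lemma pift_mult:
  assumes v: "partial_isometry_from_to v p q" and w: "partial_isometry_from_to w q r"
  shows "partial_isometry_from_to (w * v) p r"
proof (rule pift_intro)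
  note v = pift_simps[OF v] and w = pift_simps[OF w]
  show "star (w * v) * (w * v) = p" using v w by (metis mult.assoc star_mult)
  show "w * v * star (w * v) = r" using v w by (metis mult.assoc star_mult)
  show "w * v * p = w * v" using v by (simp add: mult.assoc)
qed

lemma pift_orth:
  assumes v: "partial_isometry_from_to v p q" and w: "partial_isometry_from_to w p' q'"
  shows "q * q' = 0 \<Longrightarrow> star v * w = 0" "p * p' = 0 \<Longrightarrow> v * star w = 0"
    "p * q' = 0 \<Longrightarrow> v * w = 0"
  using pift_simps[OF v] pift_simps[OF w]
  by (metis mult.assoc mult_zero_left mult_zero_right)+

lemma pift_add:
  assumes v: "partial_isometry_from_to v p q" and w: "partial_isometry_from_to w p' q'"
    and p: "p * p' = 0" and q: "q * q' = 0"
  shows "partial_isometry_from_to (v + w) (p + p') (q + q')"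
proof (rule pift_intro)
  note P = pift_projection[OF v] pift_projection[OF w]
  have p': "p' * p = 0" and q': "q' * q = 0"
    using P p q by (auto intro: projection_orth_sym)
  note o = pift_orth[OF v w] pift_orth[OF w v]
  have "v * p' = 0" "w * p = 0"
    using pift_simps(3)[OF v] pift_simps(3)[OF w] p p' by (metis mult.assoc mult_zero_right)+
  then show "(v + w) * (p + p') = v + w"
    using pift_simps[OF v] pift_simps[OF w] by (simp add: algebra_simps)
  show "star (v + w) * (v + w) = p + p'" "(v + w) * star (v + w) = q + q'"
    using pift_simps[OF v] pift_simps[OF w] o p q p' q' by (auto simp: algebra_simps star_add)
qed

text \<open>If c is isometric on the range of p, its restriction to that range is a partial
  isometry. Truncated shifts and scalar matrices are turned into partial isometries out of a given
  projection in this way.\<close>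

lemma pift_restrict:
  assumes "projection p" "star c * c * p = p"
  shows "partial_isometry_from_to (c * p) p (c * p * star c)"
proof (rule pift_intro)
  have p: "star p = p" "p * p = p" using assms(1) by (auto simp: projection_def)
  show "star (c * p) * (c * p) = p"
    using p assms(2) by (simp add: star_mult mult.assoc)
  show "c * p * star (c * p) = c * p * star c"
    using p by (simp add: star_mult mult.assoc) (metis mult.assoc)
  show "c * p * p = c * p" using p by (simp add: mult.assoc)
qed

section \<open>Homomorphisms of rings with involution\<close>

text \<open>A notion without complex scalars, because it has to apply to maps between the matrix
  rings \<open>minf\<close>, which are only rings with involution.\<close>

definition ring_star_hom :: "('a::star_ring \<Rightarrow> 'b::star_ring) \<Rightarrow> bool" where
  "ring_star_hom f \<longleftrightarrow> (\<forall>x y. f (x + y) = f x + f y) \<and> (\<forall>x y. f (x * y) = f x * f y) \<and>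
     (\<forall>x. f (star x) = star (f x))"

lemma ring_star_hom_simps:
  assumes "ring_star_hom f"
  shows "f (x + y) = f x + f y" "f (x * y) = f x * f y" "f (star x) = star (f x)"
    "f 0 = 0" "f (- x) = - f x" "f (x - y) = f x - f y"
proof -
  show add: "f (x + y) = f x + f y" for x y using assms by (auto simp: ring_star_hom_def)
  show "f (x * y) = f x * f y" "f (star x) = star (f x)" using assms by (auto simp: ring_star_hom_def)
  show 0: "f 0 = 0" using add[of 0 0] by simp
  show m: "f (- x) = - f x" for x using add[of x "- x"] 0 by (simp add: add_eq_0_iff)
  show "f (x - y) = f x - f y" using add[of x "- y"] m[of y] by simp
qed

lemma ring_star_hom_sum: "ring_star_hom f \<Longrightarrow> f (sum g A) = (\<Sum>x\<in>A. f (g x))"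
  by (induction A rule: infinite_finite_induct) (auto simp: ring_star_hom_simps)

lemma projection_hom: "ring_star_hom f \<Longrightarrow> projection p \<Longrightarrow> projection (f p)"
  unfolding projection_def by (metis ring_star_hom_simps(2,3))

lemma pift_hom:
  "ring_star_hom f \<Longrightarrow> partial_isometry_from_to v p q \<Longrightarrow> partial_isometry_from_to (f v) (f p) (f q)"
  unfolding partial_isometry_from_to_def partial_isometry_def by (metis ring_star_hom_simps(2,3))

section \<open>Matrices\<close>

lemmas entry_simps [simp] = zero_minf.rep_eq plus_minf.rep_eq minus_minf.rep_eq
  uminus_minf.rep_eq star_minf.rep_eq id_mat.rep_eq map_minf.rep_eq block_mat.rep_eq

lemma fin_mat_entry: "a \<in> fin_mat n \<Longrightarrow> i \<ge> n \<or> j \<ge> n \<Longrightarrow> entry a i j = 0"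
  by (auto simp: fin_mat_def)

lemma fin_mat_zero [simp]: "0 \<in> fin_mat n"
  by (simp add: fin_mat_def)

lemma fin_mat_add [intro]: "a \<in> fin_mat n \<Longrightarrow> b \<in> fin_mat n \<Longrightarrow> a + b \<in> fin_mat n"
  by (auto simp: fin_mat_def)

lemma fin_mat_diff [intro]: "a \<in> fin_mat n \<Longrightarrow> b \<in> fin_mat n \<Longrightarrow> a - b \<in> fin_mat n"
  by (auto simp: fin_mat_def)

lemma fin_mat_uminus [intro]: "a \<in> fin_mat n \<Longrightarrow> - a \<in> fin_mat n"
  by (auto simp: fin_mat_def)

lemma fin_mat_star [intro]: "a \<in> fin_mat n \<Longrightarrow> star a \<in> fin_mat n"
  by (auto simp: fin_mat_def)

lemma fin_mat_id [intro]: "n \<le> m \<Longrightarrow> id_mat n \<in> fin_mat m"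
  by (auto simp: fin_mat_def)

lemma fin_mat_map [intro]: "a \<in> fin_mat n \<Longrightarrow> map_minf f a \<in> fin_mat n"
  by (auto simp: fin_mat_def)

lemma fin_mat_mono: "a \<in> fin_mat n \<Longrightarrow> n \<le> m \<Longrightarrow> a \<in> fin_mat m"
  using mat_mono by blast

lemma fin_mat_dsum [intro]:
  "a \<in> fin_mat n \<Longrightarrow> b \<in> fin_mat k \<Longrightarrow> a \<oplus>\<^bsub>n\<^esub> b \<in> fin_mat (n + k)"
  by (auto simp: fin_mat_def)

lemma id_mat_mult:
  fixes a :: "'a::{star_ring,ring_1} minf"
  assumes "a \<in> fin_mat n"
  shows "id_mat n * a = a" "a * id_mat n = a"
proof -
  have "(\<Sum>k<n. (if i = k \<and> i < n then 1 else 0) * entry a k j) =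
      (\<Sum>k<n. if k = i then entry a i j else 0)" for i j
    by (rule sum.cong) auto
  then show "id_mat n * a = a"
    using fin_mat_entry[OF assms] assms by (intro minf_eqI) (simp add: entry_mult[of _ n])
  have "(\<Sum>k<n. entry a i k * (if k = j \<and> k < n then 1 else 0)) =
      (\<Sum>k<n. if k = j then entry a i j else 0)" for i j
    by (rule sum.cong) auto
  then show "a * id_mat n = a"
    using fin_mat_entry[OF assms] assms by (intro minf_eqI) (simp add: entry_mult[of _ n])
qed

lemma star_id_mat [simp]: "star (id_mat n) = (id_mat n :: 'a::{star_ring,ring_1} minf)"
  by (rule minf_eqI) auto

lemma projection_id_mat [simp]: "projection (id_mat n :: 'a::{star_ring,ring_1} minf)"
  by (auto simp: projection_def intro!: id_mat_mult)

lemma ring_star_hom_map: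
  assumes f: "ring_star_hom f"
  shows "ring_star_hom (map_minf f)"
proof -
  have e: "entry (map_minf f a) i j = f (entry a i j)" for a i j
    using ring_star_hom_simps(4)[OF f] by simp
  have "map_minf f (a * b) = map_minf f a * map_minf f b" for a b
  proof -
    obtain n where "a \<in> fin_mat n" using mat_exhaust by blast
    moreover from this have "map_minf f a \<in> fin_mat n" by auto
    ultimately show ?thesis
      by (intro minf_eqI)
        (simp add: e entry_mult[of _ n] ring_star_hom_sum[OF f] ring_star_hom_simps[OF f]
          del: entry_simps(7))
  qed
  then show ?thesis
    unfolding ring_star_hom_def
    by (auto intro!: minf_eqI simp: e ring_star_hom_simps[OF f] simp del: entry_simps(7))
qed

section \<open>Truncated shifts and block matrices\<close>

text \<open>The isometry that moves the first N coordinates down by n; it is cut off at N because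
  the full shift is not a finite matrix.\<close>

lift_definition shift_mat :: "nat \<Rightarrow> nat \<Rightarrow> 'a::{zero,one} minf"
  is "\<lambda>n N i j. if i = n + j \<and> j < N then 1 else 0"
  by (metis add_lessD1 add.commute leD nat_add_left_cancel_less order_le_less_trans)

declare shift_mat.rep_eq [simp]

lemma fin_mat_shift [intro]: "n + N \<le> m \<Longrightarrow> shift_mat n N \<in> fin_mat m"
  by (auto simp: fin_mat_def)

lemma entry_shift_mult:
  fixes a :: "'a::{star_ring,ring_1} minf"
  shows "entry (shift_mat n N * a) i j = (if n \<le> i \<and> i < n + N then entry a (i - n) j else 0)"
proof -
  have "(\<Sum>k<n + N. (if i = n + k \<and> k < N then 1 else 0) * entry a k j) =
      (\<Sum>k<n + N. if k = i - n then (if n \<le> i \<and> i < n + N then entry a (i - n) j else 0) else 0)"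
    by (rule sum.cong) auto
  then show ?thesis
    using fin_mat_shift[of n N "n + N"] by (subst entry_mult[of _ "n + N"]) auto
qed

lemma entry_mult_star_shift:
  fixes a :: "'a::{star_ring,ring_1} minf"
  shows "entry (a * star (shift_mat n N)) i j = (if n \<le> j \<and> j < n + N then entry a i (j - n) else 0)"
proof -
  have "entry (a * star (shift_mat n N)) i j = star (entry (shift_mat n N * star a) j i)"
    using star_minf.rep_eq[of "shift_mat n N * star a"] by (simp add: star_mult)
  then show ?thesis
    by (simp add: entry_shift_mult)
qed

lemma star_shift_mult_shift:
  "star (shift_mat n N) * shift_mat n N = (id_mat N :: 'a::{star_ring,ring_1} minf)"
proof -
  have "shift_mat n N * id_mat N = (shift_mat n N :: 'a minf)"
    by (rule minf_eqI) (auto simp: entry_shift_mult)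
  moreover have "entry (star (shift_mat n N) * a) i j = (if i < N then entry a (n + i) j else 0)"
    for a :: "'a minf" and i j
  proof -
    have "(\<Sum>k<n + N. star (if k = n + i \<and> i < N then 1 else 0) * entry a k j) =
      (\<Sum>k<n + N. if k = n + i then (if i < N then entry a (n + i) j else 0) else 0)"
      by (rule sum.cong) auto
    then show ?thesis
      using fin_mat_star[OF fin_mat_shift[of n N "n + N"]] by (subst entry_mult[of _ "n + N"]) auto
  qed
  ultimately show ?thesis
    by (intro minf_eqI) auto
qed

lemma block_mat_zero [simp]: "block_mat n 0 0 0 0 = 0"
  by (rule minf_eqI) auto

lemma block_mat_diag1: "a \<in> fin_mat n \<Longrightarrow> a \<oplus>\<^bsub>n\<^esub> 0 = a"
  by (rule minf_eqI) (auto simp: fin_mat_entry)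

lemma block_mat_add:
  fixes a :: "'a::star_ring minf"
  shows "block_mat n a b c d + block_mat n a' b' c' d' = block_mat n (a + a') (b + b') (c + c') (d + d')"
  by (rule minf_eqI) auto

text \<open>Turns blocks into products with the truncated shift, so that later identities between
  blocks rest on \<open>star_shift_mult_shift\<close> and ring algebra instead of entries.\<close>

lemma block_mat_eq:
  fixes a :: "'a::{star_ring,ring_1} minf"
  assumes "a \<in> fin_mat n" "b \<in> fin_mat n" "c \<in> fin_mat n" "b \<in> fin_mat N" "c \<in> fin_mat N" "d \<in> fin_mat N"
  shows "block_mat n a b c d = a + b * star (shift_mat n N) + shift_mat n N * c
     + shift_mat n N * d * star (shift_mat n N)"
  using assms
  by (intro minf_eqI) (auto simp: entry_shift_mult entry_mult_star_shift fin_mat_entry not_less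
      intro!: fin_mat_entry[of b N] fin_mat_entry[of c N] fin_mat_entry[of d N])

section \<open>Paths of matrices\<close>

lemma bounded_linear_star: "bounded_linear (star :: 'a::cstar_algebra \<Rightarrow> 'a)"
  by (rule bounded_linear_intro[of _ 1]) (auto simp: star_add scaleR_scaleC star_scaleC)

lemma bounded_linear_scalar: "bounded_linear (scalar :: 'a::cstar_algebra unitization \<Rightarrow> _)"
proof (rule bounded_linear_intro[of _ 1])
  show "norm (scalar x) \<le> norm x * 1" for x :: "'a unitization"
    using norm_unitization_le[of "scalar x"] norm_scal_part_le[of x] by (simp add: scalar_def)
qed (auto simp: scalar_def intro!: unitization_eqI)

text \<open>Real scalars suffice, as the only coefficients needed are the cosine and sine of the
  rotation.\<close>

definition scale_mat :: "real \<Rightarrow> 'a::cstar_algebra minf \<Rightarrow> 'a minf" where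
  "scale_mat r = map_minf (scaleR r)"

lemma entry_scale_mat [simp]: "entry (scale_mat r a) i j = r *\<^sub>R entry a i j"
  by (simp add: scale_mat_def)

lemma fin_mat_scale [intro]: "a \<in> fin_mat n \<Longrightarrow> scale_mat r a \<in> fin_mat n"
  by (auto simp: fin_mat_def)

lemma scale_mat_one [simp]: "scale_mat 1 a = a"
  by (rule minf_eqI) simp

lemma scale_mat_zero [simp]: "scale_mat 0 a = 0"
  by (rule minf_eqI) simp

lemma scale_mat_algebra:
  "scale_mat r (scale_mat s a) = scale_mat (r * s) a"
  "scale_mat r (a + b) = scale_mat r a + scale_mat r b"
  "scale_mat r (a - b) = scale_mat r a - scale_mat r b"
  "scale_mat r a + scale_mat s a = scale_mat (r + s) a"
  "star (scale_mat r a) = scale_mat r (star a)"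
  "scale_mat r a * b = scale_mat r (a * b)"
  "a * scale_mat r b = scale_mat r (a * b)"
proof -
  show "scale_mat r (scale_mat s a) = scale_mat (r * s) a"
    "scale_mat r (a + b) = scale_mat r a + scale_mat r b"
    "scale_mat r (a - b) = scale_mat r a - scale_mat r b"
    "scale_mat r a + scale_mat s a = scale_mat (r + s) a"
    "star (scale_mat r a) = scale_mat r (star a)"
    by (auto intro!: minf_eqI simp: scaleR_add_right scaleR_diff_right scaleR_add_left)
      (simp add: scaleR_scaleC star_scaleC)
  obtain n where a: "a \<in> fin_mat n" using mat_exhaust by blast
  then have "scale_mat r a \<in> fin_mat n" by auto
  with a show "scale_mat r a * b = scale_mat r (a * b)" "a * scale_mat r b = scale_mat r (a * b)"
    by (auto intro!: minf_eqI simp: entry_mult[of _ n] scaleR_sum_right)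
qed

section \<open>Closure properties of paths\<close>

lemma matrix_pathI:
  "(\<And>t. t \<in> {0..1} \<Longrightarrow> V t \<in> fin_mat n) \<Longrightarrow>
    (\<And>i j. continuous_on {0..1} (\<lambda>t. entry (V t) i j)) \<Longrightarrow> matrix_path V"
  unfolding matrix_path_def by blast

lemma matrix_pathE:
  assumes "matrix_path V"
  obtains n where "\<And>t. t \<in> {0..1} \<Longrightarrow> V t \<in> fin_mat n"
    "\<And>i j. continuous_on {0..1} (\<lambda>t. entry (V t) i j)"
  using assms unfolding matrix_path_def by blast

lemma matrix_path_map:
  assumes "matrix_path V" "\<And>n t. V t \<in> fin_mat n \<Longrightarrow> W t \<in> fin_mat n"
    "\<And>i j. (\<And>i j. continuous_on {0..1} (\<lambda>t. entry (V t) i j)) \<Longrightarrow>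
      continuous_on {0..1} (\<lambda>t. entry (W t) i j)"
  shows "matrix_path W"
  using assms unfolding matrix_path_def by meson

lemma matrix_path_const [intro]: "matrix_path (\<lambda>_. a)"
  using mat_exhaust[of a] by (auto simp: matrix_path_def)

lemma matrix_path_add [intro]:
  assumes "matrix_path V" "matrix_path W"
  shows "matrix_path (\<lambda>t. V t + W t)"
proof -
  obtain n where V: "\<And>t. t \<in> {0..1} \<Longrightarrow> V t \<in> fin_mat n" "\<And>i j. continuous_on {0..1} (\<lambda>t. entry (V t) i j)"
    using assms(1) by (rule matrix_pathE) blast
  obtain m where W: "\<And>t. t \<in> {0..1} \<Longrightarrow> W t \<in> fin_mat m" "\<And>i j. continuous_on {0..1} (\<lambda>t. entry (W t) i j)"
    using assms(2) by (rule matrix_pathE) blast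
  have "V t + W t \<in> fin_mat (n + m)" if "t \<in> {0..1}" for t
    using V(1)[OF that] W(1)[OF that] by (meson fin_mat_add fin_mat_mono le_add1 le_add2)
  then show ?thesis
    by (rule matrix_pathI) (auto intro!: continuous_intros V W)
qed

lemma matrix_path_minus [intro]:
  assumes "matrix_path V"
  shows "matrix_path (\<lambda>t. - V t)"
  by (rule matrix_path_map[OF assms]) (auto intro!: continuous_intros)

lemma matrix_path_diff [intro]:
  "matrix_path V \<Longrightarrow> matrix_path W \<Longrightarrow> matrix_path (\<lambda>t. V t - W t)"
  using matrix_path_add[of V "\<lambda>t. - W t"] by (auto simp: matrix_path_minus)

lemma matrix_path_mult [intro]:
  assumes "matrix_path V" "matrix_path W"
  shows "matrix_path (\<lambda>t. V t * W t)"
proof -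
  obtain n where V: "\<And>t. t \<in> {0..1} \<Longrightarrow> V t \<in> fin_mat n" "\<And>i j. continuous_on {0..1} (\<lambda>t. entry (V t) i j)"
    using assms(1) by (rule matrix_pathE) blast
  obtain m where W: "\<And>t. t \<in> {0..1} \<Longrightarrow> W t \<in> fin_mat m" "\<And>i j. continuous_on {0..1} (\<lambda>t. entry (W t) i j)"
    using assms(2) by (rule matrix_pathE) blast
  show ?thesis
  proof (rule matrix_pathI)
    show "V t * W t \<in> fin_mat (n + m)" if "t \<in> {0..1}" for t
      using V(1)[OF that] W(1)[OF that] by (meson mult_mat fin_mat_mono le_add1 le_add2)
    fix i j
    \<comment> \<open>One size n bounds the whole path V, so the entry of the product is a sum over
      a range independent of t.\<close>
    have "continuous_on {0..1} (\<lambda>t. \<Sum>k<n. entry (V t) i k * entry (W t) k j)"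
      by (intro continuous_intros V W)
    then show "continuous_on {0..1} (\<lambda>t. entry (V t * W t) i j)"
      by (rule continuous_on_eq) (use V(1) in \<open>simp add: entry_mult[of _ n]\<close>)
  qed
qed

lemma matrix_path_star [intro]:
  assumes "matrix_path V"
  shows "matrix_path (\<lambda>t. star (V t))"
  by (rule matrix_path_map[OF assms]) (auto intro!: bounded_linear.continuous_on[OF bounded_linear_star])

lemma matrix_path_scale [intro]:
  assumes "continuous_on {0..1} f" "matrix_path V"
  shows "matrix_path (\<lambda>t. scale_mat (f t) (V t))"
  by (rule matrix_path_map[OF assms(2)]) (auto intro!: continuous_intros assms(1))

lemma matrix_path_scalar [intro]:
  fixes V :: "real \<Rightarrow> 'a::cstar_algebra unitization minf"
  assumes "matrix_path V"
  shows "matrix_path (\<lambda>t. scalar_mat (V t))"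
proof -
  have "entry (scalar_mat a) i j = scalar (entry a i j)" for a :: "'a unitization minf" and i j
    by (auto simp: scalar_def zero_unitization_def)
  then show ?thesis
    by (intro matrix_path_map[OF assms]) (auto simp del: entry_simps
        intro!: bounded_linear.continuous_on[OF bounded_linear_scalar])
qed

text \<open>The path of an elementary triple starts at the projection, whereas the homotopies in (v)
  end there; reversal mediates between the two conventions.\<close>

lemma matrix_path_reverse [intro]:
  assumes "matrix_path V"
  shows "matrix_path (\<lambda>t. V (1 - t))"
proof -
  obtain n where V: "\<And>t. t \<in> {0..1} \<Longrightarrow> V t \<in> fin_mat n" "\<And>i j. continuous_on {0..1} (\<lambda>t. entry (V t) i j)"
    using assms by (rule matrix_pathE) blast
  show ?thesis
  proof (rule matrix_pathI)
    show "V (1 - t) \<in> fin_mat n" if "t \<in> {0..1}" for t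
      using that by (intro V) auto
    show "continuous_on {0..1} (\<lambda>t. entry (V (1 - t)) i j)" for i j
      by (rule continuous_on_compose2[OF V(2)]) (auto intro!: continuous_intros)
  qed
qed

text \<open>Used for a partial isometry v with orthogonal initial and final projections.\<close>

definition rot :: "'a::cstar_algebra minf \<Rightarrow> real \<Rightarrow> 'a minf" where
  "rot v t = scale_mat (cos (pi / 2 * t)) (star v * v + v * star v)
     + scale_mat (sin (pi / 2 * t)) (v - star v)"

lemma matrix_path_rot [intro]: "matrix_path (rot v)"
  unfolding rot_def by (intro matrix_path_add matrix_path_scale matrix_path_const continuous_intros)

lemma rot_ends: "rot v 0 = star v * v + v * star v" "rot v 1 = v - star v"
  by (simp_all add: rot_def)

text \<open>With J = \<open>v - star v\<close> and e = \<open>p + q\<close>, orthogonality of p and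
  q gives \<open>star J = - J\<close> and \<open>J * J = - e\<close>. So \<open>rot v t\<close> is
  the exponential of (pi/2) t J in the corner of e, namely cos e + sin J, and it is unitary there
  because the squares of cosine and sine add up to 1.\<close>

lemma pift_rot:
  assumes v: "partial_isometry_from_to v p q" and pq: "p * q = 0"
  shows "partial_isometry_from_to (rot v t) (p + q) (p + q)"
proof (rule pift_intro)
  note P = pift_projection[OF v]
  have qp: "q * p = 0" using P pq by (rule projection_orth_sym)
  have vv: "v * v = 0" "star v * star v = 0"
    using pift_orth(3)[OF v v pq] pift_orth(3)[OF pift_star[OF v] pift_star[OF v] qp] by auto
  have vq: "v * q = 0" "p * v = 0" "star v * p = 0" "q * star v = 0"
    using pift_simps[OF v] pq qp by (metis mult.assoc mult_zero_left mult_zero_right)+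
  have PP: "star p = p" "star q = q" "p * p = p" "q * q = q"
    using P by (auto simp: projection_def)
  define c s where "c = cos (pi / 2 * t)" and "s = sin (pi / 2 * t)"
  have cs: "c * c + s * s = 1"
    unfolding c_def s_def by (metis sin_cos_squared_add3)
  have r: "rot v t = scale_mat c (p + q) + scale_mat s (v - star v)"
    by (simp add: rot_def c_def s_def pift_simps[OF v])
  have e1: "(p + q) * (p + q) = p + q" and e2: "(v - star v) * (star v - v) = p + q"
    and e3: "(star v - v) * (v - star v) = p + q"
    and e4: "(p + q) * (v - star v) = v - star v" and e5: "(v - star v) * (p + q) = v - star v"
    and e6: "(p + q) * (star v - v) = star v - v" and e7: "(star v - v) * (p + q) = star v - v"
    using vv vq PP pq qp pift_simps[OF v] by (simp_all add: algebra_simps)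
  have expand: "(scale_mat c e + scale_mat s a) * (scale_mat c e + scale_mat s b) =
      scale_mat (c * c) (e * e) + scale_mat (c * s) (e * b) + scale_mat (c * s) (a * e) + scale_mat (s * s) (a * b)"
    for e a b :: "'a minf"
    by (simp add: distrib_left distrib_right scale_mat_algebra(1,2,6,7) ac_simps)
  \<comment> \<open>In both products of the rotation with its adjoint the two mixed terms are
    negatives of each other.\<close>
  have cancel: "scale_mat (c * c) e + scale_mat (c * s) a + scale_mat (c * s) (- a) + scale_mat (s * s) e = e"
    for e a :: "'a minf"
  proof (rule minf_eqI)
    fix i j
    have "(c * c) *\<^sub>R entry e i j + (s * s) *\<^sub>R entry e i j = entry e i j"
      using cs by (simp flip: scaleR_add_left)
    then show "entry (scale_mat (c * c) e + scale_mat (c * s) a + scale_mat (c * s) (- a) + scale_mat (s * s) e) i j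
        = entry e i j"
      by simp
  qed
  have st: "star (rot v t) = scale_mat c (p + q) + scale_mat s (star v - v)"
    using PP by (simp add: r star_add star_diff scale_mat_algebra(5))
  show "star (rot v t) * rot v t = p + q"
    using cancel[of "p + q" "v - star v"] unfolding st unfolding r expand e1 e3 e4 e7 minus_diff_eq .
  show "rot v t * star (rot v t) = p + q"
    using cancel[of "p + q" "star v - v"] unfolding st unfolding r expand e1 e2 e5 e6 minus_diff_eq .
  show "rot v t * (p + q) = rot v t"
    unfolding r by (simp only: distrib_right[of "scale_mat _ _"] scale_mat_algebra(6) e1 e5)
qed

section \<open>Triples and their isomorphisms\<close>

text \<open>The condition under which the componentwise sum of two triples of \<open>Gamma0\<close>
  is again in \<open>Gamma0\<close>. The third components are then orthogonal as well, because
  \<Phi> preserves products and they are supported on the images of the projections.\<close>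

fun orth :: "('a::cstar_algebra, 'b::cstar_algebra) triple \<Rightarrow> ('a, 'b) triple \<Rightarrow> bool" where
  "orth (p, q, v) (p', q', v') \<longleftrightarrow> p * p' = 0 \<and> q * q' = 0"

abbreviation shift_triple :: "nat \<Rightarrow> ('a::cstar_algebra, 'b::cstar_algebra) triple \<Rightarrow> ('a, 'b) triple" where
  "shift_triple n \<sigma> \<equiv> (0, 0, 0) \<oplus>\<oplus>\<^bsub>n\<^esub> \<sigma>"

text \<open>Phrased with a filter so that \<open>eventually_conj\<close> yields a common size for
  any finite number of matrices, with side conditions on the size if wanted.\<close>

lemma eventually_fin_mat: "\<forall>\<^sub>F n in sequentially. a \<in> fin_mat n"
  using mat_exhaust[of a] fin_mat_mono[of a] by (auto simp: eventually_sequentially)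

lemma eventually_triple_mat: "\<forall>\<^sub>F n in sequentially. \<sigma> \<in> triple_mat n"
proof (cases \<sigma>)
  case (fields p q v)
  then show ?thesis
    using eventually_fin_mat[of p] eventually_fin_mat[of q] eventually_fin_mat[of v]
    by (auto simp: triple_mat_def intro: eventually_conj)
qed

lemma eventually_seq_ex: "\<forall>\<^sub>F n in sequentially. P n \<Longrightarrow> \<exists>n. P n"
  by (auto simp: eventually_sequentially)

lemma triple_mat_mono: "\<sigma> \<in> triple_mat n \<Longrightarrow> n \<le> m \<Longrightarrow> \<sigma> \<in> triple_mat m"
  by (auto simp: triple_mat_def intro: fin_mat_mono)

lemma triple_mat_shift: "\<sigma> \<in> triple_mat N \<Longrightarrow> shift_triple n \<sigma> \<in> triple_mat (n + N)"
  by (cases \<sigma>) (auto simp: triple_mat_def fin_mat_dsum)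

lemma dsum_eq: "a \<in> fin_mat n \<Longrightarrow> a \<oplus>\<^bsub>n\<^esub> b = a + (0 \<oplus>\<^bsub>n\<^esub> (b :: 'a::star_ring minf))"
  using block_mat_add[of n a 0 0 0 0 0 0 b] by (simp add: block_mat_diag1)

lemma triple_sum_eq: "\<sigma> \<in> triple_mat n \<Longrightarrow> \<sigma> \<oplus>\<oplus>\<^bsub>n\<^esub> \<tau> = \<sigma> + shift_triple n \<tau>"
  by (cases \<sigma>; cases \<tau>) (auto simp: triple_mat_def intro: dsum_eq)

lemma mult_shift_block:
  fixes a b :: "'a::{star_ring,ring_1} minf"
  assumes "a \<in> fin_mat n"
  shows "a * (0 \<oplus>\<^bsub>n\<^esub> b) = 0"
  using assms by (intro minf_eqI) (auto simp: entry_mult[of _ n] cong: if_cong)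

lemma shift_block_eq:
  fixes b :: "'a::{star_ring,ring_1} minf"
  assumes "b \<in> fin_mat N"
  shows "0 \<oplus>\<^bsub>n\<^esub> b = shift_mat n N * b * star (shift_mat n N)"
  using block_mat_eq[of 0 n 0 0 N b] assms by simp

lemma pift_shift:
  assumes "projection (p :: 'c::{star_ring,ring_1} minf)" "p \<in> fin_mat N"
  shows "partial_isometry_from_to (shift_mat n N * p) p (0 \<oplus>\<^bsub>n\<^esub> p)"
  using pift_restrict[OF assms(1), of "shift_mat n N"] assms(2)
  by (simp add: star_shift_mult_shift id_mat_mult shift_block_eq)

lemma orth_shift: "\<sigma> \<in> triple_mat n \<Longrightarrow> orth \<sigma> (shift_triple n \<tau>)"
  by (cases \<sigma>; cases \<tau>) (auto simp: triple_mat_def mult_shift_block)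

lemma orth_add1: "orth \<sigma> \<rho> \<Longrightarrow> orth \<tau> \<rho> \<Longrightarrow> orth (\<sigma> + \<tau>) \<rho>"
  by (cases \<sigma>; cases \<tau>; cases \<rho>) (auto simp: distrib_right)

lemma orth_add2: "orth \<sigma> \<tau> \<Longrightarrow> orth \<sigma> \<rho> \<Longrightarrow> orth \<sigma> (\<tau> + \<rho>)"
  by (cases \<sigma>; cases \<tau>; cases \<rho>) (auto simp: distrib_left)

lemma mult_zero_between: "x * e = x \<Longrightarrow> f * y = y \<Longrightarrow> e * f = 0 \<Longrightarrow> x * y = (0::'a::ring)"
  by (metis mult.assoc mult_zero_left mult_zero_right)

section \<open>Amplified homomorphisms and scalar parts\<close>

lemma star_hom_zero: "star_hom (\<lambda>_. 0)"
  by (simp add: star_hom_def)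

lemma star_hom_ring_star_hom: "star_hom f \<Longrightarrow> ring_star_hom f"
  by (simp add: star_hom_def ring_star_hom_def)

lemma ring_star_hom_unitize:
  assumes "star_hom f"
  shows "ring_star_hom (unitize f)"
  using assms ring_star_hom_simps[OF star_hom_ring_star_hom[OF assms]]
  unfolding ring_star_hom_def star_hom_def
  by (auto intro!: unitization_eqI simp: unitize_def)

lemma ring_star_hom_amplify: "star_hom f \<Longrightarrow> ring_star_hom (amplify f)"
  by (intro ring_star_hom_map ring_star_hom_unitize)

lemma amplify_amplify:
  assumes "star_hom f" "star_hom g"
  shows "amplify g (amplify f a) = amplify (g \<circ> f) a"
  using ring_star_hom_simps(4)[OF star_hom_ring_star_hom[OF assms(2)]]
  by (intro minf_eqI) (auto simp: unitize_def zero_unitization_def)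

text \<open>The zero map is a *-homomorphism and its unital extension keeps exactly the scalar part.
  Facts on amplifications thus apply to scalar parts, and \<open>amplify (\<lambda>_. 0)\<close>
  also carries scalar matrices from one algebra to the other.\<close>

lemma scalar_mat_eq: "scalar_mat = amplify (\<lambda>_. 0)"
  by (auto simp: fun_eq_iff scalar_def unitize_def intro!: minf_eqI)

lemma ring_star_hom_scalar_mat: "ring_star_hom scalar_mat"
  unfolding scalar_mat_eq by (intro ring_star_hom_amplify star_hom_zero)

lemma unitize_one: "star_hom f \<Longrightarrow> unitize f 1 = 1"
  using ring_star_hom_simps(4)[OF star_hom_ring_star_hom[of f]]
  by (auto intro!: unitization_eqI simp: unitize_def)

lemma amplify_id_shift:
  assumes "star_hom f"
  shows "amplify f (id_mat n) = id_mat n" "amplify f (shift_mat n N) = shift_mat n N"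
  using unitize_one[OF assms] by (auto intro!: minf_eqI)

locale cstar_hom =
  fixes \<phi> :: "'a::cstar_algebra \<Rightarrow> 'b::cstar_algebra"
  assumes hom: "star_hom \<phi>"
begin

abbreviation \<Phi> where "\<Phi> \<equiv> amplify \<phi>"

abbreviation iso where "iso \<equiv> triple_iso \<phi>"

lemma \<Phi>_hom: "ring_star_hom \<Phi>"
  by (intro ring_star_hom_amplify hom)

lemmas \<Phi>_simps [simp] = ring_star_hom_simps[OF \<Phi>_hom] amplify_id_shift[OF hom]

lemma \<Phi>_block [simp]: "\<Phi> (block_mat n a b c d) = block_mat n (\<Phi> a) (\<Phi> b) (\<Phi> c) (\<Phi> d)"
  by (rule minf_eqI) auto

lemma pift_\<Phi>: "partial_isometry_from_to c p q \<Longrightarrow> partial_isometry_from_to (\<Phi> c) (\<Phi> p) (\<Phi> q)"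
  by (rule pift_hom[OF \<Phi>_hom])

section \<open>Isomorphisms and orthogonal sums of triples\<close>

lemma Gamma0_iff:
  "(p, q, v) \<in> Gamma0 \<phi> \<longleftrightarrow> projection p \<and> projection q \<and> partial_isometry_from_to v (\<Phi> p) (\<Phi> q)"
  by (simp add: Gamma0_def)

lemma isoI:
  "partial_isometry_from_to c p p' \<Longrightarrow> partial_isometry_from_to d q q' \<Longrightarrow>
    \<Phi> d * v = v' * \<Phi> c \<Longrightarrow> iso (p, q, v) (p', q', v')"
  unfolding triple_iso.simps by blast

lemma iso_refl: "\<sigma> \<in> Gamma0 \<phi> \<Longrightarrow> iso \<sigma> \<sigma>"
  by (cases \<sigma>) (auto simp: Gamma0_iff pift_simps intro!: isoI[OF pift_self pift_self] simp del: triple_iso.simps)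

lemma iso_sym:
  assumes "\<sigma> \<in> Gamma0 \<phi>" "\<sigma>' \<in> Gamma0 \<phi>" "iso \<sigma> \<sigma>'"
  shows "iso \<sigma>' \<sigma>"
proof -
  obtain p q v p' q' v' where s: "\<sigma> = (p, q, v)" "\<sigma>' = (p', q', v')"
    by (cases \<sigma>; cases \<sigma>') auto
  then obtain c d where c: "partial_isometry_from_to c p p'" and d: "partial_isometry_from_to d q q'"
    and e: "\<Phi> d * v = v' * \<Phi> c"
    using assms by auto
  have v: "partial_isometry_from_to v (\<Phi> p) (\<Phi> q)" "partial_isometry_from_to v' (\<Phi> p') (\<Phi> q')"
    using assms s by (auto simp: Gamma0_iff)
  \<comment> \<open>The inverse isomorphism uses \<open>star c\<close> and \<open>star d\<close>.
    Membership in \<open>Gamma0\<close> provides the supports that allow \<open>c * star c\<close>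
    to be inserted and \<open>star d * d\<close> to be removed.\<close>
  have "\<Phi> (star d) * v' = \<Phi> (star d) * (v' * \<Phi> c) * \<Phi> (star c)"
    using pift_simps[OF v(2)] pift_simps[OF pift_\<Phi>[OF c]] by (simp add: mult.assoc)
  also have "\<dots> = v * \<Phi> (star c)"
    using pift_simps[OF v(1)] pift_simps[OF pift_\<Phi>[OF d]] unfolding e[symmetric]
    by (simp flip: mult.assoc)
  finally show ?thesis
    using pift_star[OF c] pift_star[OF d] unfolding s by (intro isoI)
qed

lemma iso_trans:
  assumes "iso \<sigma> \<sigma>'" "iso \<sigma>' \<sigma>''"
  shows "iso \<sigma> \<sigma>''"
proof -
  obtain p q v p' q' v' p'' q'' v'' where s: "\<sigma> = (p, q, v)" "\<sigma>' = (p', q', v')" "\<sigma>'' = (p'', q'', v'')"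
    by (cases \<sigma>; cases \<sigma>'; cases \<sigma>'') auto
  then obtain c d c' d' where c: "partial_isometry_from_to c p p'" "partial_isometry_from_to d q q'"
    "partial_isometry_from_to c' p' p''" "partial_isometry_from_to d' q' q''"
    and e: "\<Phi> d * v = v' * \<Phi> c" "\<Phi> d' * v' = v'' * \<Phi> c'"
    using assms by auto
  have "\<Phi> (d' * d) * v = v'' * \<Phi> (c' * c)"
    using e by (simp add: mult.assoc) (simp flip: mult.assoc)
  then show ?thesis
    using pift_mult[OF c(1,3)] pift_mult[OF c(2,4)] unfolding s by (intro isoI)
qed

lemma orth_sym: "\<sigma> \<in> Gamma0 \<phi> \<Longrightarrow> \<tau> \<in> Gamma0 \<phi> \<Longrightarrow> orth \<sigma> \<tau> \<Longrightarrow> orth \<tau> \<sigma>"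
  by (cases \<sigma>; cases \<tau>) (auto simp: Gamma0_iff intro: projection_orth_sym)

lemma Gamma0_add:
  assumes "\<sigma> \<in> Gamma0 \<phi>" "\<tau> \<in> Gamma0 \<phi>" "orth \<sigma> \<tau>"
  shows "\<sigma> + \<tau> \<in> Gamma0 \<phi>"
proof -
  obtain p q v p' q' v' where s: "\<sigma> = (p, q, v)" "\<tau> = (p', q', v')"
    by (cases \<sigma>; cases \<tau>) auto
  then have "\<Phi> p * \<Phi> p' = 0" "\<Phi> q * \<Phi> q' = 0"
    using assms \<Phi>_simps(2)[of p p'] \<Phi>_simps(2)[of q q'] by (auto simp del: \<Phi>_simps(2))
  with assms s show ?thesis
    by (auto simp: Gamma0_iff intro!: projection_add pift_add)
qed

lemma iso_add:
  assumes G: "\<sigma> \<in> Gamma0 \<phi>" "\<sigma>' \<in> Gamma0 \<phi>" "\<tau> \<in> Gamma0 \<phi>" "\<tau>' \<in> Gamma0 \<phi>"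
    and o: "orth \<sigma> \<tau>" "orth \<sigma>' \<tau>'" and i: "iso \<sigma> \<sigma>'" "iso \<tau> \<tau>'"
  shows "iso (\<sigma> + \<tau>) (\<sigma>' + \<tau>')"
proof -
  obtain p q v p' q' v' where s: "\<sigma> = (p, q, v)" "\<sigma>' = (p', q', v')"
    by (cases \<sigma>; cases \<sigma>') auto
  obtain r s w r' s' w' where t: "\<tau> = (r, s, w)" "\<tau>' = (r', s', w')"
    by (cases \<tau>; cases \<tau>') auto
  from s i obtain c d where c: "partial_isometry_from_to c p p'" and d: "partial_isometry_from_to d q q'"
    and e: "\<Phi> d * v = v' * \<Phi> c"
    by auto
  from t i obtain a b where a: "partial_isometry_from_to a r r'" and b: "partial_isometry_from_to b s s'"
    and f: "\<Phi> b * w = w' * \<Phi> a"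
    by auto
  have v: "partial_isometry_from_to v (\<Phi> p) (\<Phi> q)" "partial_isometry_from_to v' (\<Phi> p') (\<Phi> q')"
    and w: "partial_isometry_from_to w (\<Phi> r) (\<Phi> s)" "partial_isometry_from_to w' (\<Phi> r') (\<Phi> s')"
    using G s t by (auto simp: Gamma0_iff)
  have z: "p * r = 0" "q * s = 0" "p' * r' = 0" "q' * s' = 0" "s * q = 0" "r' * p' = 0"
    using o orth_sym[of \<sigma> \<tau>] orth_sym[of \<sigma>' \<tau>'] G s t by auto
  then have Z: "\<Phi> q * \<Phi> s = 0" "\<Phi> s * \<Phi> q = 0" "\<Phi> p' * \<Phi> r' = 0" "\<Phi> r' * \<Phi> p' = 0"
    by (simp_all flip: \<Phi>_simps(2))
  \<comment> \<open>Each mixed product factors through orthogonal supports, for instance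
    \<open>\<Phi> d * w = \<Phi> d * (\<Phi> q * \<Phi> s) * w\<close>; hence the intertwiners of
    the two summands simply add.\<close>
  have "\<Phi> d * w = 0" "\<Phi> b * v = 0" "v' * \<Phi> a = 0" "w' * \<Phi> c = 0"
    using Z pift_simps(3)[OF pift_\<Phi>[OF d]] pift_simps(3)[OF pift_\<Phi>[OF b]]
      pift_simps(4)[OF pift_\<Phi>[OF a]] pift_simps(4)[OF pift_\<Phi>[OF c]]
      pift_simps(4)[OF v(1)] pift_simps(3)[OF v(2)] pift_simps(4)[OF w(1)] pift_simps(3)[OF w(2)]
    by (auto intro: mult_zero_between)
  then have "\<Phi> (d + b) * (v + w) = (v' + w') * \<Phi> (c + a)"
    using e f by (simp add: distrib_left distrib_right)
  moreover have "partial_isometry_from_to (c + a) (p + r) (p' + r')"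
    "partial_isometry_from_to (d + b) (q + s) (q' + s')"
    using z by (auto intro: pift_add a b c d)
  ultimately show ?thesis
    unfolding s t add_Pair by (intro isoI)
qed

text \<open>The main source of isomorphisms: only partial isometries out of p and q are chosen, and
  they determine the third entry of the target.\<close>

lemma transport:
  assumes G: "(p, q, v) \<in> Gamma0 \<phi>" and c: "partial_isometry_from_to c p p'"
    and d: "partial_isometry_from_to d q q'"
  shows "(p', q', \<Phi> d * v * \<Phi> (star c)) \<in> Gamma0 \<phi>" "iso (p, q, v) (p', q', \<Phi> d * v * \<Phi> (star c))"
proof -
  have v: "partial_isometry_from_to v (\<Phi> p) (\<Phi> q)"
    using G by (auto simp: Gamma0_iff)
  show "(p', q', \<Phi> d * v * \<Phi> (star c)) \<in> Gamma0 \<phi>"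
    using c d pift_mult[OF pift_mult[OF pift_\<Phi>[OF pift_star[OF c]] v] pift_\<Phi>[OF d]]
    by (auto simp: Gamma0_iff mult.assoc intro: pift_projection)
  have "\<Phi> d * v = \<Phi> d * v * \<Phi> (star c) * \<Phi> c"
    using pift_simps[OF v] pift_simps[OF pift_\<Phi>[OF c]] by (simp add: mult.assoc)
  with c d show "iso (p, q, v) (p', q', \<Phi> d * v * \<Phi> (star c))"
    by (rule isoI)
qed

lemma shift_triple_iso:
  assumes "\<sigma> \<in> Gamma0 \<phi>"
  shows "shift_triple n \<sigma> \<in> Gamma0 \<phi>" "iso \<sigma> (shift_triple n \<sigma>)"
proof -
  obtain p q v where s: "\<sigma> = (p, q, v)" by (cases \<sigma>) auto
  obtain N where N: "p \<in> fin_mat N" "q \<in> fin_mat N" "v \<in> fin_mat N"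
    using eventually_seq_ex[OF eventually_triple_mat[of \<sigma>]] s by (auto simp: triple_mat_def)
  have P: "projection p" "projection q" and v: "partial_isometry_from_to v (\<Phi> p) (\<Phi> q)"
    using assms s by (auto simp: Gamma0_iff)
  have "\<Phi> (shift_mat n N * q) * v * \<Phi> (star (shift_mat n N * p)) = 0 \<oplus>\<^bsub>n\<^esub> v"
    using pift_simps[OF v] shift_block_eq[OF N(3), of n] P(1) projection_hom[OF \<Phi>_hom P(1)]
    by (simp add: star_mult projection_def mult.assoc) (simp flip: mult.assoc)
  then show "shift_triple n \<sigma> \<in> Gamma0 \<phi>" "iso \<sigma> (shift_triple n \<sigma>)"
    using transport[OF assms[unfolded s] pift_shift[OF P(1) N(1), of n] pift_shift[OF P(2) N(2), of n]]
    by (simp_all add: s)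
qed

section \<open>Elementary triples\<close>

lemma elementaryI:
  assumes "projection p" "matrix_path V" "V 0 = \<Phi> p" "V 1 = v"
    "\<And>t. t \<in> {0..1} \<Longrightarrow> partial_isometry_from_to (V t) (\<Phi> p) (\<Phi> p)"
  shows "(p, p, v) \<in> elementary \<phi>"
  using assms(1-4) pift_simps[OF assms(5)] assms(5)[of 1]
  by (auto simp: elementary_def Gamma0_iff intro!: exI[of _ V])

text \<open>
  A path of elements \<open>V t\<close> as in the definition of elementary triples is replaced by \<open>V t * \<Phi> p\<close>,
  which consists of partial isometries; this avoids positivity in matrix algebras.
\<close>

lemma elementaryE:
  assumes "\<sigma> \<in> elementary \<phi>"
  obtains p v V where "\<sigma> = (p, p, v)" "projection p" "matrix_path V" "V 0 = \<Phi> p" "V 1 = v"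
    "\<And>t. t \<in> {0..1} \<Longrightarrow> partial_isometry_from_to (V t) (\<Phi> p) (\<Phi> p)"
proof -
  from assms obtain p v V where s: "\<sigma> = (p, p, v)" and G: "(p, p, v) \<in> Gamma0 \<phi>"
    and V: "matrix_path V" "V 0 = \<Phi> p" "V 1 = v"
    and t: "\<And>t. t \<in> {0..1} \<Longrightarrow> star (V t) * V t = \<Phi> p \<and> V t * star (V t) = \<Phi> p"
    by (auto simp: elementary_def)
  have p: "projection p" and P: "star (\<Phi> p) = \<Phi> p" "\<Phi> p * \<Phi> p = \<Phi> p"
    and v: "partial_isometry_from_to v (\<Phi> p) (\<Phi> p)"
    using G projection_hom[OF \<Phi>_hom, of p] by (auto simp: Gamma0_iff projection_def)
  show thesis
  proof (rule that[OF s p, of "\<lambda>t. V t * \<Phi> p"])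
    show "matrix_path (\<lambda>t. V t * \<Phi> p)" using V by auto
    show "V 0 * \<Phi> p = \<Phi> p" "V 1 * \<Phi> p = v"
      using V P pift_simps[OF v] by auto
    fix t :: real assume "t \<in> {0..1}"
    note t = t[OF this]
    \<comment> \<open>Both \<open>star (V t) * V t\<close> and \<open>V t * star (V t)\<close> equal
      \<open>\<Phi> p\<close>, so associativity of \<open>V t * star (V t) * V t\<close> makes
      \<open>V t\<close> commute with it.\<close>
    have c: "V t * \<Phi> p = \<Phi> p * V t"
      using t by (metis mult.assoc)
    show "partial_isometry_from_to (V t * \<Phi> p) (\<Phi> p) (\<Phi> p)"
    proof (rule pift_intro)
      have "star (V t * \<Phi> p) * (V t * \<Phi> p) = \<Phi> p * (star (V t) * V t) * \<Phi> p"
        using P by (simp add: star_mult mult.assoc)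
      then show "star (V t * \<Phi> p) * (V t * \<Phi> p) = \<Phi> p" using t P by simp
      have "V t * \<Phi> p * star (V t * \<Phi> p) = \<Phi> p * (V t * star (V t)) * \<Phi> p"
        unfolding c using P by (simp add: star_mult mult.assoc)
      then show "V t * \<Phi> p * star (V t * \<Phi> p) = \<Phi> p" using t P by simp
      show "V t * \<Phi> p * \<Phi> p = V t * \<Phi> p" using P by (simp add: mult.assoc)
    qed
  qed
qed

lemma elementary_Gamma0: "\<sigma> \<in> elementary \<phi> \<Longrightarrow> \<sigma> \<in> Gamma0 \<phi>"
  by (auto simp: elementary_def)

lemma elementary_self: "projection p \<Longrightarrow> (p, p, \<Phi> p) \<in> elementary \<phi>"
  by (rule elementaryI[of _ "\<lambda>_. \<Phi> p"]) (auto intro!: pift_self projection_hom[OF \<Phi>_hom])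

lemma elementary_zero: "0 \<in> elementary \<phi>"
  using elementary_self[of 0] by (simp add: zero_prod_def)

lemma elementary_add:
  assumes "\<sigma> \<in> elementary \<phi>" "\<tau> \<in> elementary \<phi>" "orth \<sigma> \<tau>"
  shows "\<sigma> + \<tau> \<in> elementary \<phi>"
proof -
  from assms(1) obtain p v V where s: "\<sigma> = (p, p, v)" "projection p" "matrix_path V" "V 0 = \<Phi> p" "V 1 = v"
    "\<And>t. t \<in> {0..1} \<Longrightarrow> partial_isometry_from_to (V t) (\<Phi> p) (\<Phi> p)"
    by (rule elementaryE) blast
  from assms(2) obtain q w W where t: "\<tau> = (q, q, w)" "projection q" "matrix_path W" "W 0 = \<Phi> q" "W 1 = w"
    "\<And>t. t \<in> {0..1} \<Longrightarrow> partial_isometry_from_to (W t) (\<Phi> q) (\<Phi> q)"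
    by (rule elementaryE) blast
  have o: "p * q = 0" "\<Phi> p * \<Phi> q = 0"
    using assms(3) s t by (auto simp flip: \<Phi>_simps(2))
  have "(p + q, p + q, v + w) \<in> elementary \<phi>"
    by (rule elementaryI[of _ "\<lambda>t. V t + W t"])
      (use s t o in \<open>auto intro: projection_add pift_add\<close>)
  then show ?thesis
    by (simp add: s t)
qed

lemma elementary_conj:
  assumes "(p, p, v) \<in> elementary \<phi>" "partial_isometry_from_to c p p'"
  shows "(p', p', \<Phi> c * v * \<Phi> (star c)) \<in> elementary \<phi>"
proof -
  from assms(1) obtain V where V: "projection p" "matrix_path V" "V 0 = \<Phi> p" "V 1 = v"
    "\<And>t. t \<in> {0..1} \<Longrightarrow> partial_isometry_from_to (V t) (\<Phi> p) (\<Phi> p)"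
    by (rule elementaryE) blast
  note c = pift_\<Phi>[OF assms(2)] pift_\<Phi>[OF pift_star[OF assms(2)]]
  show ?thesis
  proof (rule elementaryI[of _ "\<lambda>t. \<Phi> c * V t * \<Phi> (star c)"])
    show "projection p'" using pift_projection[OF assms(2)] by simp
    show "matrix_path (\<lambda>t. \<Phi> c * V t * \<Phi> (star c))" by (intro matrix_path_mult matrix_path_const V)
    show "\<Phi> c * V 0 * \<Phi> (star c) = \<Phi> p'" "\<Phi> c * V 1 * \<Phi> (star c) = \<Phi> c * v * \<Phi> (star c)"
      using V pift_simps[OF c(1)] by simp_all
    show "partial_isometry_from_to (\<Phi> c * V t * \<Phi> (star c)) (\<Phi> p') (\<Phi> p')" if "t \<in> {0..1}" for t
      using pift_mult[OF pift_mult[OF c(2) V(5)[OF that]] c(1)] by (simp add: mult.assoc)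
  qed
qed

lemma elementary_shift:
  assumes "\<sigma> \<in> elementary \<phi>"
  shows "shift_triple n \<sigma> \<in> elementary \<phi>"
proof -
  obtain p v where s: "\<sigma> = (p, p, v)" using assms by (auto simp: elementary_def)
  obtain N where N: "p \<in> fin_mat N" "v \<in> fin_mat N"
    using eventually_seq_ex[OF eventually_triple_mat[of \<sigma>]] s by (auto simp: triple_mat_def)
  have P: "projection p" and v: "partial_isometry_from_to v (\<Phi> p) (\<Phi> p)"
    using elementary_Gamma0[OF assms] s by (auto simp: Gamma0_iff)
  have "\<Phi> (shift_mat n N * p) * v * \<Phi> (star (shift_mat n N * p)) = 0 \<oplus>\<^bsub>n\<^esub> v"
    using pift_simps[OF v] shift_block_eq[OF N(2), of n] P(1) projection_hom[OF \<Phi>_hom P(1)]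
    by (simp add: star_mult projection_def mult.assoc) (simp flip: mult.assoc)
  then show ?thesis
    using elementary_conj[OF assms[unfolded s] pift_shift[OF P(1) N(1), of n]] by (simp add: s)
qed

end

section \<open>The equivalence relation\<close>

lemma shift_triple_add:
  "shift_triple n (\<sigma> + \<tau>) = shift_triple n \<sigma> + shift_triple n \<tau>"
  by (cases \<sigma>; cases \<tau>) (simp add: block_mat_add)

lemma shift_block_mult:
  fixes a b :: "'a::{star_ring,ring_1} minf"
  shows "(0 \<oplus>\<^bsub>n\<^esub> a) * (0 \<oplus>\<^bsub>n\<^esub> b) = 0 \<oplus>\<^bsub>n\<^esub> (a * b)"
proof -
  obtain N where a: "a \<in> fin_mat N" and b: "b \<in> fin_mat N"
    using eventually_seq_ex[OF eventually_conj[OF eventually_fin_mat[of a] eventually_fin_mat[of b]]]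
    by blast
  have "shift_mat n N * a * star (shift_mat n N) * (shift_mat n N * b * star (shift_mat n N)) =
      shift_mat n N * a * (star (shift_mat n N) * shift_mat n N) * b * star (shift_mat n N)"
    by (simp only: mult.assoc)
  also have "\<dots> = shift_mat n N * (a * b) * star (shift_mat n N)"
    unfolding star_shift_mult_shift using id_mat_mult[OF b] by (simp add: mult.assoc flip: mult.assoc[of "id_mat N"])
  finally show ?thesis
    by (simp only: shift_block_eq[OF a] shift_block_eq[OF b] shift_block_eq[OF mult_mat[OF a b]])
qed

lemma orth_shift_shift: "orth \<sigma> \<tau> \<Longrightarrow> orth (shift_triple n \<sigma>) (shift_triple n \<tau>)"
  by (cases \<sigma>; cases \<tau>) (simp add: shift_block_mult)

lemma orth_zero: "orth \<sigma> 0"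
  by (cases \<sigma>) (simp add: zero_prod_def)

context cstar_hom
begin

lemma triple_sum_Gamma0:
  "\<sigma> \<in> Gamma0 \<phi> \<Longrightarrow> \<tau> \<in> Gamma0 \<phi> \<Longrightarrow> \<sigma> \<in> triple_mat n \<Longrightarrow> \<sigma> \<oplus>\<oplus>\<^bsub>n\<^esub> \<tau> \<in> Gamma0 \<phi>"
  unfolding triple_sum_eq by (intro Gamma0_add shift_triple_iso orth_shift)

text \<open>A direct sum may be replaced by any orthogonal sum of isomorphic copies. Block sizes are
  eliminated here: direct sums formed with different n are isomorphic to the same orthogonal
  sum.\<close>

lemma triple_sum_iso:
  assumes "\<sigma> \<in> Gamma0 \<phi>" "\<tau> \<in> Gamma0 \<phi>" "\<sigma> \<in> triple_mat n"
    "\<sigma>' \<in> Gamma0 \<phi>" "\<tau>' \<in> Gamma0 \<phi>" "iso \<sigma> \<sigma>'" "iso \<tau> \<tau>'" "orth \<sigma>' \<tau>'"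
  shows "iso (\<sigma> \<oplus>\<oplus>\<^bsub>n\<^esub> \<tau>) (\<sigma>' + \<tau>')" "iso (\<sigma>' + \<tau>') (\<sigma> \<oplus>\<oplus>\<^bsub>n\<^esub> \<tau>)"
proof -
  note sh = shift_triple_iso[OF assms(2), of n]
  have "iso (shift_triple n \<tau>) \<tau>'"
    by (rule iso_trans[OF iso_sym[OF assms(2) sh] assms(7)])
  then show i: "iso (\<sigma> \<oplus>\<oplus>\<^bsub>n\<^esub> \<tau>) (\<sigma>' + \<tau>')"
    unfolding triple_sum_eq[OF assms(3)]
    by (intro iso_add assms sh orth_shift)
  show "iso (\<sigma>' + \<tau>') (\<sigma> \<oplus>\<oplus>\<^bsub>n\<^esub> \<tau>)"
    by (rule iso_sym[OF triple_sum_Gamma0[OF assms(1-3)] Gamma0_add[OF assms(4,5,8)] i])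
qed

lemma K0_relI:
  assumes G: "\<sigma> \<in> Gamma0 \<phi>" "\<sigma>' \<in> Gamma0 \<phi>" and e: "\<tau> \<in> elementary \<phi>" "\<tau>' \<in> elementary \<phi>"
    and o: "orth \<sigma> \<tau>" "orth \<sigma>' \<tau>'" and i: "iso (\<sigma> + \<tau>) (\<sigma>' + \<tau>')"
  shows "(\<sigma>, \<sigma>') \<in> K0_rel \<phi>"
proof -
  note e' = e[THEN elementary_Gamma0]
  obtain n where n: "\<sigma> \<in> triple_mat n" "\<sigma>' \<in> triple_mat n"
    using eventually_seq_ex[OF eventually_conj[OF eventually_triple_mat[of \<sigma>] eventually_triple_mat[of \<sigma>']]]
    by blast
  have "iso (\<sigma> \<oplus>\<oplus>\<^bsub>n\<^esub> \<tau>) (\<sigma> + \<tau>)" "iso (\<sigma>' + \<tau>') (\<sigma>' \<oplus>\<oplus>\<^bsub>n\<^esub> \<tau>')"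
    by (intro triple_sum_iso G e' n o iso_refl)+
  then have "iso (\<sigma> \<oplus>\<oplus>\<^bsub>n\<^esub> \<tau>) (\<sigma>' \<oplus>\<oplus>\<^bsub>n\<^esub> \<tau>')"
    by (rule iso_trans[OF _ iso_trans[OF i]])
  with G e n show ?thesis
    by (auto simp: K0_rel_def simp del: triple_iso.simps)
qed

text \<open>The relation provides two block sizes beyond control; here they are traded for every
  common size n. This freedom lets several relations be placed in compatible blocks.\<close>

lemma K0_relE:
  assumes "(\<sigma>, \<sigma>') \<in> K0_rel \<phi>"
  obtains \<tau> \<tau>' where "\<tau> \<in> elementary \<phi>" "\<tau>' \<in> elementary \<phi>"
    "\<And>n. \<sigma> \<in> triple_mat n \<Longrightarrow> \<sigma>' \<in> triple_mat n \<Longrightarrow> iso (\<sigma> + shift_triple n \<tau>) (\<sigma>' + shift_triple n \<tau>')"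
proof -
  from assms obtain \<tau> \<tau>' k k' where G: "\<sigma> \<in> Gamma0 \<phi>" "\<sigma>' \<in> Gamma0 \<phi>"
    and e: "\<tau> \<in> elementary \<phi>" "\<tau>' \<in> elementary \<phi>"
    and k: "\<sigma> \<in> triple_mat k" "\<sigma>' \<in> triple_mat k'"
    and i: "iso (\<sigma> \<oplus>\<oplus>\<^bsub>k\<^esub> \<tau>) (\<sigma>' \<oplus>\<oplus>\<^bsub>k'\<^esub> \<tau>')"
    unfolding K0_rel_def by blast
  note e' = e[THEN elementary_Gamma0]
  show thesis
  proof (rule that[OF e])
    fix n assume n: "\<sigma> \<in> triple_mat n" "\<sigma>' \<in> triple_mat n"
    have "iso (\<sigma> + shift_triple n \<tau>) (\<sigma> \<oplus>\<oplus>\<^bsub>k\<^esub> \<tau>)" "iso (\<sigma>' \<oplus>\<oplus>\<^bsub>k'\<^esub> \<tau>') (\<sigma>' + shift_triple n \<tau>')"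
      by (intro triple_sum_iso G e' n k iso_refl shift_triple_iso orth_shift)+
    then show "iso (\<sigma> + shift_triple n \<tau>) (\<sigma>' + shift_triple n \<tau>')"
      by (rule iso_trans[OF _ iso_trans[OF i]])
  qed
qed

lemma K0_rel_Gamma0: "(\<sigma>, \<sigma>') \<in> K0_rel \<phi> \<Longrightarrow> \<sigma> \<in> Gamma0 \<phi> \<and> \<sigma>' \<in> Gamma0 \<phi>"
  by (auto simp: K0_rel_def)

lemma K0_rel_iso: "\<sigma> \<in> Gamma0 \<phi> \<Longrightarrow> \<sigma>' \<in> Gamma0 \<phi> \<Longrightarrow> iso \<sigma> \<sigma>' \<Longrightarrow> (\<sigma>, \<sigma>') \<in> K0_rel \<phi>"
  by (rule K0_relI[OF _ _ elementary_zero elementary_zero]) (simp_all add: orth_zero)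

lemma K0_rel_sym:
  assumes "(\<sigma>, \<sigma>') \<in> K0_rel \<phi>"
  shows "(\<sigma>', \<sigma>) \<in> K0_rel \<phi>"
proof -
  obtain \<tau> \<tau>' where e: "\<tau> \<in> elementary \<phi>" "\<tau>' \<in> elementary \<phi>" and
    i: "\<And>n. \<sigma> \<in> triple_mat n \<Longrightarrow> \<sigma>' \<in> triple_mat n \<Longrightarrow> iso (\<sigma> + shift_triple n \<tau>) (\<sigma>' + shift_triple n \<tau>')"
    using assms by (rule K0_relE) blast
  obtain n where n: "\<sigma> \<in> triple_mat n" "\<sigma>' \<in> triple_mat n"
    using eventually_seq_ex[OF eventually_conj[OF eventually_triple_mat[of \<sigma>] eventually_triple_mat[of \<sigma>']]]
    by blast
  note G = conjunct1[OF K0_rel_Gamma0[OF assms]] conjunct2[OF K0_rel_Gamma0[OF assms]]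
    and e' = e[THEN elementary_Gamma0]
  have "iso (\<sigma>' + shift_triple n \<tau>') (\<sigma> + shift_triple n \<tau>)"
    by (rule iso_sym[OF _ _ i[OF n]]) (intro Gamma0_add shift_triple_iso G e' orth_shift n)+
  then show ?thesis
    by (rule K0_relI[rotated -1]) (intro G e elementary_shift orth_shift n)+
qed

lemma K0_rel_trans:
  assumes "(\<sigma>, \<sigma>') \<in> K0_rel \<phi>" "(\<sigma>', \<sigma>'') \<in> K0_rel \<phi>"
  shows "(\<sigma>, \<sigma>'') \<in> K0_rel \<phi>"
proof -
  obtain \<tau> \<tau>' where e: "\<tau> \<in> elementary \<phi>" "\<tau>' \<in> elementary \<phi>" and
    i: "\<And>n. \<sigma> \<in> triple_mat n \<Longrightarrow> \<sigma>' \<in> triple_mat n \<Longrightarrow> iso (\<sigma> + shift_triple n \<tau>) (\<sigma>' + shift_triple n \<tau>')"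
    using assms(1) by (rule K0_relE) blast
  obtain \<rho> \<rho>' where f: "\<rho> \<in> elementary \<phi>" "\<rho>' \<in> elementary \<phi>" and
    j: "\<And>n. \<sigma>' \<in> triple_mat n \<Longrightarrow> \<sigma>'' \<in> triple_mat n \<Longrightarrow> iso (\<sigma>' + shift_triple n \<rho>) (\<sigma>'' + shift_triple n \<rho>')"
    using assms(2) by (rule K0_relE) blast
  have "\<forall>\<^sub>F n in sequentially. \<sigma> \<in> triple_mat n \<and> \<sigma>' \<in> triple_mat n \<and> \<sigma>'' \<in> triple_mat n \<and>
      \<tau> \<in> triple_mat n \<and> \<tau>' \<in> triple_mat n"
    by (intro eventually_conj eventually_triple_mat)
  then obtain n where n: "\<sigma> \<in> triple_mat n" "\<sigma>' \<in> triple_mat n" "\<sigma>'' \<in> triple_mat n"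
      "\<tau> \<in> triple_mat n" "\<tau>' \<in> triple_mat n"
    by (auto dest: eventually_seq_ex)
  have N: "\<sigma> \<in> triple_mat (n + n)" "\<sigma>' \<in> triple_mat (n + n)" "\<sigma>'' \<in> triple_mat (n + n)"
      "shift_triple n \<tau> \<in> triple_mat (n + n)" "shift_triple n \<tau>' \<in> triple_mat (n + n)"
    using n by (auto intro: triple_mat_mono triple_mat_shift)
  note G = conjunct1[OF K0_rel_Gamma0[OF assms(1)]] K0_rel_Gamma0[OF assms(2), THEN conjunct1]
      K0_rel_Gamma0[OF assms(2), THEN conjunct2]
  \<comment> \<open>The elementary triples of the first relation sit between n and 2n, those of the
    second beyond 2n. Adding \<open>?r\<close> to the first isomorphism and \<open>?t'\<close> to
    the second makes them meet in \<open>\<sigma>' + ?t' + ?r\<close>.\<close>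
  let ?t = "shift_triple n \<tau>" and ?t' = "shift_triple n \<tau>'"
    and ?r = "shift_triple (n + n) \<rho>" and ?r' = "shift_triple (n + n) \<rho>'"
  have t: "?t \<in> elementary \<phi>" "?t' \<in> elementary \<phi>" "?r \<in> elementary \<phi>" "?r' \<in> elementary \<phi>"
    by (intro elementary_shift e f)+
  note T = t[THEN elementary_Gamma0]
  have o: "orth \<sigma> ?t" "orth \<sigma>' ?t'" "orth \<sigma>' ?r" "orth \<sigma>'' ?r'" "orth ?t ?r" "orth ?t' ?r"
      "orth ?t' ?r'" "orth \<sigma> ?r" "orth \<sigma>'' ?t'"
    by (intro orth_shift n N)+
  have o': "orth ?r ?t'" "orth ?r' ?t'"
    using orth_sym[OF _ _ o(6)] orth_sym[OF _ _ o(7)] T by blast+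
  have "iso (\<sigma> + ?t + ?r) (\<sigma>' + ?t' + ?r)"
    by (intro iso_add iso_refl Gamma0_add orth_add1 G T o i n)
  then have "iso (\<sigma> + (?t + ?r)) (\<sigma>' + ?r + ?t')"
    by (simp only: ac_simps)
  moreover have "iso (\<sigma>' + ?r + ?t') (\<sigma>'' + ?r' + ?t')"
    by (intro iso_add iso_refl Gamma0_add orth_add1 G T o o' j N)
  ultimately have "iso (\<sigma> + (?t + ?r)) (\<sigma>'' + (?r' + ?t'))"
    unfolding add.assoc[of \<sigma>''] by (rule iso_trans)
  then show ?thesis
    by (rule K0_relI[rotated -1]) (intro G elementary_add orth_add2 t o o')+
qed

lemma equiv_K0_rel: "equiv (Gamma0 \<phi>) (K0_rel \<phi>)"
proof (rule equivI)
  show "K0_rel \<phi> \<subseteq> Gamma0 \<phi> \<times> Gamma0 \<phi>" using K0_rel_Gamma0 by auto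
  show "refl_on (Gamma0 \<phi>) (K0_rel \<phi>)"
    using K0_rel_iso iso_refl by (auto simp: refl_on_def simp del: triple_iso.simps)
  show "sym (K0_rel \<phi>)" using K0_rel_sym by (auto simp: sym_def)
  show "trans (K0_rel \<phi>)" using K0_rel_trans by (meson transI)
qed

lemma K0_class_eq_iff:
  "\<sigma> \<in> Gamma0 \<phi> \<Longrightarrow> \<sigma>' \<in> Gamma0 \<phi> \<Longrightarrow> K0_class \<phi> \<sigma> = K0_class \<phi> \<sigma>' \<longleftrightarrow> (\<sigma>, \<sigma>') \<in> K0_rel \<phi>"
  unfolding K0_class_def by (rule eq_equiv_class_iff[OF equiv_K0_rel])

text \<open>With the two pairs of elementary triples in separate blocks, the four summands on each
  side are mutually orthogonal, and the sum of the two isomorphisms only has to be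
  regrouped.\<close>

lemma K0_rel_add:
  assumes s: "(\<sigma>, \<sigma>') \<in> K0_rel \<phi>" and r: "(\<rho>, \<rho>') \<in> K0_rel \<phi>"
    and o: "orth \<sigma> \<rho>" "orth \<sigma>' \<rho>'"
  shows "(\<sigma> + \<rho>, \<sigma>' + \<rho>') \<in> K0_rel \<phi>"
proof -
  obtain \<tau> \<tau>' where e: "\<tau> \<in> elementary \<phi>" "\<tau>' \<in> elementary \<phi>" and
    i: "\<And>n. \<sigma> \<in> triple_mat n \<Longrightarrow> \<sigma>' \<in> triple_mat n \<Longrightarrow> iso (\<sigma> + shift_triple n \<tau>) (\<sigma>' + shift_triple n \<tau>')"
    using s by (rule K0_relE) blast
  obtain \<kappa> \<kappa>' where f: "\<kappa> \<in> elementary \<phi>" "\<kappa>' \<in> elementary \<phi>" and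
    j: "\<And>n. \<rho> \<in> triple_mat n \<Longrightarrow> \<rho>' \<in> triple_mat n \<Longrightarrow> iso (\<rho> + shift_triple n \<kappa>) (\<rho>' + shift_triple n \<kappa>')"
    using r by (rule K0_relE) blast
  have "\<forall>\<^sub>F n in sequentially. \<sigma> \<in> triple_mat n \<and> \<sigma>' \<in> triple_mat n \<and> \<rho> \<in> triple_mat n \<and>
      \<rho>' \<in> triple_mat n \<and> \<tau> \<in> triple_mat n \<and> \<tau>' \<in> triple_mat n"
    by (intro eventually_conj eventually_triple_mat)
  then obtain n where n: "\<sigma> \<in> triple_mat n" "\<sigma>' \<in> triple_mat n" "\<rho> \<in> triple_mat n" "\<rho>' \<in> triple_mat n"
      "\<tau> \<in> triple_mat n" "\<tau>' \<in> triple_mat n"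
    by (auto dest: eventually_seq_ex)
  have N: "\<sigma> \<in> triple_mat (n + n)" "\<sigma>' \<in> triple_mat (n + n)" "\<rho> \<in> triple_mat (n + n)" "\<rho>' \<in> triple_mat (n + n)"
      "shift_triple n \<tau> \<in> triple_mat (n + n)" "shift_triple n \<tau>' \<in> triple_mat (n + n)"
    using n by (auto intro: triple_mat_mono triple_mat_shift)
  note G = K0_rel_Gamma0[OF s, THEN conjunct1] K0_rel_Gamma0[OF s, THEN conjunct2]
    K0_rel_Gamma0[OF r, THEN conjunct1] K0_rel_Gamma0[OF r, THEN conjunct2]
  let ?t = "shift_triple n \<tau>" and ?t' = "shift_triple n \<tau>'"
    and ?k = "shift_triple (n + n) \<kappa>" and ?k' = "shift_triple (n + n) \<kappa>'"
  have t: "?t \<in> elementary \<phi>" "?t' \<in> elementary \<phi>" "?k \<in> elementary \<phi>" "?k' \<in> elementary \<phi>"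
    by (intro elementary_shift e f)+
  note T = t[THEN elementary_Gamma0]
  have p: "orth \<sigma> ?t" "orth \<sigma>' ?t'" "orth \<rho> ?t" "orth \<rho>' ?t'" "orth \<sigma> ?k" "orth \<sigma>' ?k'"
      "orth \<rho> ?k" "orth \<rho>' ?k'" "orth ?t ?k" "orth ?t' ?k'"
    by (intro orth_shift n N)+
  have p': "orth ?t \<rho>" "orth ?t' \<rho>'"
    using orth_sym[OF _ _ p(3)] orth_sym[OF _ _ p(4)] G T by blast+
  have "iso ((\<sigma> + ?t) + (\<rho> + ?k)) ((\<sigma>' + ?t') + (\<rho>' + ?k'))"
    by (intro iso_add Gamma0_add orth_add1 orth_add2 G T o p p' i j n N)
  then have "iso ((\<sigma> + \<rho>) + (?t + ?k)) ((\<sigma>' + \<rho>') + (?t' + ?k'))"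
    by (simp only: ac_simps)
  then show ?thesis
    by (rule K0_relI[rotated -1]) (intro G Gamma0_add elementary_add orth_add1 orth_add2 t o p)+
qed

lemma K0_rel_add_elementary:
  assumes "\<sigma> \<in> Gamma0 \<phi>" "\<tau> \<in> elementary \<phi>" "orth \<sigma> \<tau>"
  shows "(\<sigma> + \<tau>, \<sigma>) \<in> K0_rel \<phi>"
  by (rule K0_relI[OF _ _ elementary_zero assms(2)])
    (use assms in \<open>auto simp: orth_zero intro: iso_refl Gamma0_add elementary_Gamma0\<close>)

section \<open>Homotopic partial isometries\<close>

text \<open>If \<open>\<sigma> + \<nu>\<close> and \<open>\<sigma>' + \<nu>\<close> are elementary, then \<open>\<sigma> + \<sigma>' + \<nu>\<close> is both \<open>\<sigma>\<close> and \<open>\<sigma>'\<close> plus an elementary triple.\<close>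

lemma K0_rel_common_inverse:
  assumes G: "\<sigma> \<in> Gamma0 \<phi>" "\<sigma>' \<in> Gamma0 \<phi>" "\<nu> \<in> Gamma0 \<phi>"
    and o: "orth \<sigma> \<nu>" "orth \<sigma>' \<nu>" and e: "\<sigma> + \<nu> \<in> elementary \<phi>" "\<sigma>' + \<nu> \<in> elementary \<phi>"
  shows "(\<sigma>, \<sigma>') \<in> K0_rel \<phi>"
proof -
  obtain n where n: "\<sigma> \<in> triple_mat n" "\<sigma>' \<in> triple_mat n"
    using eventually_seq_ex[OF eventually_conj[OF eventually_triple_mat[of \<sigma>] eventually_triple_mat[of \<sigma>']]]
    by blast
  let ?s = "shift_triple n"
  have o1: "orth (?s \<sigma>) (?s \<nu>)" "orth (?s \<sigma>') (?s \<nu>)" "orth \<sigma> (?s \<sigma>')" "orth \<sigma>' (?s \<sigma>)"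
    "orth \<sigma> (?s \<nu>)" "orth \<sigma>' (?s \<nu>)"
    by (intro orth_shift_shift orth_shift o n)+
  have o2: "orth (?s \<sigma>) \<sigma>'"
    using orth_sym[OF _ _ o1(4)] G shift_triple_iso by blast
  \<comment> \<open>\<sigma> and \<sigma>' trade places between the first block and the shifted one,
    so that \<nu> is next to \<sigma>' on one side and next to \<sigma> on the other.\<close>
  have "iso (\<sigma> + ?s \<sigma>' + ?s \<nu>) (?s \<sigma> + \<sigma>' + ?s \<nu>)"
    by (intro iso_add iso_refl Gamma0_add orth_add1 G shift_triple_iso o1 o2 iso_sym[of \<sigma>' "?s \<sigma>'"])
  then have "iso (\<sigma> + ?s (\<sigma>' + \<nu>)) (\<sigma>' + ?s (\<sigma> + \<nu>))"
    unfolding shift_triple_add by (simp only: ac_simps)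
  then show ?thesis
    by (rule K0_relI[rotated -1]) (intro G elementary_shift e orth_shift n)+
qed

lemma K0_rel_homotopic_orth:
  assumes G: "(p, q, v) \<in> Gamma0 \<phi>" "(p, q, v') \<in> Gamma0 \<phi>" and pq: "p * q = 0"
    and V: "matrix_path V" "V 0 = v" "V 1 = v'"
    and Vt: "\<And>t. t \<in> {0..1} \<Longrightarrow> partial_isometry_from_to (V t) (\<Phi> p) (\<Phi> q)"
  shows "((p, q, v), (p, q, v')) \<in> K0_rel \<phi>"
proof (rule K0_rel_common_inverse)
  let ?n = "(q, p, - star v)" and ?e = "\<Phi> p + \<Phi> q"
  have P: "projection p" "projection q" and v: "partial_isometry_from_to v (\<Phi> p) (\<Phi> q)"
    and v': "partial_isometry_from_to v' (\<Phi> p) (\<Phi> q)"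
    using G by (auto simp: Gamma0_iff)
  have qp: "q * p = 0" by (rule projection_orth_sym[OF P pq])
  have PQ: "\<Phi> p * \<Phi> q = 0" "\<Phi> q * \<Phi> p = 0"
    using pq qp by (simp_all flip: \<Phi>_simps(2))
  show "(p, q, v) \<in> Gamma0 \<phi>" "(p, q, v') \<in> Gamma0 \<phi>" by fact+
  show "?n \<in> Gamma0 \<phi>"
    using P pift_minus[OF pift_star[OF v]] by (auto simp: Gamma0_iff)
  show "orth (p, q, v) ?n" "orth (p, q, v') ?n"
    using pq qp by auto
  have rot: "partial_isometry_from_to (rot v t) ?e ?e" for t
    by (rule pift_rot[OF v PQ(1)])
  have "(p + q, p + q, v - star v) \<in> elementary \<phi>"
    by (rule elementaryI[of _ "rot v"])
      (use P rot pq in \<open>auto simp: rot_ends pift_simps[OF v] projection_add\<close>)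
  then show "(p, q, v) + ?n \<in> elementary \<phi>" by (simp add: add.commute)
  have add: "partial_isometry_from_to (w - star v) ?e ?e"
    if "partial_isometry_from_to w (\<Phi> p) (\<Phi> q)" for w
    using pift_add[OF that pift_minus[OF pift_star[OF v]] PQ] by (simp add: add.commute)
  note u = add[OF v]
  have "(p + q, p + q, v' - star v) \<in> elementary \<phi>"
  \<comment> \<open>A pointwise product instead of a concatenation. Let u be
    \<open>v - star v\<close>: at 0 the path is the identity of the corner times
    \<open>star u * u\<close>, and at 1 it is \<open>u * star u * (v' - star v)\<close>, where the
    product of u and its adjoint is again that identity.\<close>
  proof (rule elementaryI[of _ "\<lambda>t. rot v t * (star (v - star v) * (V t - star v))"])
    show "projection (p + q)" by (rule projection_add[OF P pq])
    show "matrix_path (\<lambda>t. rot v t * (star (v - star v) * (V t - star v)))"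
      by (intro matrix_path_mult matrix_path_rot matrix_path_const matrix_path_diff V)
    show "rot v 0 * (star (v - star v) * (V 0 - star v)) = \<Phi> (p + q)"
      using pift_simps[OF u] pift_simps[OF v] V(2) projection_add[OF P pq, THEN projection_hom[OF \<Phi>_hom]]
      by (simp add: rot_ends projection_def)
    show "rot v 1 * (star (v - star v) * (V 1 - star v)) = v' - star v"
      unfolding rot_ends V(3) mult.assoc[symmetric] pift_simps[OF u] by (rule pift_simps(4)[OF add[OF v']])
    show "partial_isometry_from_to (rot v t * (star (v - star v) * (V t - star v))) (\<Phi> (p + q)) (\<Phi> (p + q))"
      if "t \<in> {0..1}" for t
      using pift_mult[OF pift_mult[OF add[OF Vt[OF that]] pift_star[OF u]] rot] by simp
  qed
  then show "(p, q, v') + ?n \<in> elementary \<phi>" by (simp add: add.commute)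
qed

text \<open>Orthogonality of p and q, which the rotation requires, is arranged by shifting q beyond
  the size of p; the same partial isometry d carries the whole path along.\<close>

lemma K0_rel_homotopic:
  assumes G: "(p, q, v) \<in> Gamma0 \<phi>" "(p, q, v') \<in> Gamma0 \<phi>"
    and V: "matrix_path V" "V 0 = v" "V 1 = v'"
    and Vt: "\<And>t. t \<in> {0..1} \<Longrightarrow> partial_isometry_from_to (V t) (\<Phi> p) (\<Phi> q)"
  shows "((p, q, v), (p, q, v')) \<in> K0_rel \<phi>"
proof -
  have P: "projection p" "projection q" using G by (auto simp: Gamma0_iff)
  obtain n where n: "p \<in> fin_mat n" "q \<in> fin_mat n"
    using eventually_seq_ex[OF eventually_conj[OF eventually_fin_mat[of p] eventually_fin_mat[of q]]] by blast
  let ?q = "0 \<oplus>\<^bsub>n\<^esub> q"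
  obtain d where d: "partial_isometry_from_to d q ?q"
    using pift_shift[OF P(2) n(2)] by blast
  define f where "f w = \<Phi> d * w * \<Phi> (star p)" for w
  note t = transport[OF G(1) pift_self[OF P(1)] d, folded f_def]
    transport[OF G(2) pift_self[OF P(1)] d, folded f_def]
  have "((p, ?q, f v), (p, ?q, f v')) \<in> K0_rel \<phi>"
  proof (rule K0_rel_homotopic_orth[of _ _ _ _ "\<lambda>t. f (V t)"])
    show "p * ?q = 0" by (rule mult_shift_block[OF n(1)])
    show "matrix_path (\<lambda>t. f (V t))"
      unfolding f_def by (intro matrix_path_mult matrix_path_const V)
    show "partial_isometry_from_to (f (V t)) (\<Phi> p) (\<Phi> ?q)" if "t \<in> {0..1}" for t
      using pift_mult[OF pift_mult[OF pift_\<Phi>[OF pift_star[OF pift_self[OF P(1)]]] Vt[OF that]] pift_\<Phi>[OF d]]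
      unfolding f_def by (simp only: mult.assoc)
  qed (use V t in simp_all)
  then show ?thesis
    using K0_rel_iso[OF G(1) t(1,2)] K0_rel_iso[OF G(2) t(3,4)] K0_rel_trans K0_rel_sym by blast
qed

section \<open>Compositions\<close>

text \<open>Rotating inside the corner of \<open>p + q\<close> changes the pair consisting of
  \<open>w * v\<close> on p and minus the identity on q into v on p and w on q. The extra triple on
  q has trivial class.\<close>

lemma K0_rel_comp_orth:
  assumes G: "(p, q, v) \<in> Gamma0 \<phi>" "(q, r, w) \<in> Gamma0 \<phi>"
    and o: "p * q = 0" "q * r = 0" "p * r = 0"
  shows "((p, q, v) + (q, r, w), (p, r, w * v)) \<in> K0_rel \<phi>"
proof -
  have P: "projection p" "projection q" "projection r" and v: "partial_isometry_from_to v (\<Phi> p) (\<Phi> q)"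
    and w: "partial_isometry_from_to w (\<Phi> q) (\<Phi> r)"
    using G by (auto simp: Gamma0_iff)
  have o': "q * p = 0" "r * q = 0" "r * p = 0" using P o projection_orth_sym by blast+
  have O: "\<Phi> p * \<Phi> q = 0" "\<Phi> q * \<Phi> p = 0" "\<Phi> r * \<Phi> q = 0" "\<Phi> q * \<Phi> r = 0" "\<Phi> r * \<Phi> p = 0"
    using o o' by (simp_all flip: \<Phi>_simps(2))
  have Q: "partial_isometry_from_to (- \<Phi> q) (\<Phi> q) (\<Phi> q)"
    by (intro pift_minus pift_self projection_hom[OF \<Phi>_hom] P)
  \<comment> \<open>The sign is dictated by the end of the rotation:
    \<open>?u * (star v - v) = w * v * star v + \<Phi> q * v = w + v\<close>, the other two products
    being zero.\<close>
  let ?u = "w * v - \<Phi> q"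
  have wv: "(p, r, w * v) \<in> Gamma0 \<phi>" and qq: "(q, q, - \<Phi> q) \<in> Gamma0 \<phi>"
    and oo: "orth (p, r, w * v) (q, q, - \<Phi> q)"
    using P pift_mult[OF v w] Q o o' by (auto simp: Gamma0_iff)
  have u: "partial_isometry_from_to ?u (\<Phi> p + \<Phi> q) (\<Phi> q + \<Phi> r)"
    using pift_add[OF pift_mult[OF v w] Q O(1,3)] by (simp add: add.commute)
  have rot: "partial_isometry_from_to (rot (star v) t) (\<Phi> p + \<Phi> q) (\<Phi> p + \<Phi> q)" for t
    using pift_rot[OF pift_star[OF v] O(2)] by (simp add: add.commute)
  have z: "w * v * v = 0" "\<Phi> q * w = 0" "\<Phi> q * star v = 0" "w * v * star v = w" "\<Phi> q * v = v"
    using pift_orth(3)[OF v v O(1)] O pift_simps[OF v] pift_simps[OF w] mult_zero_between[of "\<Phi> q" "\<Phi> q" "\<Phi> r" w]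
      mult_zero_between[of "\<Phi> q" "\<Phi> q" "\<Phi> p" "star v"] P(2)[THEN projection_hom[OF \<Phi>_hom]]
    by (auto simp: mult.assoc projection_def)
  have "((p + q, q + r, ?u), (p + q, q + r, v + w)) \<in> K0_rel \<phi>"
  proof (rule K0_rel_homotopic[of _ _ _ _ "\<lambda>t. ?u * rot (star v) t"])
    show "(p + q, q + r, ?u) \<in> Gamma0 \<phi>"
      using u P o by (simp add: Gamma0_iff projection_add)
    show "(p + q, q + r, v + w) \<in> Gamma0 \<phi>"
      using Gamma0_add[OF G] o by simp
    show "matrix_path (\<lambda>t. ?u * rot (star v) t)"
      by (intro matrix_path_mult matrix_path_const matrix_path_rot)
    show "?u * rot (star v) 0 = ?u"
      using pift_simps(3)[OF u] pift_simps[OF v] by (simp add: rot_ends add.commute)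
    show "?u * rot (star v) 1 = v + w"
      using z by (simp add: rot_ends algebra_simps)
    show "partial_isometry_from_to (?u * rot (star v) t) (\<Phi> (p + q)) (\<Phi> (q + r))" for t
      using pift_mult[OF rot u] by simp
  qed
  then have "((p, q, v) + (q, r, w), (p, r, w * v) + (q, q, - \<Phi> q)) \<in> K0_rel \<phi>"
    using K0_rel_sym by (simp add: add.commute)
  moreover have "((p, r, w * v) + (q, q, - \<Phi> q), (p, r, w * v)) \<in> K0_rel \<phi>"
  proof -
    \<comment> \<open>The sign is absorbed by an isomorphism, with q on one side and - q on the
      other, instead of by a path from \<open>\<Phi> q\<close> to \<open>- \<Phi> q\<close>.\<close>
    have i: "iso (q, q, - \<Phi> q) (q, q, \<Phi> q)"
      by (rule isoI[OF pift_self[OF P(2)] pift_minus[OF pift_self[OF P(2)]]]) simp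
    have e: "(q, q, \<Phi> q) \<in> elementary \<phi>" and o2: "orth (p, r, w * v) (q, q, \<Phi> q)"
      using elementary_self P oo by auto
    have "((p, r, w * v) + (q, q, - \<Phi> q), (p, r, w * v) + (q, q, \<Phi> q)) \<in> K0_rel \<phi>"
      by (intro K0_rel_iso iso_add Gamma0_add iso_refl i wv qq oo o2 elementary_Gamma0[OF e])
    then show ?thesis
      using K0_rel_add_elementary[OF wv e o2] K0_rel_trans by blast
  qed
  ultimately show ?thesis by (rule K0_rel_trans)
qed

section \<open>Addition of classes\<close>

text \<open>By the congruence property every member of the union defining \<open>K0_add\<close> is
  the same class, and that class can be computed from any orthogonal pair of
  representatives.\<close>

lemma K0_add_eq:
  assumes s: "(\<sigma>, \<sigma>') \<in> K0_rel \<phi>" and r: "(\<rho>, \<rho>') \<in> K0_rel \<phi>" and o: "orth \<sigma>' \<rho>'"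
  shows "K0_add \<phi> (K0_class \<phi> \<sigma>) (K0_class \<phi> \<rho>) = K0_class \<phi> (\<sigma>' + \<rho>')"
proof -
  note G = K0_rel_Gamma0[OF s] K0_rel_Gamma0[OF r]
  have eq: "K0_class \<phi> (\<alpha> \<oplus>\<oplus>\<^bsub>n\<^esub> \<beta>) = K0_class \<phi> (\<sigma>' + \<rho>')"
    if a: "\<alpha> \<in> K0_class \<phi> \<sigma>" and b: "\<beta> \<in> K0_class \<phi> \<rho>" and n: "\<alpha> \<in> triple_mat n" for \<alpha> \<beta> n
  proof -
    have a': "(\<alpha>, \<sigma>') \<in> K0_rel \<phi>" and b': "(\<beta>, \<rho>') \<in> K0_rel \<phi>"
      using K0_rel_trans[OF K0_rel_sym s] K0_rel_trans[OF K0_rel_sym r] a b by (auto simp: K0_class_def)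
    have "(shift_triple n \<beta>, \<rho>') \<in> K0_rel \<phi>"
      using K0_rel_trans[OF K0_rel_sym[OF K0_rel_iso[OF _ shift_triple_iso]] b'] K0_rel_Gamma0[OF b'] by blast
    then have "(\<alpha> \<oplus>\<oplus>\<^bsub>n\<^esub> \<beta>, \<sigma>' + \<rho>') \<in> K0_rel \<phi>"
      unfolding triple_sum_eq[OF n] by (intro K0_rel_add a' o orth_shift n)
    then show ?thesis
      using K0_class_eq_iff K0_rel_Gamma0 by blast
  qed
  obtain n where n: "\<sigma> \<in> triple_mat n"
    using eventually_seq_ex[OF eventually_triple_mat] by blast
  have self: "\<sigma> \<in> K0_class \<phi> \<sigma>" "\<rho> \<in> K0_class \<phi> \<rho>"
    using G equiv_class_self[OF equiv_K0_rel] unfolding K0_class_def by blast+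
  show ?thesis
  proof
    show "K0_add \<phi> (K0_class \<phi> \<sigma>) (K0_class \<phi> \<rho>) \<subseteq> K0_class \<phi> (\<sigma>' + \<rho>')"
      unfolding K0_add_def using eq by (intro UN_least) simp
    show "K0_class \<phi> (\<sigma>' + \<rho>') \<subseteq> K0_add \<phi> (K0_class \<phi> \<sigma>) (K0_class \<phi> \<rho>)"
      unfolding K0_add_def eq[OF self n, symmetric]
      by (rule subset_trans[OF _ UN_upper[OF self(1)]], rule subset_trans[OF _ UN_upper[OF self(2)]],
        rule UN_upper) (simp add: n)
  qed
qed

lemma K0_add_comp:
  assumes G: "(p, q, v) \<in> Gamma0 \<phi>" "(q, r, w) \<in> Gamma0 \<phi>"
  shows "K0_add \<phi> (K0_class \<phi> (p, q, v)) (K0_class \<phi> (q, r, w)) = K0_class \<phi> (p, r, w * v)"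
proof -
  have P: "projection p" "projection q" "projection r" and v: "partial_isometry_from_to v (\<Phi> p) (\<Phi> q)"
    and w: "partial_isometry_from_to w (\<Phi> q) (\<Phi> r)"
    using G by (auto simp: Gamma0_iff)
  have "\<forall>\<^sub>F n in sequentially. p \<in> fin_mat n \<and> q \<in> fin_mat n \<and> r \<in> fin_mat n"
    by (intro eventually_conj eventually_fin_mat)
  then obtain n where n: "p \<in> fin_mat n" "q \<in> fin_mat n" "r \<in> fin_mat n"
    by (auto dest: eventually_seq_ex)
  \<comment> \<open>p stays in the first block while q and r move to the second and third, which
    makes all three pairwise orthogonal.\<close>
  let ?q = "0 \<oplus>\<^bsub>n\<^esub> q" and ?r = "0 \<oplus>\<^bsub>n + n\<^esub> r"
  obtain c where c: "partial_isometry_from_to c q ?q"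
    using pift_shift[OF P(2) n(2)] by blast
  obtain d where d: "partial_isometry_from_to d r ?r"
    using pift_shift[OF P(3) n(3)] by blast
  note p = pift_self[OF P(1)]
  have wv: "(p, r, w * v) \<in> Gamma0 \<phi>"
    using P pift_mult[OF v w] by (auto simp: Gamma0_iff)
  let ?v = "\<Phi> c * v * \<Phi> (star p)" and ?w = "\<Phi> d * w * \<Phi> (star c)"
  note t = transport[OF G(1) p c] and t' = transport[OF G(2) c d] and t'' = transport[OF wv p d]
  \<comment> \<open>The same c moves q in both triples, so \<open>star c * c = q\<close> disappears
    between w and v.\<close>
  have "?w * ?v = \<Phi> d * w * (\<Phi> (star c) * \<Phi> c) * v * \<Phi> (star p)"
    by (simp only: mult.assoc)
  also have "\<dots> = \<Phi> d * (w * v) * \<Phi> (star p)"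
    using pift_simps[OF pift_\<Phi>[OF c]] pift_simps[OF v] pift_simps[OF w] by (simp add: mult.assoc)
  finally have e: "?w * ?v = \<Phi> d * (w * v) * \<Phi> (star p)" .
  have o: "p * ?q = 0" "?q * ?r = 0" "p * ?r = 0"
    using n fin_mat_dsum[OF fin_mat_zero n(2)]
    by (auto intro!: mult_shift_block intro: fin_mat_mono)
  have "K0_add \<phi> (K0_class \<phi> (p, q, v)) (K0_class \<phi> (q, r, w)) = K0_class \<phi> ((p, ?q, ?v) + (?q, ?r, ?w))"
    using o by (intro K0_add_eq K0_rel_iso t t' G) auto
  also have "\<dots> = K0_class \<phi> (p, r, w * v)"
    using K0_rel_trans[OF K0_rel_comp_orth[OF t(1) t'(1) o, unfolded e] K0_rel_sym[OF K0_rel_iso[OF wv t'']]]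
    by (meson K0_class_eq_iff K0_rel_Gamma0)
  finally show ?thesis .
qed

section \<open>Orthogonal sums\<close>

lemma block_mat_split: "a \<in> fin_mat n \<Longrightarrow> block_mat n a b c d = (a :: 'c::star_ring minf) + block_mat n 0 b c d"
  using block_mat_add[of n a 0 0 0 0 b c d] by (simp add: block_mat_diag1)

text \<open>The three cases differ only in which projections of the second triple are shifted away:
  q' alone, p' alone, or neither. The first triple never moves.\<close>

lemma orthogonal_sum_iso:
  assumes G: "(p, q, v) \<in> Gamma0 \<phi>" "(p', q', v') \<in> Gamma0 \<phi>"
    and n: "(p, q, v) \<in> triple_mat n" "(p', q', v') \<in> triple_mat n"
  shows "p * p' = 0 \<Longrightarrow> iso ((p, q, v) \<oplus>\<oplus>\<^bsub>n\<^esub> (p', q', v')) (p + p', q \<oplus>\<^bsub>n\<^esub> q', block_mat n v 0 v' 0)"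
    and "q * q' = 0 \<Longrightarrow> iso ((p, q, v) \<oplus>\<oplus>\<^bsub>n\<^esub> (p', q', v')) (p \<oplus>\<^bsub>n\<^esub> p', q + q', block_mat n v v' 0 0)"
    and "p * p' = 0 \<Longrightarrow> q * q' = 0 \<Longrightarrow> iso ((p, q, v) \<oplus>\<oplus>\<^bsub>n\<^esub> (p', q', v')) (p + p', q + q', v + v')"
proof -
  have N: "p \<in> fin_mat n" "q \<in> fin_mat n" "v \<in> fin_mat n" "p' \<in> fin_mat n" "q' \<in> fin_mat n" "v' \<in> fin_mat n"
    using n by (auto simp: triple_mat_def)
  have P: "projection p'" "projection q'" and v': "partial_isometry_from_to v' (\<Phi> p') (\<Phi> q')"
    using G by (auto simp: Gamma0_iff)
  have s: "star (\<Phi> p') = \<Phi> p'" "star (\<Phi> q') = \<Phi> q'" "star p' = p'" "star q' = q'"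
    using P P[THEN projection_hom[OF \<Phi>_hom]] by (auto simp: projection_def)
  note S = pift_shift[OF P(1) N(4), of n] pift_shift[OF P(2) N(5), of n]
  note sum = triple_sum_iso(1)[OF G n(1) G(1) _ iso_refl[OF G(1)]]
  show "iso ((p, q, v) \<oplus>\<oplus>\<^bsub>n\<^esub> (p', q', v')) (p + p', q + q', v + v')" if "p * p' = 0" "q * q' = 0"
    using sum[OF G(2) iso_refl[OF G(2)]] that by (simp del: triple_iso.simps)
  show "iso ((p, q, v) \<oplus>\<oplus>\<^bsub>n\<^esub> (p', q', v')) (p + p', q \<oplus>\<^bsub>n\<^esub> q', block_mat n v 0 v' 0)" if "p * p' = 0"
  proof -
    note t = transport[OF G(2) pift_self[OF P(1)] S(2)]
    \<comment> \<open>Shifting only the range moves v' to the lower left block; shifting only the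
      domain, as in the other case, moves it to the upper right one.\<close>
    have "\<Phi> (shift_mat n n * q') * v' * \<Phi> (star p') = block_mat n 0 0 v' 0"
      using pift_simps[OF v'] s N by (simp add: block_mat_eq[of _ _ _ _ n] mult.assoc)
    with sum[OF t] that N show ?thesis
      by (simp add: mult_shift_block block_mat_split[of v n 0 v' 0] block_mat_split[of q n 0 0 q']
        del: triple_iso.simps)
  qed
  show "iso ((p, q, v) \<oplus>\<oplus>\<^bsub>n\<^esub> (p', q', v')) (p \<oplus>\<^bsub>n\<^esub> p', q + q', block_mat n v v' 0 0)" if "q * q' = 0"
  proof -
    note t = transport[OF G(2) S(1) pift_self[OF P(2)]]
    have "\<Phi> q' * v' * \<Phi> (star (shift_mat n n * p')) = block_mat n 0 v' 0 0"
      using pift_simps[OF v'] s N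
      by (simp add: block_mat_eq[of _ _ _ _ n] star_mult) (simp flip: mult.assoc)
    with sum[OF t] that N show ?thesis
      by (simp add: mult_shift_block block_mat_split[of v n v' 0 0] block_mat_split[of p n 0 0 p']
        del: triple_iso.simps)
  qed
qed

end

section \<open>Sizes of partial isometries and unitaries of corners\<close>

lemma map_minf_block: "map_minf f (block_mat n a b c d) =
    block_mat n (map_minf f a) (map_minf f b) (map_minf f c) (map_minf f d)"
  by (rule minf_eqI) auto

lemma scalar_mat_simps [simp]:
  "scalar_mat (x + y) = scalar_mat x + scalar_mat y"
  "scalar_mat (x - y) = scalar_mat x - scalar_mat y"
  "scalar_mat (x * y) = scalar_mat x * scalar_mat y"
  "scalar_mat (star x) = star (scalar_mat x)"
  "scalar_mat 0 = 0"
  "scalar_mat (id_mat n) = id_mat n"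
  "scalar_mat (block_mat n a b c d) = block_mat n (scalar_mat a) (scalar_mat b) (scalar_mat c) (scalar_mat d)"
  "scalar_mat (shift_mat n N) = shift_mat n N"
proof -
  show "scalar_mat (id_mat n) = id_mat n" "scalar_mat (shift_mat n N) = shift_mat n N"
    by (auto intro!: minf_eqI simp: scalar_def zero_unitization_def one_unitization_def)
qed (fact ring_star_hom_simps[OF ring_star_hom_scalar_mat] map_minf_block)+

lemma fin_mat_sandwich:
  fixes a :: "'a::star_ring minf"
  shows "a \<in> fin_mat n \<Longrightarrow> b \<in> fin_mat n \<Longrightarrow> a * u * b \<in> fin_mat n"
proof -
  assume a: "a \<in> fin_mat n" and b: "b \<in> fin_mat n"
  have "entry (a * u * b) i j = (\<Sum>k<n. (\<Sum>l<n. entry a i l * entry u l k) * entry b k j)" for i j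
    using a b by (simp add: entry_mult[of _ n])
  then show ?thesis
    using a b by (auto simp: fin_mat_def)
qed

text \<open>Since \<open>v = q * v * p\<close>, its rows are bounded by those of q and its columns
  by those of p.\<close>

lemma pift_fin_mat:
  fixes v :: "'a::star_ring minf"
  assumes "partial_isometry_from_to v p q" "p \<in> fin_mat n" "q \<in> fin_mat n"
  shows "v \<in> fin_mat n"
  using fin_mat_sandwich[OF assms(3,2), of v] by (simp add: pift_simps[OF assms(1)])

text \<open>The factorization through e on both sides supplies the support condition of
  \<open>pift_intro\<close>. The assumption on R covers \<open>UNIV\<close> as well as a matrix
  algebra of fixed size containing e.\<close>

lemma corner_unitaries_iff:
  assumes "projection e" "\<And>u. partial_isometry_from_to u e e \<Longrightarrow> u \<in> R"
  shows "u \<in> corner_unitaries R e \<longleftrightarrow> partial_isometry_from_to u e e"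
proof
  assume "u \<in> corner_unitaries R e"
  then obtain a where u: "u = e * a * e" "star u * u = e" "u * star u = e"
    by (auto simp: corner_unitaries_def)
  have "u * e = u"
    using assms(1) by (simp add: u(1) mult.assoc projection_def)
  with u show "partial_isometry_from_to u e e"
    by (intro pift_intro)
next
  assume u: "partial_isometry_from_to u e e"
  moreover have "u = e * u * e" by (simp add: pift_simps[OF u])
  ultimately show "u \<in> corner_unitaries R e"
    using assms(2) unfolding corner_unitaries_def by (auto simp: pift_simps[OF u] intro!: bexI[of _ u])
qed

lemma homotopic_unitaries_iff:
  assumes "projection e" "\<And>u. partial_isometry_from_to u e e \<Longrightarrow> u \<in> R"
  shows "homotopic_unitaries R e u u' \<longleftrightarrow>
    (\<exists>V. matrix_path V \<and> V 0 = u \<and> V 1 = u' \<and> (\<forall>t\<in>{0..1}. partial_isometry_from_to (V t) e e))"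
  by (simp add: homotopic_unitaries_def corner_unitaries_iff[OF assms])

lemma projection_dsum:
  fixes p q :: "'a::{star_ring,ring_1} minf"
  assumes "projection p" "projection q" "p \<in> fin_mat n" "q \<in> fin_mat k"
  shows "projection (p \<oplus>\<^bsub>n\<^esub> q)" "p \<oplus>\<^bsub>n\<^esub> q \<in> fin_mat (n + k)"
proof -
  show "projection (p \<oplus>\<^bsub>n\<^esub> q)"
    unfolding dsum_eq[OF assms(3)]
    by (rule projection_add[OF assms(1) pift_projection(2)[OF pift_shift[OF assms(2,4)]] mult_shift_block[OF assms(3)]])
  show "p \<oplus>\<^bsub>n\<^esub> q \<in> fin_mat (n + k)"
    by (rule fin_mat_dsum[OF assms(3,4)])
qed

lemma padded_id_eq:
  "n \<le> m \<Longrightarrow> padded_id m n k = id_mat n \<oplus>\<^bsub>m\<^esub> id_mat k"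
  by (rule minf_eqI) auto

context cstar_hom
begin

section \<open>Normal forms\<close>

text \<open>Taking scalar parts before or after \<Phi> is in both cases an amplified composite of
  \<phi> with a zero map, hence an amplified zero map.\<close>

lemma scalar_mat_\<Phi>: "scalar_mat (\<Phi> x) = amplify (\<lambda>_. 0) x" "\<Phi> (scalar_mat x) = amplify (\<lambda>_. 0) x"
proof -
  have "\<phi> 0 = 0" using ring_star_hom_simps(4)[OF star_hom_ring_star_hom[OF hom]] .
  then show "scalar_mat (\<Phi> x) = amplify (\<lambda>_. 0) x" "\<Phi> (scalar_mat x) = amplify (\<lambda>_. 0) x"
    by (simp_all add: scalar_mat_eq amplify_amplify hom star_hom_zero comp_def)
qed

text \<open>
  The scalar matrix \<open>u\<close> maps the range of the scalar part of p onto that of \<open>id_mat n\<close> by the scalar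
  part of v, and shifts the complement out of the way, so that no unitary extension of the scalar part
  of v is needed.
\<close>

lemma normalize_scalar_part:
  assumes G: "(p, id_mat n, v) \<in> Gamma0 \<phi>"
  shows "\<exists>p' v'. (p', id_mat n, v') \<in> Gamma0 \<phi> \<and> scalar_mat p' = id_mat n \<and> scalar_mat v' = id_mat n \<and>
    iso (p, id_mat n, v) (p', id_mat n, v')"
proof -
  have p: "projection p" and v: "partial_isometry_from_to v (\<Phi> p) (id_mat n)"
    using G by (auto simp: Gamma0_iff)
  have "\<forall>\<^sub>F N in sequentially. p \<in> fin_mat N \<and> n \<le> N"
    by (intro eventually_conj eventually_fin_mat eventually_ge_at_top)
  then obtain N where N: "p \<in> fin_mat N" "n \<le> N"
    by (auto dest: eventually_seq_ex)
  \<comment> \<open>v lives over the target algebra, but its scalar part has complex entries; the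
    zero homomorphism in the opposite direction brings it to matrices over the source.\<close>
  define w :: "'a unitization minf" where "w = amplify (\<lambda>_. 0) v"
  define e where "e = scalar_mat p"
  define E :: "'a unitization minf \<Rightarrow> 'b unitization minf" where "E = amplify (\<lambda>_. 0)"
  have E: "ring_star_hom E" unfolding E_def by (rule ring_star_hom_amplify[OF star_hom_zero])
  have Ew: "E w = scalar_mat v"
    by (simp add: E_def w_def scalar_mat_eq amplify_amplify star_hom_zero comp_def)
  have sw: "scalar_mat w = w" and se: "scalar_mat e = e"
    by (simp_all add: w_def e_def scalar_mat_eq amplify_amplify star_hom_zero comp_def)
  have w: "partial_isometry_from_to w e (id_mat n)"
  proof -
    have "amplify (\<lambda>_. 0) (\<Phi> p) = e"
      by (simp add: e_def scalar_mat_eq amplify_amplify hom star_hom_zero comp_def)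
    moreover have "ring_star_hom (amplify (\<lambda>_. 0) :: 'b unitization minf \<Rightarrow> 'a unitization minf)"
      by (rule ring_star_hom_amplify[OF star_hom_zero])
    ultimately show ?thesis
      using pift_hom[OF _ v, of "amplify (\<lambda>_. 0 :: 'a)"]
      by (simp add: w_def amplify_id_shift[OF star_hom_zero])
  qed
  have e: "projection e" "e \<in> fin_mat N"
    using N pift_projection[OF w] by (auto simp: e_def)
  define g where "g = id_mat N - e"
  have g: "projection g" "g \<in> fin_mat N"
    using e unfolding g_def by (auto intro: projection_diff simp: id_mat_mult)
  have eg: "e * g = 0" "g * e = 0"
    using e by (auto simp: g_def algebra_simps id_mat_mult projection_def)
  \<comment> \<open>w sends e onto \<open>id_mat n\<close>, and the shift sends the complement g
    beyond N. As n is at most N, the two images are orthogonal and u is isometric on all of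
    \<open>id_mat N\<close>, in particular on p.\<close>
  define u where "u = w + shift_mat N N * g"
  have "partial_isometry_from_to u (e + g) (id_mat n + (0 \<oplus>\<^bsub>N\<^esub> g))"
    unfolding u_def by (intro pift_add w pift_shift g eg mult_shift_block fin_mat_id N)
  then have u: "partial_isometry_from_to u (id_mat N) (id_mat n + (0 \<oplus>\<^bsub>N\<^esub> g))"
    by (simp add: g_def)
  have ue: "u * e = w"
    using pift_simps[OF w] eg by (simp add: u_def distrib_right mult.assoc)
  have su: "scalar_mat u = u"
    by (simp add: u_def g_def sw se)
  define p' where "p' = u * p * star u"
  have c: "partial_isometry_from_to (u * p) p p'"
    unfolding p'_def by (rule pift_restrict[OF p]) (simp add: pift_simps[OF u] id_mat_mult[OF N(1)])
  define v' where "v' = \<Phi> (id_mat n) * v * \<Phi> (star (u * p))"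
  note t = transport[OF G c pift_self[OF projection_id_mat], folded v'_def]
  have "scalar_mat p' = u * e * star u"
    by (simp add: p'_def su e_def)
  also have "\<dots> = w * e * star u"
    unfolding ue by (simp add: pift_simps[OF w])
  also have "\<dots> = w * star (u * e)"
    using e by (simp add: star_mult projection_def mult.assoc)
  also have "\<dots> = id_mat n" unfolding ue by (rule pift_simps[OF w])
  finally have "scalar_mat p' = id_mat n" .
  moreover have "scalar_mat v' = id_mat n"
  proof -
    have "v' = v * \<Phi> (star (u * p))"
      using pift_simps[OF v] by (simp add: v'_def)
    then have "scalar_mat v' = scalar_mat v * star (E (u * p))"
      using ring_star_hom_simps(3)[OF E, of "u * p"]
      by (simp only: scalar_mat_simps scalar_mat_\<Phi> E_def)
    \<comment> \<open>\<open>E\<close> sees only scalar parts, so p may be replaced by its scalar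
      part e; then \<open>u * e = w\<close> turns the product into \<open>v * star v\<close> on
      scalar parts.\<close>
    also have "E (u * p) = E (u * e)"
    proof -
      have "E e = E p"
        unfolding e_def E_def by (simp add: scalar_mat_eq amplify_amplify star_hom_zero comp_def)
      then show ?thesis by (simp add: ring_star_hom_simps[OF E])
    qed
    also have "\<dots> = scalar_mat v" by (simp only: ue Ew)
    also have "scalar_mat v * star (scalar_mat v) = scalar_mat (v * star v)" by simp
    also have "\<dots> = id_mat n" unfolding pift_simps[OF v] by simp
    finally show ?thesis .
  qed
  ultimately show ?thesis using t by blast
qed

lemma normal_form:
  assumes "\<sigma> \<in> Gamma0 \<phi>"
  shows "\<exists>n p v. n \<ge> 1 \<and> (p, id_mat n, v) \<in> Gamma0 \<phi> \<and>
    scalar_mat p = id_mat n \<and> scalar_mat v = id_mat n \<and> (\<sigma>, (p, id_mat n, v)) \<in> K0_rel \<phi>"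
proof -
  obtain p q v where s: "\<sigma> = (p, q, v)" by (cases \<sigma>) auto
  have "\<forall>\<^sub>F n in sequentially. \<sigma> \<in> triple_mat n \<and> 1 \<le> n"
    by (intro eventually_conj eventually_triple_mat eventually_ge_at_top)
  then obtain n where n: "(p, q, v) \<in> triple_mat n" "1 \<le> n"
    using s by (auto dest: eventually_seq_ex)
  then have N: "p \<in> fin_mat n" "q \<in> fin_mat n" by (auto simp: triple_mat_def)
  have G: "(p, q, v) \<in> Gamma0 \<phi>" and P: "projection q" using assms s by (auto simp: Gamma0_iff)
  define r where "r = id_mat n - q"
  have r: "projection r" "r \<in> fin_mat n"
    using P N unfolding r_def by (auto intro: projection_diff simp: id_mat_mult)
  have qr: "q * r = 0"
    using P N by (simp add: r_def algebra_simps id_mat_mult projection_def)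
  have e: "(r, r, \<Phi> r) \<in> elementary \<phi>" by (rule elementary_self[OF r(1)])
  \<comment> \<open>Only the first entry of the added triple is shifted, away from p. The second
    stays in place, so that \<open>q + r\<close> is literally \<open>id_mat n\<close> and not just
    equivalent to it.\<close>
  note t = transport[OF elementary_Gamma0[OF e] pift_shift[OF r, of n] pift_self[OF r(1)]]
  let ?w = "\<Phi> r * \<Phi> r * \<Phi> (star (shift_mat n n * r))"
  have o: "orth (p, q, v) (0 \<oplus>\<^bsub>n\<^esub> r, r, ?w)"
    using qr mult_shift_block[OF N(1)] by simp
  have "((p, q, v) + (0 \<oplus>\<^bsub>n\<^esub> r, r, ?w), (p, q, v) \<oplus>\<oplus>\<^bsub>n\<^esub> (r, r, \<Phi> r)) \<in> K0_rel \<phi>"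
    by (intro K0_rel_iso Gamma0_add triple_sum_Gamma0 triple_sum_iso G t elementary_Gamma0[OF e] n iso_refl o)
  moreover have "((p, q, v) \<oplus>\<oplus>\<^bsub>n\<^esub> (r, r, \<Phi> r), (p, q, v)) \<in> K0_rel \<phi>"
    unfolding triple_sum_eq[OF n(1)]
    by (intro K0_rel_add_elementary G elementary_shift e orth_shift n)
  ultimately have "((p, q, v), (p, q, v) + (0 \<oplus>\<^bsub>n\<^esub> r, r, ?w)) \<in> K0_rel \<phi>"
    using K0_rel_trans K0_rel_sym by blast
  moreover have "q + r = id_mat n" by (simp add: r_def)
  ultimately have 1: "((p, q, v), (p + (0 \<oplus>\<^bsub>n\<^esub> r), id_mat n, v + ?w)) \<in> K0_rel \<phi>"
    by (simp del: \<Phi>_simps)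
  obtain p' v' where 2: "(p', id_mat n, v') \<in> Gamma0 \<phi>" "scalar_mat p' = id_mat n" "scalar_mat v' = id_mat n"
    "iso (p + (0 \<oplus>\<^bsub>n\<^esub> r), id_mat n, v + ?w) (p', id_mat n, v')"
    using normalize_scalar_part K0_rel_Gamma0[OF 1] by blast
  have "(\<sigma>, (p', id_mat n, v')) \<in> K0_rel \<phi>"
    using K0_rel_trans[OF 1 K0_rel_iso[OF _ 2(1,4)]] K0_rel_Gamma0[OF 1] s by blast
  with 2 n show ?thesis by blast
qed

section \<open>Reversed triples\<close>

text \<open>Exchanges the roles of p and q and respects all the structure, so the second normal form
  is the reversal of the first.\<close>

fun reverse :: "('a, 'b) triple \<Rightarrow> ('a, 'b) triple" where
  "reverse (p, q, v) = (q, p, star v)"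

lemma reverse_reverse [simp]: "reverse (reverse \<sigma>) = \<sigma>"
  by (cases \<sigma>) simp

lemma reverse_add: "reverse (\<sigma> + \<tau>) = reverse \<sigma> + reverse \<tau>"
  by (cases \<sigma>; cases \<tau>) (simp add: star_add)

lemma reverse_shift: "reverse (shift_triple n \<sigma>) = shift_triple n (reverse \<sigma>)"
proof -
  have "star (0 \<oplus>\<^bsub>n\<^esub> (a :: 'b unitization minf)) = 0 \<oplus>\<^bsub>n\<^esub> star a" for a
    by (rule minf_eqI) auto
  then show ?thesis by (cases \<sigma>) simp
qed

lemma reverse_Gamma0: "\<sigma> \<in> Gamma0 \<phi> \<Longrightarrow> reverse \<sigma> \<in> Gamma0 \<phi>"
  by (cases \<sigma>) (auto simp: Gamma0_iff pift_star)

lemma reverse_triple_mat: "\<sigma> \<in> triple_mat n \<Longrightarrow> reverse \<sigma> \<in> triple_mat n"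
  by (cases \<sigma>) (auto simp: triple_mat_def)

lemma reverse_elementary: "\<sigma> \<in> elementary \<phi> \<Longrightarrow> reverse \<sigma> \<in> elementary \<phi>"
proof (erule elementaryE)
  fix p v V
  assume s: "\<sigma> = (p, p, v)" and p: "projection p" and V: "matrix_path V" "V 0 = \<Phi> p" "V 1 = v"
    and Vt: "\<And>t. t \<in> {0..1} \<Longrightarrow> partial_isometry_from_to (V t) (\<Phi> p) (\<Phi> p)"
  have "(p, p, star v) \<in> elementary \<phi>"
    by (rule elementaryI[of _ "\<lambda>t. star (V t)"])
      (use p V Vt in \<open>auto simp: projection_def simp flip: \<Phi>_simps(3) intro: pift_star\<close>)
  then show "reverse \<sigma> \<in> elementary \<phi>" by (simp add: s)
qed

lemma reverse_iso:
  assumes G: "\<sigma> \<in> Gamma0 \<phi>" "\<sigma>' \<in> Gamma0 \<phi>" and i: "iso \<sigma> \<sigma>'"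
  shows "iso (reverse \<sigma>) (reverse \<sigma>')"
proof -
  obtain p q v p' q' v' where s: "\<sigma> = (p, q, v)" "\<sigma>' = (p', q', v')"
    by (cases \<sigma>; cases \<sigma>') auto
  from iso_sym[OF G i] s obtain c d where c: "partial_isometry_from_to c p' p"
    and d: "partial_isometry_from_to d q' q" and e: "\<Phi> d * v' = v * \<Phi> c"
    by auto
  have "\<Phi> (star c) * star v = star v' * \<Phi> (star d)"
    using arg_cong[OF e, of star] by (simp add: star_mult)
  then show ?thesis
    unfolding s reverse.simps by (intro isoI[OF pift_star[OF d] pift_star[OF c]])
qed

lemma reverse_K0_rel:
  assumes "(\<sigma>, \<sigma>') \<in> K0_rel \<phi>"
  shows "(reverse \<sigma>, reverse \<sigma>') \<in> K0_rel \<phi>"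
proof -
  obtain \<tau> \<tau>' where e: "\<tau> \<in> elementary \<phi>" "\<tau>' \<in> elementary \<phi>" and
    i: "\<And>n. \<sigma> \<in> triple_mat n \<Longrightarrow> \<sigma>' \<in> triple_mat n \<Longrightarrow> iso (\<sigma> + shift_triple n \<tau>) (\<sigma>' + shift_triple n \<tau>')"
    using assms by (rule K0_relE) blast
  obtain n where n: "\<sigma> \<in> triple_mat n" "\<sigma>' \<in> triple_mat n"
    using eventually_seq_ex[OF eventually_conj[OF eventually_triple_mat[of \<sigma>] eventually_triple_mat[of \<sigma>']]]
    by blast
  note G = K0_rel_Gamma0[OF assms, THEN conjunct1] K0_rel_Gamma0[OF assms, THEN conjunct2]
    and E = elementary_shift[OF e(1), THEN elementary_Gamma0] elementary_shift[OF e(2), THEN elementary_Gamma0]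
  have "iso (reverse (\<sigma> + shift_triple n \<tau>)) (reverse (\<sigma>' + shift_triple n \<tau>'))"
    by (intro reverse_iso Gamma0_add G E orth_shift n i)
  then have "iso (reverse \<sigma> + shift_triple n (reverse \<tau>)) (reverse \<sigma>' + shift_triple n (reverse \<tau>'))"
    by (simp only: reverse_add reverse_shift)
  then show ?thesis
    by (rule K0_relI[rotated -1])
      (intro reverse_Gamma0 G elementary_shift reverse_elementary e orth_shift reverse_triple_mat n)+
qed

lemma normal_form_reverse:
  assumes "\<sigma> \<in> Gamma0 \<phi>"
  shows "\<exists>n q v. n \<ge> 1 \<and> (id_mat n, q, v) \<in> Gamma0 \<phi> \<and>
    scalar_mat q = id_mat n \<and> scalar_mat v = id_mat n \<and> (\<sigma>, (id_mat n, q, v)) \<in> K0_rel \<phi>"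
proof -
  obtain n p v where n: "n \<ge> 1" "(p, id_mat n, v) \<in> Gamma0 \<phi>"
    "scalar_mat p = id_mat n" "scalar_mat v = id_mat n" "(reverse \<sigma>, (p, id_mat n, v)) \<in> K0_rel \<phi>"
    using normal_form[OF reverse_Gamma0[OF assms]] by blast
  have "(id_mat n, p, star v) \<in> Gamma0 \<phi>" "(\<sigma>, (id_mat n, p, star v)) \<in> K0_rel \<phi>"
    using reverse_Gamma0[OF n(2)] reverse_K0_rel[OF n(5)] by simp_all
  moreover have "scalar_mat (star v) = id_mat n" using n(4) by simp
  ultimately show ?thesis using n by blast
qed

section \<open>Vanishing classes\<close>

lemma zero_Gamma0: "0 \<in> Gamma0 \<phi>"
  by (rule elementary_Gamma0[OF elementary_zero])

lemma K0_zero_iff: "\<sigma> \<in> Gamma0 \<phi> \<Longrightarrow> K0_class \<phi> \<sigma> = K0_zero \<phi> \<longleftrightarrow> (\<sigma>, 0) \<in> K0_rel \<phi>"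
  unfolding K0_zero_def using K0_class_eq_iff[OF _ zero_Gamma0] by (simp add: zero_prod_def)

lemma vanishing:
  assumes G: "(p, q, v) \<in> Gamma0 \<phi>" and n: "(p, q, v) \<in> triple_mat n"
  shows "((p, q, v), 0) \<in> K0_rel \<phi> \<longleftrightarrow>
    (\<exists>r s x y. projection r \<and> projection s \<and>
      partial_isometry_from_to x (p \<oplus>\<^bsub>n\<^esub> r) s \<and> partial_isometry_from_to y (q \<oplus>\<^bsub>n\<^esub> r) s \<and>
      homotopic_unitaries UNIV (\<Phi> s) (\<Phi> y * (v \<oplus>\<^bsub>n\<^esub> \<Phi> r) * \<Phi> (star x)) (\<Phi> s))"
    (is "_ \<longleftrightarrow> ?R")
proof
  have N: "p \<in> fin_mat n" "q \<in> fin_mat n" "v \<in> fin_mat n"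
    using n by (auto simp: triple_mat_def)
  have P: "projection p" "projection q" and v: "partial_isometry_from_to v (\<Phi> p) (\<Phi> q)"
    using G by (auto simp: Gamma0_iff)
  {
    assume rel: "((p, q, v), 0) \<in> K0_rel \<phi>"
    have "0 \<in> triple_mat n" by (simp add: triple_mat_def zero_prod_def)
    then obtain \<tau> \<tau>' where e: "\<tau> \<in> elementary \<phi>" "\<tau>' \<in> elementary \<phi>"
      and i: "iso ((p, q, v) + shift_triple n \<tau>) (0 + shift_triple n \<tau>')"
      using n by (metis K0_relE[OF rel])
    obtain r u where t: "\<tau> = (r, r, u)" using e by (auto simp: elementary_def)
    let ?r = "0 \<oplus>\<^bsub>n\<^esub> r" and ?u = "0 \<oplus>\<^bsub>n\<^esub> u"
    have r: "projection r" using elementary_Gamma0[OF e(1)] t by (auto simp: Gamma0_iff)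
    have "(?r, ?r, ?u) \<in> elementary \<phi>" using elementary_shift[OF e(1), of n] t by simp
    then obtain U where U: "matrix_path U" "U 0 = \<Phi> ?r" "U 1 = ?u"
      and Ut: "\<And>t. t \<in> {0..1} \<Longrightarrow> partial_isometry_from_to (U t) (\<Phi> ?r) (\<Phi> ?r)"
      by (rule elementaryE) blast
    obtain s w W where s: "shift_triple n \<tau>' = (s, s, w)" "projection s" and W: "matrix_path W" "W 0 = \<Phi> s" "W 1 = w"
      and Wt: "\<And>t. t \<in> {0..1} \<Longrightarrow> partial_isometry_from_to (W t) (\<Phi> s) (\<Phi> s)"
      using elementary_shift[OF e(2), of n] by (rule elementaryE) blast
    from i have "iso (p + ?r, q + ?r, v + ?u) (s, s, w)"
      using t s by (simp del: triple_iso.simps)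
    then obtain x y where x: "partial_isometry_from_to x (p + ?r) s"
      and y: "partial_isometry_from_to y (q + ?r) s" and xy: "\<Phi> y * (v + ?u) = w * \<Phi> x"
      by auto
    have pr: "p * ?r = 0" "q * ?r = 0" "?r * p = 0"
      using mult_shift_block N projection_orth_sym[OF P(1), of ?r] pift_projection[OF pift_shift[OF r]]
        elementary_Gamma0[OF elementary_shift[OF e(1), of n]] t
      by (auto simp: Gamma0_iff)
    have PR: "\<Phi> p * \<Phi> ?r = 0" "\<Phi> ?r * \<Phi> p = 0"
      unfolding \<Phi>_simps(2)[symmetric] pr \<Phi>_simps(4) by simp_all
    have u: "partial_isometry_from_to ?u (\<Phi> ?r) (\<Phi> ?r)" using Ut[of 1] U by simp
    \<comment> \<open>The factor \<open>star (U t)\<close> undoes u: at 1 the relation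
      \<open>\<Phi> y * (v + ?u) = w * \<Phi> x\<close> gives
      \<open>\<Phi> y * (v + ?u) * (\<Phi> p + star ?u) * \<Phi> (star x)\<close>, in which u is
      replaced by \<open>\<Phi> ?r\<close>. At 0 both paths are trivial and Z is
      \<open>\<Phi> s\<close>.\<close>
    define Z where "Z t = W t * (\<Phi> x * (\<Phi> p + star (U t)) * \<Phi> (star x))" for t
    have X: "partial_isometry_from_to (\<Phi> x) (\<Phi> p + \<Phi> ?r) (\<Phi> s)"
      using pift_\<Phi>[OF x] by (simp only: \<Phi>_simps)
    have Zt: "partial_isometry_from_to (Z t) (\<Phi> s) (\<Phi> s)" if "t \<in> {0..1}" for t
    proof -
      have "partial_isometry_from_to (\<Phi> p + star (U t)) (\<Phi> p + \<Phi> ?r) (\<Phi> p + \<Phi> ?r)"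
        by (intro pift_add pift_self projection_hom[OF \<Phi>_hom] P pift_star Ut that PR)
      from pift_mult[OF pift_mult[OF pift_mult[OF pift_star[OF X] this] X] Wt[OF that]]
      show ?thesis by (simp only: Z_def mult.assoc \<Phi>_simps)
    qed
    have "v * star ?u = 0" "?u * \<Phi> p = 0" "star (\<Phi> ?r) = \<Phi> ?r"
      using mult_zero_between[OF pift_simps(3)[OF v] pift_simps(5)[OF u] PR(1)]
        mult_zero_between[OF pift_simps(3)[OF u] _ PR(2), of "\<Phi> p"] P(1)[THEN projection_hom[OF \<Phi>_hom]]
        pift_projection(1)[OF u]
      by (simp_all add: projection_def)
    then have vu: "(v + ?u) * (\<Phi> p + star ?u) = v + \<Phi> ?r"
      using pift_simps[OF v] pift_simps[OF u] by (simp add: distrib_left distrib_right del: \<Phi>_block)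
    have "Z 0 = \<Phi> s"
      unfolding Z_def U W using pift_simps[OF X] \<open>star (\<Phi> ?r) = \<Phi> ?r\<close> s(2)[THEN projection_hom[OF \<Phi>_hom]]
      by (simp add: projection_def del: \<Phi>_block)
    moreover have "Z 1 = \<Phi> y * (v \<oplus>\<^bsub>n\<^esub> \<Phi> r) * \<Phi> (star x)"
    proof -
      have "Z 1 = w * \<Phi> x * (\<Phi> p + star ?u) * \<Phi> (star x)"
        unfolding Z_def U W by (simp only: mult.assoc)
      also have "\<dots> = \<Phi> y * ((v + ?u) * (\<Phi> p + star ?u)) * \<Phi> (star x)"
        unfolding xy[symmetric] by (simp only: mult.assoc)
      finally show ?thesis
        unfolding vu dsum_eq[OF N(3)] by simp
    qed
    moreover have "matrix_path Z"
      unfolding Z_def by (intro matrix_path_mult matrix_path_add matrix_path_star matrix_path_const U W)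
    ultimately have "homotopic_unitaries UNIV (\<Phi> s) (\<Phi> y * (v \<oplus>\<^bsub>n\<^esub> \<Phi> r) * \<Phi> (star x)) (\<Phi> s)"
      using Zt matrix_path_reverse[of Z]
      by (subst homotopic_unitaries_iff) (auto intro!: exI[of _ "\<lambda>t. Z (1 - t)"] projection_hom[OF \<Phi>_hom] s(2))
    with x y r s(2) show ?R
      unfolding dsum_eq[OF N(1), symmetric] dsum_eq[OF N(2), symmetric] by blast
  }
  assume ?R
  then obtain r s x y where r: "projection r" and s: "projection s"
    and x: "partial_isometry_from_to x (p \<oplus>\<^bsub>n\<^esub> r) s" and y: "partial_isometry_from_to y (q \<oplus>\<^bsub>n\<^esub> r) s"
    and h: "homotopic_unitaries UNIV (\<Phi> s) (\<Phi> y * (v \<oplus>\<^bsub>n\<^esub> \<Phi> r) * \<Phi> (star x)) (\<Phi> s)"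
    by blast
  from h obtain V where V: "matrix_path V" "V 0 = \<Phi> y * (v \<oplus>\<^bsub>n\<^esub> \<Phi> r) * \<Phi> (star x)" "V 1 = \<Phi> s"
    and Vt: "\<And>t. t \<in> {0..1} \<Longrightarrow> partial_isometry_from_to (V t) (\<Phi> s) (\<Phi> s)"
    by (subst (asm) homotopic_unitaries_iff) (auto intro: projection_hom[OF \<Phi>_hom] s)
  have e: "(r, r, \<Phi> r) \<in> elementary \<phi>" by (rule elementary_self[OF r])
  have sum: "(p \<oplus>\<^bsub>n\<^esub> r, q \<oplus>\<^bsub>n\<^esub> r, v \<oplus>\<^bsub>n\<^esub> \<Phi> r) \<in> Gamma0 \<phi>"
    using triple_sum_Gamma0[OF G elementary_Gamma0[OF e] n] by simp
  \<comment> \<open>This triple is the transport of the direct sum along x and y, and the reversed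
    homotopy is its path from the projection.\<close>
  have e': "(s, s, \<Phi> y * (v \<oplus>\<^bsub>n\<^esub> \<Phi> r) * \<Phi> (star x)) \<in> elementary \<phi>"
    by (rule elementaryI[of _ "\<lambda>t. V (1 - t)"]) (use V Vt s in auto)
  have "((p \<oplus>\<^bsub>n\<^esub> r, q \<oplus>\<^bsub>n\<^esub> r, v \<oplus>\<^bsub>n\<^esub> \<Phi> r), (s, s, \<Phi> y * (v \<oplus>\<^bsub>n\<^esub> \<Phi> r) * \<Phi> (star x))) \<in> K0_rel \<phi>"
    by (rule K0_rel_iso[OF sum transport[OF sum x y]])
  moreover have "((p, q, v) \<oplus>\<oplus>\<^bsub>n\<^esub> (r, r, \<Phi> r), (p, q, v)) \<in> K0_rel \<phi>"
    unfolding triple_sum_eq[OF n]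
    by (intro K0_rel_add_elementary G elementary_shift e orth_shift n)
  moreover have "(0 + (s, s, \<Phi> y * (v \<oplus>\<^bsub>n\<^esub> \<Phi> r) * \<Phi> (star x)), 0) \<in> K0_rel \<phi>"
    by (intro K0_rel_add_elementary zero_Gamma0 e') (simp add: zero_prod_def)
  ultimately show "((p, q, v), 0) \<in> K0_rel \<phi>"
    unfolding triple_sum.simps add_0_left by (meson K0_rel_trans K0_rel_sym)
qed

text \<open>Compared with the general criterion, r is enlarged to \<open>id_mat k\<close>, and x and
  y are merged into the single w = \<open>star x * y\<close>, which is then corrected to have the
  prescribed scalar part.\<close>

lemma vanishing_normal_form:
  assumes nm: "n \<le> m" and p: "p \<in> fin_mat m" and G: "(p, id_mat n, v) \<in> Gamma0 \<phi>"
    and sp: "scalar_mat p = id_mat n" and sv: "scalar_mat v = id_mat n"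
  shows "((p, id_mat n, v), 0) \<in> K0_rel \<phi> \<longleftrightarrow>
    (\<exists>k w. w \<in> fin_mat (m + k) \<and>
      partial_isometry_from_to w (padded_id m n k) (p \<oplus>\<^bsub>m\<^esub> id_mat k) \<and>
      scalar_mat w = padded_id m n k \<and>
      homotopic_unitaries (fin_mat (m + k)) (padded_id m n k)
        ((v \<oplus>\<^bsub>m\<^esub> id_mat k) * \<Phi> w) (padded_id m n k))"
    (is "_ \<longleftrightarrow> ?R")
proof
  have P: "projection p" and v: "partial_isometry_from_to v (\<Phi> p) (id_mat n)"
    using G by (auto simp: Gamma0_iff)
  have idn: "id_mat n \<in> fin_mat m" using nm by auto
  have vm: "v \<in> fin_mat m" by (rule pift_fin_mat[OF v]) (use p nm in auto)
  have T: "(p, id_mat n, v) \<in> triple_mat m" using p vm nm by (auto simp: triple_mat_def)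
  note vanish = vanishing[OF G T]
  have e: "projection (id_mat n \<oplus>\<^bsub>m\<^esub> id_mat k :: 'c::cstar_algebra unitization minf)"
    "(id_mat n \<oplus>\<^bsub>m\<^esub> id_mat k :: 'c unitization minf) \<in> fin_mat (m + k)" for k
    by (rule projection_dsum) (use nm in auto)
  {
    assume ?R
    then obtain k w where w: "partial_isometry_from_to w (id_mat n \<oplus>\<^bsub>m\<^esub> id_mat k) (p \<oplus>\<^bsub>m\<^esub> id_mat k)"
      and h: "homotopic_unitaries (fin_mat (m + k)) (id_mat n \<oplus>\<^bsub>m\<^esub> id_mat k)
        ((v \<oplus>\<^bsub>m\<^esub> id_mat k) * \<Phi> w) (id_mat n \<oplus>\<^bsub>m\<^esub> id_mat k)"
      unfolding padded_id_eq[OF nm] by blast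
    let ?e = "id_mat n \<oplus>\<^bsub>m\<^esub> id_mat k"
    from h obtain V where V: "matrix_path V" "V 0 = (v \<oplus>\<^bsub>m\<^esub> id_mat k) * \<Phi> w" "V 1 = ?e"
      and Vt: "\<forall>t\<in>{0..1}. partial_isometry_from_to (V t) ?e ?e"
      by (subst (asm) homotopic_unitaries_iff) (auto intro: e pift_fin_mat)
    \<comment> \<open>For the converse the general criterion is used with r =
      \<open>id_mat k\<close>, s = y = \<open>?e\<close> and x = \<open>star w\<close>, so the left
      factor \<open>\<Phi> y\<close> has to be absorbed.\<close>
    have "?e * ((v \<oplus>\<^bsub>m\<^esub> id_mat k) * \<Phi> w) = (v \<oplus>\<^bsub>m\<^esub> id_mat k) * \<Phi> w"
      using bspec[OF Vt, of 0] pift_simps(4)[of "V 0" ?e ?e] V by simp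
    then have "homotopic_unitaries UNIV (\<Phi> ?e) (\<Phi> ?e * (v \<oplus>\<^bsub>m\<^esub> \<Phi> (id_mat k)) * \<Phi> (star (star w))) (\<Phi> ?e)"
      using V Vt by (subst homotopic_unitaries_iff) (auto simp: mult.assoc intro: e)
    with vanish show "((p, id_mat n, v), 0) \<in> K0_rel \<phi>"
      using pift_star[OF w] pift_self[OF e(1)[of k]] e(1)[of k] projection_id_mat[of k] by blast
  next
    assume "((p, id_mat n, v), 0) \<in> K0_rel \<phi>"
    then obtain r s x y where r: "projection r" and s: "projection s"
      and x: "partial_isometry_from_to x (p \<oplus>\<^bsub>m\<^esub> r) s" and y: "partial_isometry_from_to y (id_mat n \<oplus>\<^bsub>m\<^esub> r) s"
      and h: "homotopic_unitaries UNIV (\<Phi> s) (\<Phi> y * (v \<oplus>\<^bsub>m\<^esub> \<Phi> r) * \<Phi> (star x)) (\<Phi> s)"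
      using vanish by blast
    from h obtain V where V: "matrix_path V" "V 0 = \<Phi> y * (v \<oplus>\<^bsub>m\<^esub> \<Phi> r) * \<Phi> (star x)" "V 1 = \<Phi> s"
      and Vt: "\<And>t. t \<in> {0..1} \<Longrightarrow> partial_isometry_from_to (V t) (\<Phi> s) (\<Phi> s)"
      by (subst (asm) homotopic_unitaries_iff) (auto intro: projection_hom[OF \<Phi>_hom] s)
    obtain k where k: "r \<in> fin_mat k" using mat_exhaust by blast
    let ?e = "id_mat n \<oplus>\<^bsub>m\<^esub> id_mat k"
    \<comment> \<open>f is what r lacks to fill \<open>id_mat k\<close>. Both w0 and the path are
      extended by the identity on f.\<close>
    define f where "f = 0 \<oplus>\<^bsub>m\<^esub> (id_mat k - r)"
    have kr: "projection (id_mat k - r)"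
      by (rule projection_diff[OF r projection_id_mat]) (simp add: id_mat_mult k)
    have rk: "r * (id_mat k - r) = 0" "(id_mat k - r) * r = 0"
      using k r by (simp_all add: id_mat_mult left_diff_distrib right_diff_distrib projection_def)
    have f: "projection f"
      unfolding f_def by (intro pift_projection(2)[OF pift_shift[of _ k]] kr) (use k in auto)
    have orth: "(a \<oplus>\<^bsub>m\<^esub> r) * f = 0" "f * (a \<oplus>\<^bsub>m\<^esub> r) = 0" "(a \<oplus>\<^bsub>m\<^esub> r) + f = a \<oplus>\<^bsub>m\<^esub> id_mat k"
      if "a \<in> fin_mat m" for a
    proof -
      \<comment> \<open>\<open>mult_shift_block\<close> annihilates the shifted block only on the
        right of a matrix; taking adjoints gives the other side.\<close>
      have "f * a = 0"
        using arg_cong[OF mult_shift_block[OF fin_mat_star[OF that], of "id_mat k - r"], of star] f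
        by (simp add: star_mult f_def projection_def)
      then show "(a \<oplus>\<^bsub>m\<^esub> r) * f = 0" "f * (a \<oplus>\<^bsub>m\<^esub> r) = 0"
        unfolding dsum_eq[OF that] distrib_left distrib_right
        using mult_shift_block[OF that, of "id_mat k - r"] by (simp_all add: f_def shift_block_mult rk)
      show "(a \<oplus>\<^bsub>m\<^esub> r) + f = a \<oplus>\<^bsub>m\<^esub> id_mat k"
        by (simp add: f_def block_mat_add)
    qed
    define w0 where "w0 = star x * y"
    have w0: "partial_isometry_from_to w0 (id_mat n \<oplus>\<^bsub>m\<^esub> r) (p \<oplus>\<^bsub>m\<^esub> r)"
      unfolding w0_def by (rule pift_mult[OF y pift_star[OF x]])
    define w1 where "w1 = w0 + f"
    have w1: "partial_isometry_from_to w1 ?e (p \<oplus>\<^bsub>m\<^esub> id_mat k)"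
      using pift_add[OF w0 pift_self[OF f] orth(1)[OF idn] orth(1)[OF p]]
      unfolding orth(3)[OF idn] orth(3)[OF p] w1_def .
    define u where "u = (v \<oplus>\<^bsub>m\<^esub> id_mat k) * \<Phi> w1"
    define Y where "Y t = \<Phi> (star y) * V t * \<Phi> y + \<Phi> f" for t
    have orthB: "\<Phi> (id_mat n \<oplus>\<^bsub>m\<^esub> r) * \<Phi> f = 0" "\<Phi> (id_mat n \<oplus>\<^bsub>m\<^esub> r) + \<Phi> f = ?e"
      "\<Phi> f * \<Phi> (p \<oplus>\<^bsub>m\<^esub> r) = 0" "\<Phi> (p \<oplus>\<^bsub>m\<^esub> r) * \<Phi> f = 0"
      using orth(1)[OF idn] orth(3)[OF idn] orth(1,2)[OF p]
      by (simp_all only: \<Phi>_simps(1,2)[symmetric] \<Phi>_simps(4)) simp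
    note yB = pift_\<Phi>[OF y] and xB = pift_\<Phi>[OF x] and w0B = pift_\<Phi>[OF w0]
      and fB = projection_hom[OF \<Phi>_hom f]
    have Yt: "partial_isometry_from_to (Y t) ?e ?e" if "t \<in> {0..1}" for t
    proof -
      have "partial_isometry_from_to (\<Phi> (star y) * V t * \<Phi> y) (\<Phi> (id_mat n \<oplus>\<^bsub>m\<^esub> r)) (\<Phi> (id_mat n \<oplus>\<^bsub>m\<^esub> r))"
        using pift_mult[OF pift_mult[OF yB Vt[OF that]] pift_\<Phi>[OF pift_star[OF y]]]
        by (simp only: mult.assoc)
      from pift_add[OF this pift_self[OF fB] orthB(1,1)] show ?thesis
        unfolding orthB(2) Y_def .
    qed
    have Y0: "Y 0 = u"
    proof -
      have vr: "partial_isometry_from_to (v \<oplus>\<^bsub>m\<^esub> \<Phi> r) (\<Phi> (p \<oplus>\<^bsub>m\<^esub> r)) (\<Phi> (id_mat n \<oplus>\<^bsub>m\<^esub> r))"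
        using triple_sum_Gamma0[OF G elementary_Gamma0[OF elementary_self[OF r]] T]
        by (simp add: Gamma0_iff)
      have vk: "v \<oplus>\<^bsub>m\<^esub> id_mat k = (v \<oplus>\<^bsub>m\<^esub> \<Phi> r) + \<Phi> f"
        by (simp add: f_def block_mat_add)
      have z: "(v \<oplus>\<^bsub>m\<^esub> \<Phi> r) * \<Phi> f = 0" "\<Phi> f * \<Phi> w0 = 0"
        using mult_zero_between[OF pift_simps(3)[OF vr] _ orthB(4), of "\<Phi> f"]
          mult_zero_between[OF _ pift_simps(4)[OF w0B] orthB(3), of "\<Phi> f"] fB
        by (auto simp: projection_def)
      have "Y 0 = (\<Phi> (star y) * \<Phi> y) * (v \<oplus>\<^bsub>m\<^esub> \<Phi> r) * \<Phi> w0 + \<Phi> f"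
        unfolding Y_def V w0_def \<Phi>_simps(2) by (simp only: mult.assoc)
      also have "\<dots> = (v \<oplus>\<^bsub>m\<^esub> \<Phi> r) * \<Phi> w0 + \<Phi> f"
        using pift_simps(1)[OF yB] pift_simps(4)[OF vr] by (simp only: \<Phi>_simps(3))
      also have "\<dots> = u"
        unfolding u_def vk w1_def \<Phi>_simps(1) distrib_left distrib_right z
        using fB by (simp add: projection_def)
      finally show ?thesis .
    qed
    have Y1: "Y 1 = ?e"
      unfolding Y_def V using pift_simps(1)[OF yB] pift_simps(4)[OF yB] orthB(2)
      by (simp only: mult.assoc \<Phi>_simps(3))
    define w where "w = w1 * star (scalar_mat w1)"
    have se: "scalar_mat ?e = ?e" "scalar_mat (?e :: 'b unitization minf) = ?e"
      "scalar_mat (p \<oplus>\<^bsub>m\<^esub> id_mat k) = ?e" "scalar_mat (v \<oplus>\<^bsub>m\<^esub> id_mat k) = ?e"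
      by (simp_all add: sp sv)
    have sw1: "partial_isometry_from_to (scalar_mat w1) ?e ?e"
      using pift_hom[OF ring_star_hom_scalar_mat w1] unfolding se .
    have w: "partial_isometry_from_to w ?e (p \<oplus>\<^bsub>m\<^esub> id_mat k)"
      unfolding w_def by (rule pift_mult[OF pift_star[OF sw1] w1])
    have ss: "scalar_mat (scalar_mat a) = scalar_mat a" for a :: "'a unitization minf"
      by (simp add: scalar_mat_eq amplify_amplify star_hom_zero comp_def)
    have sw: "scalar_mat w = ?e"
      unfolding w_def using pift_simps(2)[OF sw1] by (simp add: ss)
    have "partial_isometry_from_to (scalar_mat (Y t)) ?e ?e" if "t \<in> {0..1}" for t
      using pift_hom[OF ring_star_hom_scalar_mat Yt[OF that]] unfolding se .
    then have Zt: "partial_isometry_from_to (Y t * star (scalar_mat (Y t))) ?e ?e" if "t \<in> {0..1}" for t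
      using pift_mult[OF pift_star Yt] that by blast
    \<comment> \<open>The correction of the path agrees at 0 with that of w: since the scalar part
      of v is \<open>id_mat n\<close>, that of u is just
      \<open>\<Phi> (scalar_mat w1)\<close>.\<close>
    have Z0: "Y 0 * star (scalar_mat (Y 0)) = (v \<oplus>\<^bsub>m\<^esub> id_mat k) * \<Phi> w"
    proof -
      have "partial_isometry_from_to (scalar_mat (\<Phi> w1)) ?e ?e"
        using pift_\<Phi>[OF sw1] by (simp add: scalar_mat_\<Phi>)
      then have "scalar_mat u = \<Phi> (scalar_mat w1)"
        unfolding u_def scalar_mat_simps(3) se scalar_mat_\<Phi> by (rule pift_simps(4))
      then show ?thesis
        unfolding Y0 w_def \<Phi>_simps(2,3) by (simp only: u_def mult.assoc)
    qed
    have Z1: "Y 1 * star (scalar_mat (Y 1)) = ?e"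
    proof -
      have "projection (?e :: 'b unitization minf)" by (rule e)
      then show ?thesis unfolding Y1 se by (simp only: projection_def)
    qed
    have "matrix_path (\<lambda>t. Y t * star (scalar_mat (Y t)))"
      unfolding Y_def
      by (intro matrix_path_mult matrix_path_add matrix_path_star matrix_path_scalar matrix_path_const V)
    then have "homotopic_unitaries (fin_mat (m + k)) ?e ((v \<oplus>\<^bsub>m\<^esub> id_mat k) * \<Phi> w) ?e"
      using Zt Z0 Z1
      by (subst homotopic_unitaries_iff) (auto intro: e pift_fin_mat exI[of _ "\<lambda>t. Y t * star (scalar_mat (Y t))"])
    moreover have "w \<in> fin_mat (m + k)"
      by (rule pift_fin_mat[OF w e(2)]) (intro fin_mat_dsum p fin_mat_id order_refl)
    ultimately show ?R
      unfolding padded_id_eq[OF nm] using w sw by blast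
  }
qed

end

theorem proposition3p3:
  fixes \<phi> :: "'a::cstar_algebra \<Rightarrow> 'b::cstar_algebra"
  assumes "star_hom \<phi>"
  shows
    \<comment> \<open>(i)\<close>
    "(\<forall>p q v v' V.
        projection p \<and> projection q \<and>
        partial_isometry_from_to v (amplify \<phi> p) (amplify \<phi> q) \<and>
        partial_isometry_from_to v' (amplify \<phi> p) (amplify \<phi> q) \<and>
        matrix_path V \<and> V 0 = v \<and> V 1 = v' \<and>
        (\<forall>t\<in>{0..1}. partial_isometry_from_to (V t) (amplify \<phi> p) (amplify \<phi> q))
        \<longrightarrow> K0_class \<phi> (p, q, v) = K0_class \<phi> (p, q, v')) \<and>
     \<comment> \<open>(ii)\<close>
     (\<forall>p q r v w.
        projection p \<and> projection q \<and> projection r \<and>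
        partial_isometry_from_to v (amplify \<phi> p) (amplify \<phi> q) \<and>
        partial_isometry_from_to w (amplify \<phi> q) (amplify \<phi> r)
        \<longrightarrow> K0_add \<phi> (K0_class \<phi> (p, q, v)) (K0_class \<phi> (q, r, w)) = K0_class \<phi> (p, r, w * v)) \<and>
     \<comment> \<open>(iii)\<close>
     (\<forall>p q v p' q' v' n.
        (p, q, v) \<in> Gamma0 \<phi> \<and> (p', q', v') \<in> Gamma0 \<phi> \<and>
        (p, q, v) \<in> triple_mat n \<and> (p', q', v') \<in> triple_mat n
        \<longrightarrow> (p * p' = 0 \<longrightarrow>
              triple_iso \<phi> ((p, q, v) \<oplus>\<oplus>\<^bsub>n\<^esub> (p', q', v'))
                (p + p', q \<oplus>\<^bsub>n\<^esub> q', block_mat n v 0 v' 0)) \<and>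
            (q * q' = 0 \<longrightarrow>
              triple_iso \<phi> ((p, q, v) \<oplus>\<oplus>\<^bsub>n\<^esub> (p', q', v'))
                (p \<oplus>\<^bsub>n\<^esub> p', q + q', block_mat n v v' 0 0)) \<and>
            (p * p' = 0 \<and> q * q' = 0 \<longrightarrow>
              triple_iso \<phi> ((p, q, v) \<oplus>\<oplus>\<^bsub>n\<^esub> (p', q', v'))
                (p + p', q + q', v + v'))) \<and>
     \<comment> \<open>(iv)\<close>
     (\<forall>\<sigma>\<in>Gamma0 \<phi>.
        (\<exists>n p v. n \<ge> 1 \<and> (p, id_mat n, v) \<in> Gamma0 \<phi> \<and>
           scalar_mat p = id_mat n \<and> scalar_mat v = id_mat n \<and>
           (\<sigma>, (p, id_mat n, v)) \<in> K0_rel \<phi>) \<and>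
        (\<exists>n q v. n \<ge> 1 \<and> (id_mat n, q, v) \<in> Gamma0 \<phi> \<and>
           scalar_mat q = id_mat n \<and> scalar_mat v = id_mat n \<and>
           (\<sigma>, (id_mat n, q, v)) \<in> K0_rel \<phi>)) \<and>
     \<comment> \<open>(v)\<close>
     (\<forall>p q v n.
        (p, q, v) \<in> Gamma0 \<phi> \<and> (p, q, v) \<in> triple_mat n
        \<longrightarrow> (K0_class \<phi> (p, q, v) = K0_zero \<phi> \<longleftrightarrow>
             (\<exists>r s x y. projection r \<and> projection s \<and>
                partial_isometry_from_to x (p \<oplus>\<^bsub>n\<^esub> r) s \<and>
                partial_isometry_from_to y (q \<oplus>\<^bsub>n\<^esub> r) s \<and>
                homotopic_unitaries UNIV (amplify \<phi> s)
                  (amplify \<phi> y * (v \<oplus>\<^bsub>n\<^esub> amplify \<phi> r) * amplify \<phi> (star x))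
                  (amplify \<phi> s)))) \<and>
     (\<forall>m n p v.
        n \<le> m \<and> p \<in> fin_mat m \<and> (p, id_mat n, v) \<in> Gamma0 \<phi> \<and>
        scalar_mat p = id_mat n \<and> scalar_mat v = id_mat n
        \<longrightarrow> (K0_class \<phi> (p, id_mat n, v) = K0_zero \<phi> \<longleftrightarrow>
             (\<exists>k w. w \<in> fin_mat (m + k) \<and>
                partial_isometry_from_to w (padded_id m n k) (p \<oplus>\<^bsub>m\<^esub> id_mat k) \<and>
                scalar_mat w = padded_id m n k \<and>
                homotopic_unitaries (fin_mat (m + k)) (padded_id m n k)
                  ((v \<oplus>\<^bsub>m\<^esub> id_mat k) * amplify \<phi> w)
                  (padded_id m n k))))"

proof -
  interpret cstar_hom \<phi> by unfold_locales fact
  show ?thesis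
  proof (intro conjI; intro allI impI ballI)
    fix p q v v' V
    assume "projection p \<and> projection q \<and>
        partial_isometry_from_to v (\<Phi> p) (\<Phi> q) \<and>
        partial_isometry_from_to v' (\<Phi> p) (\<Phi> q) \<and>
        matrix_path V \<and> V 0 = v \<and> V 1 = v' \<and>
        (\<forall>t\<in>{0..1}. partial_isometry_from_to (V t) (\<Phi> p) (\<Phi> q))"
    then have "((p, q, v), (p, q, v')) \<in> K0_rel \<phi>"
      by (intro K0_rel_homotopic[of _ _ _ _ V]) (auto simp: Gamma0_iff)
    then show "K0_class \<phi> (p, q, v) = K0_class \<phi> (p, q, v')"
      by (meson K0_class_eq_iff K0_rel_Gamma0)
  next
    fix p q r v w
    assume "projection p \<and> projection q \<and> projection r \<and>
        partial_isometry_from_to v (\<Phi> p) (\<Phi> q) \<and> partial_isometry_from_to w (\<Phi> q) (\<Phi> r)"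
    then show "K0_add \<phi> (K0_class \<phi> (p, q, v)) (K0_class \<phi> (q, r, w)) = K0_class \<phi> (p, r, w * v)"
      by (intro K0_add_comp) (auto simp: Gamma0_iff)
  next
    fix p q v p' q' v' n
    assume *: "(p, q, v) \<in> Gamma0 \<phi> \<and> (p', q', v') \<in> Gamma0 \<phi> \<and>
        (p, q, v) \<in> triple_mat n \<and> (p', q', v') \<in> triple_mat n"
    from * show "(p * p' = 0 \<longrightarrow>
              triple_iso \<phi> ((p, q, v) \<oplus>\<oplus>\<^bsub>n\<^esub> (p', q', v'))
                (p + p', q \<oplus>\<^bsub>n\<^esub> q', block_mat n v 0 v' 0)) \<and>
            (q * q' = 0 \<longrightarrow>
              triple_iso \<phi> ((p, q, v) \<oplus>\<oplus>\<^bsub>n\<^esub> (p', q', v'))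
                (p \<oplus>\<^bsub>n\<^esub> p', q + q', block_mat n v v' 0 0)) \<and>
            (p * p' = 0 \<and> q * q' = 0 \<longrightarrow>
              triple_iso \<phi> ((p, q, v) \<oplus>\<oplus>\<^bsub>n\<^esub> (p', q', v'))
                (p + p', q + q', v + v'))"
      using orthogonal_sum_iso[of p q v p' q' v' n] by blast
  next
    fix \<sigma> assume "\<sigma> \<in> Gamma0 \<phi>"
    then show "(\<exists>n p v. n \<ge> 1 \<and> (p, id_mat n, v) \<in> Gamma0 \<phi> \<and>
           scalar_mat p = id_mat n \<and> scalar_mat v = id_mat n \<and>
           (\<sigma>, (p, id_mat n, v)) \<in> K0_rel \<phi>) \<and>
        (\<exists>n q v. n \<ge> 1 \<and> (id_mat n, q, v) \<in> Gamma0 \<phi> \<and>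
           scalar_mat q = id_mat n \<and> scalar_mat v = id_mat n \<and>
           (\<sigma>, (id_mat n, q, v)) \<in> K0_rel \<phi>)"
      by (intro conjI normal_form normal_form_reverse)
  next
    fix p q v n
    assume "(p, q, v) \<in> Gamma0 \<phi> \<and> (p, q, v) \<in> triple_mat n"
    then show "K0_class \<phi> (p, q, v) = K0_zero \<phi> \<longleftrightarrow>
             (\<exists>r s x y. projection r \<and> projection s \<and>
                partial_isometry_from_to x (p \<oplus>\<^bsub>n\<^esub> r) s \<and>
                partial_isometry_from_to y (q \<oplus>\<^bsub>n\<^esub> r) s \<and>
                homotopic_unitaries UNIV (\<Phi> s)
                  (\<Phi> y * (v \<oplus>\<^bsub>n\<^esub> \<Phi> r) * \<Phi> (star x))
                  (\<Phi> s))"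
      using K0_zero_iff vanishing by simp
  next
    fix m n p v
    assume *: "n \<le> m \<and> p \<in> fin_mat m \<and> (p, id_mat n, v) \<in> Gamma0 \<phi> \<and>
        scalar_mat p = id_mat n \<and> scalar_mat v = id_mat n"
    then have G: "(p, id_mat n, v) \<in> Gamma0 \<phi>" by blast
    show "K0_class \<phi> (p, id_mat n, v) = K0_zero \<phi> \<longleftrightarrow>
             (\<exists>k w. w \<in> fin_mat (m + k) \<and>
                partial_isometry_from_to w (padded_id m n k) (p \<oplus>\<^bsub>m\<^esub> id_mat k) \<and>
                scalar_mat w = padded_id m n k \<and>
                homotopic_unitaries (fin_mat (m + k)) (padded_id m n k)
                  ((v \<oplus>\<^bsub>m\<^esub> id_mat k) * \<Phi> w)
                  (padded_id m n k))"
      unfolding K0_zero_iff[OF G] using * by (intro vanishing_normal_form) simp_all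
  qed
qed

end
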